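(* Let $X$ be in Class 1 or Class 2. Then for all $x\in I$, $\delta>0$, $\alpha>0$ and $\beta\ge 0$, $$\mathbf E_x\left(e^{-\alpha\theta_\delta-\beta M_{\theta_\delta}}\right)=\frac{\psi_\alpha(x)}{\psi_\alpha(x\vee(\delta+l))}\int_{x\vee(\delta+l)}^{\infty}c_\alpha(y;\delta)\,\exp\left(-\beta y-\int_{x\vee(\delta+l)}^{y}b_\alpha(z;\delta)\,dS(z)\right)dS(y),$$ where $$b_\alpha(y;\delta):=\frac{\varphi_\alpha(y-\delta)\psi_\alpha^-(y)-\varphi_\alpha^-(y)\psi_\alpha(y-\delta)}{\varphi_\alpha(y-\delta)\psi_\alpha(y)-\varphi_\alpha(y)\psi_\alpha(y-\delta)}$$ and $$c_\alpha(y;\delta):=\frac{\varphi_\alpha(y)\psi_\alpha^-(y)-\varphi_\alpha^-(y)\psi_\alpha(y)}{\varphi_\alpha(y-\delta)\psi_\alpha(y)-\varphi_\alpha(y)\psi_\alpha(y-\delta)}=\frac{w_\alpha}{\varphi_\alpha(y-\delta)\psi_\alpha(y)-\varphi_\alpha(y)\psi_\alpha(y-\delta)}.$$ Moreover, for $y\ge x\vee(\delta+l)$, $$\mathbf P_x(M_{\theta_\delta}>y)=\exp\left(-\int_{x\vee(\delta+l)}^{y}\frac{dS(z)}{S(z)-S(z-\delta)}\right).$$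
   Context: $X=(X_t)_{t\ge 0}$ is a regular one-dimensional diffusion in the sense of Itô and McKean (strong Markov, continuous paths) on an interval $I\subseteq\mathbb R$ with left endpoint $l\ge-\infty$ and right endpoint $r=+\infty$, not killed inside $I$. $\mathbf P_x,\mathbf E_x$ denote probability and expectation when $X_0=x$. $S$ is the scale function, assumed continuously differentiable, and $m$ is the speed measure, assumed to have a continuous density with respect to Lebesgue measure; the generator is $\frac{d}{dm}\frac{d}{dS}$. Class 1: $X$ is recurrent with either (a) $S(+\infty)=+\infty$, $S(l)=-\infty$, or (b) $S(+\infty)=+\infty$, $S(l)>-\infty$, $l>-\infty$ and $l$ reflecting. Class 2: $X$ is transient with either (a) $S(+\infty)<\infty$, $S(l)=-\infty$, or (b) $S(+\infty)<\infty$, $S(l)>-\infty$, $l>-\infty$ and $l$ reflecting. For $\alpha>0$, $\psi_\alpha$ (increasing) and $\varphi_\alpha$ (decreasing) are the positive solutions of $\frac{d}{dm}\frac{d}{dS}u=\alpha u$, unique up to multiplicative constants under the appropriate boundary conditions, such that, with $H_y:=\inf\{t\ge0: X_t=y\}$, $\mathbf E_x(e^{-\alpha H_y})=\psi_\alpha(x)/\psi_\alpha(y)$ for $x\le y$ and $\mathbf E_x(e^{-\alpha H_y})=\varphi_\alpha(x)/\varphi_\alpha(y)$ for $x\ge y$. The superscripts $^+$, $^-$ denote right and left derivatives with respect to $S$. The Wronskian $w_\alpha:=\psi_\alpha^-(x)\varphi_\alpha(x)-\psi_\alpha(x)\varphi_\alpha^-(x)$ does not depend on $x$. $M_t:=\max_{0\le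 s\le t}X_s$ and $\theta_\delta:=\inf\{t\ge0: M_t-X_t>\delta\}$ (with $\inf\emptyset=+\infty$). If $\theta_\delta=+\infty$ the convention $\exp(-\infty)=0$ is used, and $M_{\theta_\delta}=+\infty$ (the supremum of the whole path). $a\vee b=\max(a,b)$; if $l=-\infty$ then $x\vee(\delta+l)=x$. *)

theory Defs
  imports "HOL-Probability.Probability"
begin

text \<open>
  A family \<open>P x\<close> of probability measures (\<open>x \<in> I\<close>) on one measurable space \<open>Om\<close> carries the process
  \<open>X t\<close>, \<open>t \<ge> 0\<close>.  There is no killing inside \<open>I\<close>, but a transient path may reach the right endpoint
  \<open>+\<infinity>\<close> in finite time (explosion); therefore \<open>X\<close> is \<^typ>\<open>ereal\<close>-valued, with \<open>\<infinity>\<close> as the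
  cemetery in which the path stays from its lifetime on.
\<close>

subsection \<open>Functionals of the path\<close>

definition hitting_time :: "(real \<Rightarrow> 'a \<Rightarrow> ereal) \<Rightarrow> real \<Rightarrow> 'a \<Rightarrow> ereal" where
  "hitting_time X y \<omega> = Inf {ereal t | t. 0 \<le> t \<and> X t \<omega> = ereal y}"

definition running_max :: "(real \<Rightarrow> 'a \<Rightarrow> ereal) \<Rightarrow> real \<Rightarrow> 'a \<Rightarrow> ereal" where
  "running_max X t \<omega> = (SUP s\<in>{0..t}. X s \<omega>)"

text \<open>Only times before the lifetime count; note that \<open>\<infinity> - \<infinity> = \<infinity>\<close> in \<^typ>\<open>ereal\<close>.\<close>

definition drawdown_time :: "(real \<Rightarrow> 'a \<Rightarrow> ereal) \<Rightarrow> real \<Rightarrow> 'a \<Rightarrow> ereal" where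
  "drawdown_time X \<delta> \<omega> =
     Inf {ereal t | t. 0 \<le> t \<and> X t \<omega> < \<infinity> \<and> running_max X t \<omega> - X t \<omega> > ereal \<delta>}"

definition max_at_drawdown :: "(real \<Rightarrow> 'a \<Rightarrow> ereal) \<Rightarrow> real \<Rightarrow> 'a \<Rightarrow> ereal" where
  "max_at_drawdown X \<delta> \<omega> =
     (if drawdown_time X \<delta> \<omega> = \<infinity> then \<infinity>
      else running_max X (real_of_ereal (drawdown_time X \<delta> \<omega>)) \<omega>)"

text \<open>\<open>exp (- a)\<close> with the convention \<open>exp (- \<infinity>) = 0\<close>.\<close>

definition exp_neg :: "ereal \<Rightarrow> real" where
  "exp_neg a = (if a = \<infinity> then 0 else exp (- real_of_ereal a))"

subsection \<open>Diffusions\<close>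

definition path_space :: "(real \<Rightarrow> ereal) measure" where
  "path_space = PiM {0..} (\<lambda>_. borel)"

definition path_from :: "(real \<Rightarrow> 'a \<Rightarrow> ereal) \<Rightarrow> real \<Rightarrow> 'a \<Rightarrow> (real \<Rightarrow> ereal)" where
  "path_from X s \<omega> = (\<lambda>t\<in>{0..}. X (s + t) \<omega>)"

definition natural_filtration :: "'a measure \<Rightarrow> (real \<Rightarrow> 'a \<Rightarrow> ereal) \<Rightarrow> ereal \<Rightarrow> 'a measure" where
  "natural_filtration Om X t =
     sigma (space Om) {X s -` A \<inter> space Om | s A. 0 \<le> s \<and> ereal s \<le> t \<and> A \<in> sets borel}"

text \<open>The right-continuous filtration; its stopping times are the Markov times \<open>T\<close> of Ito and
  McKean, characterised by \<open>{T < t} \<in> F t\<close>.  The index runs over \<^typ>\<open>ereal\<close> so that stopping times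
  can take the value \<open>\<infinity>\<close>.\<close>

definition right_filtration :: "'a measure \<Rightarrow> (real \<Rightarrow> 'a \<Rightarrow> ereal) \<Rightarrow> ereal \<Rightarrow> 'a measure" where
  "right_filtration Om X t =
     sigma (space Om) {A \<in> sets Om. \<forall>u>t. A \<in> sets (natural_filtration Om X u)}"

definition alive_at :: "(real \<Rightarrow> 'a \<Rightarrow> ereal) \<Rightarrow> ('a \<Rightarrow> ereal) \<Rightarrow> 'a \<Rightarrow> bool" where
  "alive_at X T \<omega> \<longleftrightarrow> T \<omega> < \<infinity> \<and> X (real_of_ereal (T \<omega>)) \<omega> < \<infinity>"

locale regular_diffusion =
  fixes Om :: "'a measure" and P :: "real \<Rightarrow> 'a measure" and X :: "real \<Rightarrow> 'a \<Rightarrow> ereal"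
    and I :: "real set" and l :: ereal
  assumes left_endpoint: "l < \<infinity>"
    and state_interval: "I = {x. l < ereal x} \<or> I = {x. l \<le> ereal x}"
    and prob: "x \<in> I \<Longrightarrow> prob_space (P x)"
    and sets_P: "x \<in> I \<Longrightarrow> sets (P x) = sets Om"
    and measurable_X: "0 \<le> t \<Longrightarrow> X t \<in> borel_measurable Om"
    and kernel: "B \<in> sets path_space \<Longrightarrow>
      (\<lambda>x. emeasure (P x) {\<omega> \<in> space Om. path_from X 0 \<omega> \<in> B})
        \<in> borel_measurable (restrict_space borel I)"
    and state_space: "\<omega> \<in> space Om \<Longrightarrow> 0 \<le> t \<Longrightarrow> X t \<omega> \<in> ereal ` I \<union> {\<infinity>}"
    and continuous_paths: "\<omega> \<in> space Om \<Longrightarrow> continuous_on {0..} (\<lambda>t. X t \<omega>)"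
    and cemetery: "\<omega> \<in> space Om \<Longrightarrow> 0 \<le> s \<Longrightarrow> s \<le> t \<Longrightarrow> X s \<omega> = \<infinity> \<Longrightarrow> X t \<omega> = \<infinity>"
    and start: "x \<in> I \<Longrightarrow> AE \<omega> in P x. X 0 \<omega> = ereal x"
    and strong_Markov:
      "x \<in> I \<Longrightarrow> (\<And>\<omega>. \<omega> \<in> space Om \<Longrightarrow> 0 \<le> T \<omega>) \<Longrightarrow> stopping_time (right_filtration Om X) T \<Longrightarrow>
       A \<in> sets (filtration.pre_sigma (space Om) (right_filtration Om X) T) \<Longrightarrow>
       B \<in> sets path_space \<Longrightarrow>
       emeasure (P x) {\<omega> \<in> A. alive_at X T \<omega> \<and> path_from X (real_of_ereal (T \<omega>)) \<omega> \<in> B} =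
       (\<integral>\<^sup>+ \<omega>. indicator {\<omega> \<in> A. alive_at X T \<omega>} \<omega> *
          emeasure (P (real_of_ereal (X (real_of_ereal (T \<omega>)) \<omega>)))
            {\<omega>' \<in> space Om. path_from X 0 \<omega>' \<in> B} \<partial>P x)"
    and regular: "x \<in> I \<Longrightarrow> y \<in> I \<Longrightarrow>
      measure (P x) {\<omega> \<in> space (P x). hitting_time X y \<omega> < \<infinity>} > 0"

subsection \<open>Scale function and speed measure\<close>

definition scale_function ::
    "(real \<Rightarrow> 'a measure) \<Rightarrow> (real \<Rightarrow> 'a \<Rightarrow> ereal) \<Rightarrow> real set \<Rightarrow> (real \<Rightarrow> real) \<Rightarrow> bool" where
  "scale_function P X I S \<longleftrightarrow>
     strict_mono_on I S \<and> continuous_on I S \<and>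
     (\<forall>a\<in>I. \<forall>b\<in>I. \<forall>x\<in>{a..b}. a < b \<longrightarrow>
        measure (P x) {\<omega> \<in> space (P x). hitting_time X a \<omega> < hitting_time X b \<omega>}
          = (S b - S x) / (S b - S a))"

text \<open>Continuous differentiability is required in the interior only: for a reflecting Bessel process,
  say, \<open>S'\<close> may be unbounded near the left endpoint.\<close>

definition C1_scale :: "real set \<Rightarrow> (real \<Rightarrow> real) \<Rightarrow> bool" where
  "C1_scale I S \<longleftrightarrow>
     (\<forall>x\<in>interior I. S differentiable at x) \<and> continuous_on (interior I) (deriv S)"

text \<open>The Stieltjes measure \<open>dS\<close> of a continuously differentiable scale function.\<close>

definition dS :: "real set \<Rightarrow> (real \<Rightarrow> real) \<Rightarrow> real measure" where
  "dS I S = density lborel (\<lambda>z. ennreal (deriv S z) * indicator (interior I) z)"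

text \<open>
  The speed measure is characterised by mean exit times.  The Green kernels below are those of
  \<open>d/dm d/dS\<close> (without a factor \<open>1/2\<close>).  The second formula concerns a left endpoint that
  belongs to \<open>I\<close>, where the path is not stopped; it determines the mass of \<open>m\<close> at that endpoint.
\<close>

definition speed_measure :: "(real \<Rightarrow> 'a measure) \<Rightarrow> (real \<Rightarrow> 'a \<Rightarrow> ereal) \<Rightarrow> real set \<Rightarrow>
    (real \<Rightarrow> real) \<Rightarrow> real measure \<Rightarrow> bool" where
  "speed_measure P X I S m \<longleftrightarrow>
     sets m = sets borel \<and> emeasure m (- I) = 0 \<and>
     (\<forall>a\<in>I. \<forall>b\<in>I. \<forall>x\<in>{a..b}. a < b \<longrightarrow>
        (\<integral>\<^sup>+ \<omega>. e2ennreal (min (hitting_time X a \<omega>) (hitting_time X b \<omega>)) \<partial>P x) =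
        (\<integral>\<^sup>+ y\<in>{a<..<b}.
           ennreal ((S (min x y) - S a) * (S b - S (max x y)) / (S b - S a)) \<partial>m)) \<and>
     (\<forall>a\<in>I. \<forall>b\<in>I. \<forall>x\<in>{a..b}. a < b \<and> I = {a..} \<longrightarrow>
        (\<integral>\<^sup>+ \<omega>. e2ennreal (hitting_time X b \<omega>) \<partial>P x) =
        (\<integral>\<^sup>+ y\<in>{a..<b}. ennreal (S b - S (max x y)) \<partial>m))"

definition has_continuous_density :: "real set \<Rightarrow> real measure \<Rightarrow> bool" where
  "has_continuous_density I m \<longleftrightarrow>
     (\<exists>m'. continuous_on (interior I) m' \<and> (\<forall>y\<in>interior I. 0 \<le> m' y) \<and>
           m = density lborel (\<lambda>y. ennreal (m' y) * indicator (interior I) y))"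

subsection \<open>The two classes\<close>

definition recurrent :: "(real \<Rightarrow> 'a measure) \<Rightarrow> (real \<Rightarrow> 'a \<Rightarrow> ereal) \<Rightarrow> real set \<Rightarrow> bool" where
  "recurrent P X I \<longleftrightarrow>
     (\<forall>x\<in>I. \<forall>y\<in>I. measure (P x) {\<omega> \<in> space (P x). hitting_time X y \<omega> < \<infinity>} = 1)"

definition transient :: "(real \<Rightarrow> 'a measure) \<Rightarrow> (real \<Rightarrow> 'a \<Rightarrow> ereal) \<Rightarrow> real set \<Rightarrow> bool" where
  "transient P X I \<longleftrightarrow> \<not> recurrent P X I"

text \<open>Instantaneous reflection.  That the path leaves \<open>l\<close> is part of regularity, which holds for
  all starting points in \<open>I\<close>.\<close>

definition reflecting ::
    "(real \<Rightarrow> 'a measure) \<Rightarrow> (real \<Rightarrow> 'a \<Rightarrow> ereal) \<Rightarrow> real set \<Rightarrow> ereal \<Rightarrow> bool" where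
  "reflecting P X I l \<longleftrightarrow>
     l \<in> ereal ` I \<and>
     (\<forall>x\<in>I. AE \<omega> in P x. emeasure lborel {t. 0 \<le> t \<and> X t \<omega> = l} = 0)"

text \<open>As \<open>S\<close> is increasing, its limits at the endpoints are its supremum and infimum.\<close>

definition scale_right :: "real set \<Rightarrow> (real \<Rightarrow> real) \<Rightarrow> ereal" where
  "scale_right I S = (SUP x\<in>I. ereal (S x))"

definition scale_left :: "real set \<Rightarrow> (real \<Rightarrow> real) \<Rightarrow> ereal" where
  "scale_left I S = (INF x\<in>I. ereal (S x))"

definition left_boundary_ab :: "(real \<Rightarrow> 'a measure) \<Rightarrow> (real \<Rightarrow> 'a \<Rightarrow> ereal) \<Rightarrow> real set \<Rightarrow>
    ereal \<Rightarrow> (real \<Rightarrow> real) \<Rightarrow> bool" where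
  "left_boundary_ab P X I l S \<longleftrightarrow>
     scale_left I S = -\<infinity> \<or>
     (scale_left I S > -\<infinity> \<and> l > -\<infinity> \<and> reflecting P X I l)"

definition class1 :: "(real \<Rightarrow> 'a measure) \<Rightarrow> (real \<Rightarrow> 'a \<Rightarrow> ereal) \<Rightarrow> real set \<Rightarrow>
    ereal \<Rightarrow> (real \<Rightarrow> real) \<Rightarrow> bool" where
  "class1 P X I l S \<longleftrightarrow>
     recurrent P X I \<and> scale_right I S = \<infinity> \<and> left_boundary_ab P X I l S"

definition class2 :: "(real \<Rightarrow> 'a measure) \<Rightarrow> (real \<Rightarrow> 'a \<Rightarrow> ereal) \<Rightarrow> real set \<Rightarrow>
    ereal \<Rightarrow> (real \<Rightarrow> real) \<Rightarrow> bool" where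
  "class2 P X I l S \<longleftrightarrow>
     transient P X I \<and> scale_right I S < \<infinity> \<and> left_boundary_ab P X I l S"

subsection \<open>The functions \<open>\<psi>\<close> and \<open>\<phi>\<close>\<close>

definition S_quotient :: "(real \<Rightarrow> real) \<Rightarrow> (real \<Rightarrow> real) \<Rightarrow> real \<Rightarrow> real \<Rightarrow> real" where
  "S_quotient S u x z = (u z - u x) / (S z - S x)"

definition left_S_deriv :: "(real \<Rightarrow> real) \<Rightarrow> (real \<Rightarrow> real) \<Rightarrow> real \<Rightarrow> real" where
  "left_S_deriv S u x = Lim (at_left x) (S_quotient S u x)"

definition right_S_deriv :: "(real \<Rightarrow> real) \<Rightarrow> (real \<Rightarrow> real) \<Rightarrow> real \<Rightarrow> real" where
  "right_S_deriv S u x = Lim (at_right x) (S_quotient S u x)"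

text \<open>\<open>d/dm d/dS u = \<alpha> u\<close>, integrated with respect to \<open>m\<close>.\<close>

definition generator_eigenfunction ::
    "real set \<Rightarrow> (real \<Rightarrow> real) \<Rightarrow> real measure \<Rightarrow> real \<Rightarrow> (real \<Rightarrow> real) \<Rightarrow> bool" where
  "generator_eigenfunction I S m \<alpha> u \<longleftrightarrow>
     continuous_on I u \<and>
     (\<forall>x\<in>interior I. (\<exists>D. (S_quotient S u x \<longlongrightarrow> D) (at_left x)) \<and>
                     (\<exists>D. (S_quotient S u x \<longlongrightarrow> D) (at_right x))) \<and>
     (\<forall>a\<in>interior I. \<forall>b\<in>interior I. a < b \<longrightarrow>
        left_S_deriv S u b - left_S_deriv S u a = \<alpha> * (LINT y:{a..<b}|m. u y) \<and>
        right_S_deriv S u b - right_S_deriv S u a = \<alpha> * (LINT y:{a<..b}|m. u y))"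

text \<open>The appropriate boundary conditions are those for which the solutions represent the Laplace
  transforms of the hitting times; this fixes them up to a multiplicative constant.\<close>

definition increasing_solution :: "(real \<Rightarrow> 'a measure) \<Rightarrow> (real \<Rightarrow> 'a \<Rightarrow> ereal) \<Rightarrow> real set \<Rightarrow>
    (real \<Rightarrow> real) \<Rightarrow> real measure \<Rightarrow> real \<Rightarrow> (real \<Rightarrow> real) \<Rightarrow> bool" where
  "increasing_solution P X I S m \<alpha> \<psi> \<longleftrightarrow>
     generator_eigenfunction I S m \<alpha> \<psi> \<and> (\<forall>x\<in>I. 0 < \<psi> x) \<and> mono_on I \<psi> \<and>
     (\<forall>x\<in>I. \<forall>y\<in>I. x \<le> y \<longrightarrow>
        (LINT \<omega>|P x. exp_neg (ereal \<alpha> * hitting_time X y \<omega>)) = \<psi> x / \<psi> y)"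

definition decreasing_solution :: "(real \<Rightarrow> 'a measure) \<Rightarrow> (real \<Rightarrow> 'a \<Rightarrow> ereal) \<Rightarrow> real set \<Rightarrow>
    (real \<Rightarrow> real) \<Rightarrow> real measure \<Rightarrow> real \<Rightarrow> (real \<Rightarrow> real) \<Rightarrow> bool" where
  "decreasing_solution P X I S m \<alpha> \<phi> \<longleftrightarrow>
     generator_eigenfunction I S m \<alpha> \<phi> \<and> (\<forall>x\<in>I. 0 < \<phi> x) \<and> antimono_on I \<phi> \<and>
     (\<forall>x\<in>I. \<forall>y\<in>I. y \<le> x \<longrightarrow>
        (LINT \<omega>|P x. exp_neg (ereal \<alpha> * hitting_time X y \<omega>)) = \<phi> x / \<phi> y)"

definition wronskian :: "(real \<Rightarrow> real) \<Rightarrow> (real \<Rightarrow> real) \<Rightarrow> (real \<Rightarrow> real) \<Rightarrow> real \<Rightarrow> real" where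
  "wronskian S \<psi> \<phi> x = left_S_deriv S \<psi> x * \<phi> x - \<psi> x * left_S_deriv S \<phi> x"

subsection \<open>The quantities in the formula\<close>

text \<open>\<open>x \<or> (\<delta> + l)\<close>, equal to \<open>x\<close> if \<open>l = -\<infinity>\<close>.\<close>

definition lower_limit :: "ereal \<Rightarrow> real \<Rightarrow> real \<Rightarrow> real" where
  "lower_limit l \<delta> x = real_of_ereal (max (ereal x) (ereal \<delta> + l))"

definition bc_denom :: "(real \<Rightarrow> real) \<Rightarrow> (real \<Rightarrow> real) \<Rightarrow> real \<Rightarrow> real \<Rightarrow> real" where
  "bc_denom \<psi> \<phi> \<delta> y = \<phi> (y - \<delta>) * \<psi> y - \<phi> y * \<psi> (y - \<delta>)"

definition b_fun :: "(real \<Rightarrow> real) \<Rightarrow> (real \<Rightarrow> real) \<Rightarrow> (real \<Rightarrow> real) \<Rightarrow> real \<Rightarrow> real \<Rightarrow> real" where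
  "b_fun S \<psi> \<phi> \<delta> y =
     (\<phi> (y - \<delta>) * left_S_deriv S \<psi> y - left_S_deriv S \<phi> y * \<psi> (y - \<delta>)) / bc_denom \<psi> \<phi> \<delta> y"

definition c_fun :: "(real \<Rightarrow> real) \<Rightarrow> (real \<Rightarrow> real) \<Rightarrow> (real \<Rightarrow> real) \<Rightarrow> real \<Rightarrow> real \<Rightarrow> real" where
  "c_fun S \<psi> \<phi> \<delta> y =
     (\<phi> y * left_S_deriv S \<psi> y - left_S_deriv S \<phi> y * \<psi> y) / bc_denom \<psi> \<phi> \<delta> y"

end

theory Submission
  imports Defs
begin

text \<open>
  Write \<open>H v\<close> for the first time at which the path is at \<open>v\<close>, and \<open>\<theta>\<close> for the drawdown time.  If the path starts at or
  below \<open>v\<close> and reaches \<open>v\<close> before \<open>\<theta>\<close>, then at \<open>H v\<close> it equals its running maximum, and from then on the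
  drawdown of the whole path is the drawdown of the path after \<open>H v\<close>.  So the strong Markov property at
  \<open>H v\<close> makes \<open>g(x,v) = E\<^sub>x(exp(-\<alpha> H v); H v < \<theta>)\<close> multiplicative, \<open>g(x,w) = g(x,v) g(v,w)\<close>, and gives
  \<open>E\<^sub>x(exp(-\<alpha> \<theta>); H u < \<theta> < H v) = g(x,u) k(u,v)\<close> with \<open>k(u,v) = E\<^sub>u(exp(-\<alpha> \<theta>); \<theta> < H v)\<close>
  (lemmas \<open>renewal\<close>, \<open>surv_mult\<close> and \<open>drop_increment\<close>).

  Over a short stretch from \<open>u\<close> to \<open>v\<close> the drawdown is almost an exit problem.  Starting at \<open>u\<close>, reaching \<open>v\<close>
  before \<open>v - \<delta>\<close> excludes a drawdown before \<open>H v\<close>, and reaching a point \<open>a < u - \<delta>\<close> before \<open>v\<close> forces one.  Hence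
  \<open>g(u,v)\<close> and \<open>k(u,v)\<close> lie between Laplace transforms of two-sided exit times, with lower barriers \<open>v - \<delta>\<close>
  and \<open>u - \<delta>\<close>.  Those transforms solve two linear equations, again by the strong Markov property, and are
  quotients of \<open>cross(a,v) = \<phi>(a) \<psi>(v) - \<phi>(v) \<psi>(a)\<close> (\<open>hit_before_laplace\<close>).  As \<open>v - u\<close> tends to \<open>0\<close> both
  bounds have the same first order term, so that \<open>1 - g(u,v)\<close> behaves like \<open>b(u) dS\<close> and \<open>k(u,v)\<close> like \<open>c(u) dS\<close>.
  Therefore \<open>g(x,\<cdot>)\<close> solves the differential equation \<open>g' = - g b S'\<close>.  On \<open>H u < \<theta> < H v\<close> the maximum at the
  drawdown time lies between \<open>u\<close> and \<open>v\<close>; so \<open>K(y) = E\<^sub>x(exp(-\<alpha> \<theta> - \<beta> M); \<theta> < H y)\<close> satisfies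
  \<open>K' = exp(-\<beta> y) g(x,y) c(y) S'\<close>.  Integrating both equations gives the formula (\<open>survival_integral\<close>,
  \<open>law_integral\<close>); the factor \<open>\<psi>(x) / \<psi>(L)\<close> is the transform of the time needed to reach the lower limit \<open>L\<close>.
  If \<open>x < L\<close>, then \<open>L = l + \<delta>\<close>, and below \<open>L\<close> no drawdown of size \<open>\<delta>\<close> fits into the state space.

  For the law of the maximum the same argument runs with \<open>\<alpha> = 0\<close>, \<open>S\<close> in place of \<open>\<psi>\<close> and \<open>1\<close> in place of \<open>\<phi>\<close>:
  then \<open>g(x,y)\<close> is the probability of reaching \<open>y\<close> before \<open>\<theta>\<close>, which is the probability of \<open>M > y\<close> because the
  path reaches every higher level almost surely (\<open>hit_lap_0_eq_1\<close>).

  The derivatives exist because the speed measure has a density: it makes the left derivative of \<open>\<psi>\<close> and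
  of \<open>\<phi>\<close> with respect to \<open>S\<close> continuous, and a continuous function with a continuous one-sided derivative is
  differentiable (\<open>DERIV_of_left_S_deriv\<close>).  Differentiating the Wronskian then shows that it is constant.
\<close>

section \<open>Hitting times and drawdowns of a single path\<close>

text \<open>
  Functionals of the process are functionals of its path, so they are studied on paths first, as functionals
  of the coordinate process on \<^typ>\<open>real \<Rightarrow> ereal\<close>.  The same functionals apply to the path after a random
  time, which is where the strong Markov property needs them.
\<close>

definition coord :: "real \<Rightarrow> (real \<Rightarrow> ereal) \<Rightarrow> ereal" where
  "coord t w = w t"

definition hit :: "real \<Rightarrow> (real \<Rightarrow> ereal) \<Rightarrow> ereal" where
  "hit = hitting_time coord"

definition ddtime :: "real \<Rightarrow> (real \<Rightarrow> ereal) \<Rightarrow> ereal" where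
  "ddtime = drawdown_time coord"

definition ddmax :: "real \<Rightarrow> (real \<Rightarrow> ereal) \<Rightarrow> ereal" where
  "ddmax = max_at_drawdown coord"

text \<open>
  What every path of the diffusion satisfies: it is continuous, stays at or above the left endpoint, and
  \<open>\<infinity>\<close> is absorbing.  The value \<open>-\<infinity>\<close> is excluded separately because \<open>l\<close> may be \<open>-\<infinity>\<close>.
\<close>

definition lifetime_path :: "ereal \<Rightarrow> (real \<Rightarrow> ereal) \<Rightarrow> bool" where
  "lifetime_path l w \<longleftrightarrow> continuous_on {0..} w \<and> (\<forall>t\<ge>0. l \<le> w t \<and> -\<infinity> < w t) \<and>
     (\<forall>s t. 0 \<le> s \<longrightarrow> s \<le> t \<longrightarrow> w s = \<infinity> \<longrightarrow> w t = \<infinity>)"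

lemma hitting_time_eq_hit: "hitting_time X y \<omega> = hit y (\<lambda>t. X t \<omega>)"
  by (simp add: hit_def hitting_time_def coord_def)

lemma drawdown_time_eq_ddtime: "drawdown_time X \<delta> \<omega> = ddtime \<delta> (\<lambda>t. X t \<omega>)"
  by (simp add: ddtime_def drawdown_time_def running_max_def coord_def)

lemma max_at_drawdown_eq_ddmax: "max_at_drawdown X \<delta> \<omega> = ddmax \<delta> (\<lambda>t. X t \<omega>)"
  by (simp add: ddmax_def max_at_drawdown_def drawdown_time_def running_max_def coord_def)

lemma running_max_coord: "running_max coord t w = (SUP s\<in>{0..t}. w s)"
  by (simp add: running_max_def coord_def)

lemma hit_cong:
  assumes "\<And>t. 0 \<le> t \<Longrightarrow> w t = w' t"
  shows "hit y w = hit y w'"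
  unfolding hit_def hitting_time_def coord_def using assms by (metis (no_types, opaque_lifting))

lemma ddtime_cong:
  assumes eq: "\<And>t. 0 \<le> t \<Longrightarrow> w t = w' t"
  shows "ddtime \<delta> w = ddtime \<delta> w'"
proof -
  have "running_max coord t w = running_max coord t w'" for t
    unfolding running_max_def coord_def by (intro SUP_cong) (auto simp: eq)
  then have "(0 \<le> t \<and> coord t w < \<infinity> \<and> ereal \<delta> < running_max coord t w - coord t w) \<longleftrightarrow>
      (0 \<le> t \<and> coord t w' < \<infinity> \<and> ereal \<delta> < running_max coord t w' - coord t w')" for t
    using eq[of t] by (auto simp: coord_def)
  then show ?thesis unfolding ddtime_def drawdown_time_def by simp
qed

lemma hit_eq_Inf: "hit y w = Inf {ereal t | t. 0 \<le> t \<and> w t = ereal y}"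
  by (simp add: hit_def hitting_time_def coord_def)

lemma hit_nonneg: "0 \<le> hit y w"
  unfolding hit_eq_Inf by (rule Inf_greatest) auto

lemma hit_le: "0 \<le> t \<Longrightarrow> w t = ereal y \<Longrightarrow> hit y w \<le> ereal t"
  unfolding hit_eq_Inf by (rule Inf_lower) auto

lemma hit_attained:
  assumes cont: "continuous_on {0..} w" and fin: "hit y w < \<infinity>"
  obtains t where "0 \<le> t" "hit y w = ereal t" "w t = ereal y" "\<And>s. 0 \<le> s \<Longrightarrow> s < t \<Longrightarrow> w s \<noteq> ereal y"
proof -
  define C where "C = {t \<in> {0..}. w t \<in> {ereal y}}"
  have ne: "C \<noteq> {}"
  proof
    assume "C = {}"
    then have e: "{ereal t | t. 0 \<le> t \<and> w t = ereal y} = {}" unfolding C_def by auto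
    have "hit y w = \<infinity>" unfolding hit_eq_Inf e by (simp add: top_ereal_def)
    with fin show False by simp
  qed
  have cl: "closed C"
    unfolding C_def
    using continuous_closed_preimage[OF cont, of "{ereal y}"] by (simp add: vimage_def Int_def)
  have bd: "bdd_below C" unfolding C_def by (auto intro: bdd_belowI[of _ 0])
  have mem: "Inf C \<in> C" by (rule closed_contains_Inf[OF ne bd cl])
  have low: "Inf C \<le> t" if "0 \<le> t" "w t = ereal y" for t
    using that bd by (intro cInf_lower) (auto simp: C_def)
  have "hit y w = ereal (Inf C)"
  proof (rule antisym)
    show "hit y w \<le> ereal (Inf C)" using mem by (intro hit_le) (auto simp: C_def)
    show "ereal (Inf C) \<le> hit y w" unfolding hit_eq_Inf using low by (intro Inf_greatest) auto
  qed
  moreover have "w s \<noteq> ereal y" if "0 \<le> s" "s < Inf C" for s using low[of s] that by auto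
  ultimately show thesis using that mem unfolding C_def by auto
qed

lemma hit_le_iff:
  assumes cont: "continuous_on {0..} w"
  shows "hit y w \<le> ereal t \<longleftrightarrow> (\<exists>s\<in>{0..t}. w s = ereal y)"
proof
  assume le: "hit y w \<le> ereal t"
  then have "hit y w < \<infinity>" using le_less_trans by fastforce
  then obtain s where "0 \<le> s" "hit y w = ereal s" "w s = ereal y"
    using hit_attained[OF cont] by metis
  with le show "\<exists>s\<in>{0..t}. w s = ereal y" by auto
next
  assume "\<exists>s\<in>{0..t}. w s = ereal y"
  then show "hit y w \<le> ereal t" by (force intro: order_trans[OF hit_le])
qed

lemma path_IVT:
  fixes w :: "real \<Rightarrow> ereal"
  assumes cont: "continuous_on {0..} w" and st: "0 \<le> s" "s \<le> t"
    and "w s \<le> c \<and> c \<le> w t \<or> w t \<le> c \<and> c \<le> w s"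
  shows "\<exists>r\<in>{s..t}. w r = c"
proof -
  have c: "continuous_on {s..t} w" using cont by (rule continuous_on_subset) (use st in auto)
  from assms(4) show ?thesis
    using IVT'[of w s c t, OF _ _ _ c] IVT2'[of w t c s, OF _ _ _ c] st by (metis atLeastAtMost_iff)
qed

lemma below_before_hit:
  assumes cont: "continuous_on {0..} w" and "w 0 \<le> ereal v" "0 \<le> s" "ereal s < hit v w"
  shows "w s < ereal v"
proof (rule ccontr)
  assume "\<not> ?thesis"
  then have "\<exists>r\<in>{0..s}. w r = ereal v" using assms by (intro path_IVT[OF cont]) auto
  then have "hit v w \<le> ereal s" using cont by (auto simp: hit_le_iff)
  with assms show False by simp
qed

lemma hit_mono:
  assumes cont: "continuous_on {0..} w" and "w 0 \<le> ereal u" "u \<le> v"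
  shows "hit u w \<le> hit v w"
proof (cases "hit v w < \<infinity>")
  case True
  then obtain t where t: "0 \<le> t" "hit v w = ereal t" "w t = ereal v" using hit_attained[OF cont] by metis
  have "\<exists>r\<in>{0..t}. w r = ereal u" using path_IVT[OF cont, of 0 t "ereal u"] t assms by auto
  then show ?thesis using t cont by (auto simp: hit_le_iff)
qed auto

text \<open>
  The event of which the drawdown time is the first occurrence, with the subtraction of the definition
  turned into an addition and the supremum into an existential.  This form survives small perturbations
  of \<open>s\<close> and \<open>t\<close>, which makes rational times suffice.
\<close>

definition drawn :: "real \<Rightarrow> (real \<Rightarrow> ereal) \<Rightarrow> real \<Rightarrow> bool" where
  "drawn \<delta> w t \<longleftrightarrow> 0 \<le> t \<and> w t < \<infinity> \<and> (\<exists>s\<in>{0..t}. w t + ereal \<delta> < w s)"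

lemma lifetime_pathD:
  assumes "lifetime_path l w"
  shows "continuous_on {0..} w" "0 \<le> t \<Longrightarrow> l \<le> w t" "0 \<le> t \<Longrightarrow> -\<infinity> < w t"
    "0 \<le> s \<Longrightarrow> s \<le> t \<Longrightarrow> w s = \<infinity> \<Longrightarrow> w t = \<infinity>"
  using assms unfolding lifetime_path_def by blast+

lemma ddtime_eq_Inf_drawn:
  assumes "\<And>t. 0 \<le> t \<Longrightarrow> -\<infinity> < w t"
  shows "ddtime \<delta> w = Inf {ereal t | t. drawn \<delta> w t}"
proof -
  have "(0 \<le> t \<and> w t < \<infinity> \<and> ereal \<delta> < running_max coord t w - w t) \<longleftrightarrow> drawn \<delta> w t" for t
  proof (cases "0 \<le> t \<and> w t < \<infinity>")
    case True
    then obtain c where c: "w t = ereal c" using assms[of t] by (cases "w t") auto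
    have "ereal \<delta> < running_max coord t w - w t \<longleftrightarrow> w t + ereal \<delta> < running_max coord t w"
      unfolding c by (subst ereal_less_minus_iff) (auto simp: add.commute)
    also have "\<dots> \<longleftrightarrow> (\<exists>s\<in>{0..t}. w t + ereal \<delta> < w s)"
      unfolding running_max_def coord_def by (simp add: less_SUP_iff)
    finally show ?thesis using True by (simp add: drawn_def)
  qed (auto simp: drawn_def)
  then show ?thesis unfolding ddtime_def drawdown_time_def coord_def by (metis (no_types, lifting))
qed

context
  fixes l :: ereal and w :: "real \<Rightarrow> ereal" and \<delta> :: real
  assumes path: "lifetime_path l w" and \<delta>: "0 < \<delta>"
begin

lemmas path_props = lifetime_pathD[OF path]

lemma ddtime_path: "ddtime \<delta> w = Inf {ereal t | t. drawn \<delta> w t}"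
  by (rule ddtime_eq_Inf_drawn) (rule path_props)

lemma ddtime_le: "drawn \<delta> w t \<Longrightarrow> ddtime \<delta> w \<le> ereal t"
  unfolding ddtime_path by (rule Inf_lower) auto

lemma ddtime_less_iff: "ddtime \<delta> w < T \<longleftrightarrow> (\<exists>t. drawn \<delta> w t \<and> ereal t < T)"
  unfolding ddtime_path by (auto simp: Inf_less_iff)

lemma ddtime_nonneg: "0 \<le> ddtime \<delta> w"
  unfolding ddtime_path by (rule Inf_greatest) (auto simp: drawn_def)

lemma ddtime_finite: "ddtime \<delta> w < \<infinity> \<Longrightarrow> \<exists>D\<ge>0. ddtime \<delta> w = ereal D"
  using ddtime_nonneg by (cases "ddtime \<delta> w") auto

lemma right_nbhd:
  assumes "open U" "0 \<le> t" "w t \<in> U"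
  obtains e where "0 < e" "\<And>r. t \<le> r \<Longrightarrow> r < t + e \<Longrightarrow> w r \<in> U"
proof -
  have "(w \<longlongrightarrow> w t) (at t within {0..})"
    using path_props(1) assms(2) by (auto simp: continuous_on_def)
  then have "eventually (\<lambda>r. w r \<in> U) (at t within {0..})"
    using assms by (auto simp: tendsto_def)
  then obtain e where "e > 0" "\<And>r. r \<in> {0..} \<Longrightarrow> r \<noteq> t \<Longrightarrow> dist r t < e \<Longrightarrow> w r \<in> U"
    unfolding eventually_at by auto
  then show thesis using assms
    by (intro that[of e]) (auto simp: dist_real_def dest: spec[of _ t], metis abs_of_nonneg atLeast_iff diff_ge_0_iff_ge diff_less_eq add.commute order_trans)
qed

text \<open>
  A drawdown of exactly \<open>\<delta>\<close> does not count, and up to time \<open>T\<close> the maximum exceeds the present value by a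
  margin strictly below \<open>\<delta>\<close>, by compactness.  A constant \<open>k\<close> between the maximum and \<open>w T + \<delta>\<close> then separates
  the two on a whole interval to the right of \<open>T\<close>.
\<close>

lemma ddtime_greater:
  assumes T: "0 \<le> T" "w T < \<infinity>" "ereal T \<le> ddtime \<delta> w"
    and above: "\<And>s. 0 \<le> s \<Longrightarrow> s \<le> T \<Longrightarrow> w s < w T + ereal \<delta>"
  shows "ereal T < ddtime \<delta> w"
proof -
  obtain c where c: "w T = ereal c" using T path_props(3)[of T] by (cases "w T") auto
  have "compact {0..T}" "{0..T} \<noteq> {}" using T by auto
  moreover have "continuous_on {0..T} w" by (rule continuous_on_subset[OF path_props(1)]) auto
  ultimately obtain s0 where s0: "s0 \<in> {0..T}" "\<And>s. s \<in> {0..T} \<Longrightarrow> w s \<le> w s0"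
    using continuous_attains_sup[of "{0..T}" w] by auto
  have "w s0 < ereal (c + \<delta>)" using above[of s0] s0(1) c by simp
  then obtain k where k: "w s0 < ereal k" "k < c + \<delta>"
    using ereal_dense2[of "w s0" "ereal (c + \<delta>)"] by auto
  have ck: "ereal c < ereal k" using s0(2)[of T] T c k by (metis atLeastAtMost_iff le_less_trans order_refl)
  have "w T \<in> {ereal (k - \<delta>)<..<ereal k}" using c k ck by auto
  then obtain e where e: "0 < e" "\<And>r. T \<le> r \<Longrightarrow> r < T + e \<Longrightarrow> w r \<in> {ereal (k - \<delta>)<..<ereal k}"
    using right_nbhd[of "{ereal (k - \<delta>)<..<ereal k}" T] T by auto
  have notdrawn: "\<not> drawn \<delta> w t" if "t < T + e" for t
  proof
    assume d: "drawn \<delta> w t"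
    then have "ereal t \<ge> ereal T" using ddtime_le T(3) order_trans by blast
    then have "T \<le> t" by simp
    obtain s where s: "s \<in> {0..t}" "w t + ereal \<delta> < w s" using d by (auto simp: drawn_def)
    have "w s < ereal k"
    proof (cases "s \<le> T")
      case True then show ?thesis using s0(2)[of s] s k by (auto intro: le_less_trans)
    next
      case False then show ?thesis using e(2)[of s] s that by auto
    qed
    moreover have "ereal (k - \<delta>) < w t" using e(2)[OF \<open>T \<le> t\<close> that] by auto
    then have "ereal k < w t + ereal \<delta>" by (cases "w t") auto
    ultimately show False using s(2) by auto
  qed
  have "ereal (T + e) \<le> ddtime \<delta> w"
    unfolding ddtime_path using notdrawn by (intro Inf_greatest) (auto simp: not_less[symmetric])
  then show ?thesis using e(1) by (cases "ddtime \<delta> w") auto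
qed

text \<open>
  At the drawdown time the distance from the maximum is at least \<open>\<delta>\<close>, otherwise \<open>ddtime_greater\<close> would
  postpone it.  The maximum is attained strictly earlier.
\<close>

lemma at_ddtime:
  assumes D: "ddtime \<delta> w = ereal D"
  shows "0 \<le> D" "w D < \<infinity>" "\<exists>s. 0 \<le> s \<and> s < D \<and> w D + ereal \<delta> \<le> w s"
proof -
  show D0: "0 \<le> D" using ddtime_nonneg D by simp
  have "ddtime \<delta> w < ereal (D + 1)" using D by simp
  then obtain t where t: "drawn \<delta> w t" by (auto simp: ddtime_less_iff)
  then have "D \<le> t" using ddtime_le D by fastforce
  then show fin: "w D < \<infinity>" using path_props(4)[OF D0, of t] t by (auto simp: drawn_def)
  obtain s where s: "0 \<le> s" "s \<le> D" "w D + ereal \<delta> \<le> w s"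
    using ddtime_greater[OF D0 fin] D by (metis less_irrefl not_less order_refl)
  have "w D < w D + ereal \<delta>" using fin path_props(3)[OF D0] \<delta> by (cases "w D") auto
  then have "s \<noteq> D" using s by auto
  with s show "\<exists>s. 0 \<le> s \<and> s < D \<and> w D + ereal \<delta> \<le> w s" by (intro exI[of _ s]) auto
qed

text \<open>
  At a first passage upwards the path equals its running maximum, so a drawdown cannot occur at that
  very moment.
\<close>

lemma ddtime_after_hit:
  assumes "w 0 \<le> ereal v" "hit v w \<le> ddtime \<delta> w" "hit v w < \<infinity>"
  shows "hit v w < ddtime \<delta> w"
proof -
  obtain T where T: "0 \<le> T" "hit v w = ereal T" "w T = ereal v" using hit_attained[OF path_props(1) assms(3)] by metis
  have "w s < w T + ereal \<delta>" if "0 \<le> s" "s \<le> T" for s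
  proof (cases "s = T")
    case False
    then have "w s < ereal v" using below_before_hit[OF path_props(1) assms(1), of s] that T by auto
    then show ?thesis using T \<delta> by (cases "w s") auto
  qed (use T \<delta> in simp)
  then show ?thesis using ddtime_greater[of T] T assms by simp
qed

lemma before_ddtime_dichotomy:
  assumes "w 0 \<le> ereal v"
  shows "ddtime \<delta> w < hit v w \<or> hit v w < ddtime \<delta> w \<or> (hit v w = \<infinity> \<and> ddtime \<delta> w = \<infinity>)"
  using ddtime_after_hit[OF assms] by (cases "ddtime \<delta> w < hit v w"; cases "hit v w = \<infinity>") (auto simp: not_less)

lemma ddmax_eq: "ddtime \<delta> w = ereal D \<Longrightarrow> ddmax \<delta> w = (SUP s\<in>{0..D}. w s)"
  by (simp add: ddtime_def ddmax_def max_at_drawdown_def running_max_coord)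

lemma max_below_hit:
  assumes "w 0 \<le> ereal v" "ereal D < hit v w" "0 \<le> s" "s \<le> D"
  shows "w s < ereal v"
proof (rule below_before_hit[OF path_props(1) assms(1) assms(3)])
  have "ereal s \<le> ereal D" using assms by simp
  then show "ereal s < hit v w" using assms(2) by (rule le_less_trans)
qed

text \<open>
  When the drawdown happens below \<open>v\<close>, the path has come down by \<open>\<delta>\<close> from a height less than \<open>v\<close> and has
  passed \<open>v - \<delta>\<close> on its way.  This and the next three lemmas are the two inclusions between drawdowns and
  two-sided exits from which all estimates follow.
\<close>

lemma drawdown_imp_hit:
  assumes "w 0 \<le> ereal v" "ereal (v - \<delta>) \<le> w 0" "ddtime \<delta> w < hit v w"
  shows "hit (v - \<delta>) w \<le> ddtime \<delta> w"
proof -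
  have "ddtime \<delta> w < \<infinity>" using assms(3) by auto
  then obtain D where D: "ddtime \<delta> w = ereal D" using ddtime_finite by auto
  obtain s where s: "0 \<le> s" "s < D" "w D + ereal \<delta> \<le> w s" using at_ddtime(3)[OF D] by auto
  have "w s < ereal v" using max_below_hit[OF assms(1), of D s] assms(3) D s by simp
  then have "w D \<le> ereal (v - \<delta>)" using s(3) by (cases "w D"; cases "w s") auto
  then have "\<exists>r\<in>{0..D}. w r = ereal (v - \<delta>)"
    using path_IVT[OF path_props(1), of 0 D "ereal (v - \<delta>)"] assms at_ddtime(1)[OF D] by auto
  then show ?thesis unfolding D using path_props(1) by (simp add: hit_le_iff)
qed

text \<open>
  The starting point alone is a maximum high enough for a drawdown at \<open>a\<close>.  The inequality is strict, so
  that the drawdown at \<open>a\<close> exceeds \<open>\<delta>\<close>.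
\<close>

lemma hit_imp_drawdown:
  assumes "ereal (a + \<delta>) < w 0" "hit a w < \<infinity>"
  shows "ddtime \<delta> w \<le> hit a w"
proof -
  obtain T where T: "0 \<le> T" "hit a w = ereal T" "w T = ereal a" using hit_attained[OF path_props(1) assms(2)] by metis
  have "drawn \<delta> w T" unfolding drawn_def using T assms(1) by (auto intro!: bexI[of _ 0])
  then show ?thesis using ddtime_le T by simp
qed

lemma up_first_imp_no_drawdown:
  assumes "w 0 \<le> ereal v" "ereal (v - \<delta>) \<le> w 0" "hit v w < hit (v - \<delta>) w"
  shows "hit v w < ddtime \<delta> w"
proof -
  have fin: "hit v w < \<infinity>" using assms(3) by auto
  then have "\<not> ddtime \<delta> w < hit v w"
    using drawdown_imp_hit[OF assms(1,2)] assms(3) by (auto intro: less_trans le_less_trans)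
  then show ?thesis using before_ddtime_dichotomy[OF assms(1)] fin by auto
qed

lemma no_drawdown_imp_up_first:
  assumes "ereal (a + \<delta>) < w 0" "hit v w < ddtime \<delta> w"
  shows "hit v w < hit a w"
proof (rule ccontr)
  assume "\<not> ?thesis"
  then have "hit a w \<le> hit v w" by simp
  moreover have "hit a w < \<infinity>" using calculation assms(2) by (auto intro: le_less_trans)
  ultimately show False using hit_imp_drawdown[OF assms(1)] assms(2) by auto
qed

lemma running_max_between:
  assumes "w 0 \<le> ereal u" "hit u w < ddtime \<delta> w" "ddtime \<delta> w < hit v w" "u \<le> v"
  shows "ereal u \<le> ddmax \<delta> w" "ddmax \<delta> w \<le> ereal v"
proof -
  have "ddtime \<delta> w < \<infinity>" using assms(3) by auto
  then obtain D where D: "0 \<le> D" "ddtime \<delta> w = ereal D" using ddtime_finite by auto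
  have m: "ddmax \<delta> w = (SUP s\<in>{0..D}. w s)"
    by (rule ddmax_eq) (rule D)
  have "hit u w < \<infinity>" using assms(2) by auto
  then obtain T where T: "0 \<le> T" "hit u w = ereal T" "w T = ereal u" using hit_attained[OF path_props(1)] by metis
  show "ereal u \<le> ddmax \<delta> w" unfolding m using T assms D by (intro SUP_upper2[of T]) auto
  have "w 0 \<le> ereal v" using assms by (auto intro: order_trans)
  then show "ddmax \<delta> w \<le> ereal v" unfolding m
    using max_below_hit[of v D] assms D by (intro SUP_least) (auto intro: less_imp_le)
qed

lemma hit_imp_ddmax_greater:
  assumes "w 0 \<le> ereal v" "y < v" "hit v w < ddtime \<delta> w"
  shows "ereal y < ddmax \<delta> w"
proof (cases "ddtime \<delta> w = \<infinity>")
  case False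
  then obtain D where D: "0 \<le> D" "ddtime \<delta> w = ereal D" using ddtime_finite by (auto simp: less_top)
  have m: "ddmax \<delta> w = (SUP s\<in>{0..D}. w s)"
    by (rule ddmax_eq) (rule D)
  have "hit v w < \<infinity>" using assms(3) by auto
  then obtain T where T: "0 \<le> T" "hit v w = ereal T" "w T = ereal v" using hit_attained[OF path_props(1)] by metis
  then show ?thesis unfolding m using assms D by (auto simp: less_SUP_iff intro!: bexI[of _ T])
qed (simp add: ddtime_def ddmax_def max_at_drawdown_def)

lemma ddmax_greater_iff:
  assumes D: "ddtime \<delta> w = ereal D"
  shows "c < ddmax \<delta> w \<longleftrightarrow> (\<exists>s. 0 \<le> s \<and> s < D \<and> c < w s)"
proof -
  have D0: "0 \<le> D" by (rule at_ddtime(1)[OF D])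
  have m: "ddmax \<delta> w = (SUP s\<in>{0..D}. w s)"
    by (rule ddmax_eq) (rule D)
  have "(\<exists>s\<in>{0..D}. c < w s) \<longleftrightarrow> (\<exists>s. 0 \<le> s \<and> s < D \<and> c < w s)"
  proof
    assume "\<exists>s\<in>{0..D}. c < w s"
    then obtain s where s: "0 \<le> s" "s \<le> D" "c < w s" by auto
    obtain r where r: "0 \<le> r" "r < D" "w D + ereal \<delta> \<le> w r" using at_ddtime(3)[OF D] by auto
    show "\<exists>s. 0 \<le> s \<and> s < D \<and> c < w s"
    proof (cases "s < D")
      case False
      then have "s = D" using s by simp
      have "w D < w D + ereal \<delta>" using at_ddtime(2)[OF D] path_props(3)[OF D0] \<delta> by (cases "w D") auto
      then have "c < w r" using s r \<open>s = D\<close> by (meson less_le_trans less_trans)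
      then show ?thesis using r by auto
    qed (use s in auto)
  qed auto
  then show ?thesis unfolding m by (simp add: less_SUP_iff)
qed

lemma ddmax_greater_imp_hit:
  assumes "w 0 \<le> ereal y" "ereal y < ddmax \<delta> w" "ddtime \<delta> w < \<infinity>"
  shows "hit y w < ddtime \<delta> w"
proof -
  obtain D where D: "0 \<le> D" "ddtime \<delta> w = ereal D" using ddtime_finite assms(3) by auto
  then obtain s where s: "0 \<le> s" "s < D" "ereal y < w s" using ddmax_greater_iff[OF D(2)] assms by auto
  then have "\<exists>r\<in>{0..s}. w r = ereal y" using assms by (intro path_IVT[OF path_props(1)]) auto
  then have "hit y w \<le> ereal s" using path_props(1) by (auto simp: hit_le_iff)
  then show ?thesis using s D by (auto intro: le_less_trans)
qed

lemma ddmax_finite: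
  assumes D: "ddtime \<delta> w = ereal D"
  obtains m where "ddmax \<delta> w = ereal m" "w 0 \<le> ereal m"
proof -
  have D0: "0 \<le> D" "w D < \<infinity>" using at_ddtime[OF D] by auto
  have m: "ddmax \<delta> w = (SUP s\<in>{0..D}. w s)"
    by (rule ddmax_eq) (rule D)
  have "compact {0..D}" "{0..D} \<noteq> {}" using D0 by auto
  moreover have "continuous_on {0..D} w" by (rule continuous_on_subset[OF path_props(1)]) auto
  ultimately obtain s0 where s0: "s0 \<in> {0..D}" "\<And>s. s \<in> {0..D} \<Longrightarrow> w s \<le> w s0"
    using continuous_attains_sup[of "{0..D}" w] by auto
  have "ddmax \<delta> w = w s0" unfolding m using s0 by (intro antisym SUP_least SUP_upper) auto
  moreover have "w s0 \<noteq> \<infinity>" using path_props(4)[of s0 D] s0 D0 by auto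
  ultimately show thesis using that s0(2)[of 0] path_props(3)[of s0] s0(1) D0 by (cases "w s0") auto
qed

text \<open>
  For an infinite drawdown time the maximum is \<open>\<infinity>\<close> by convention, whatever the path does.  In the other case
  the supremum is attained before the drawdown time and continuity to the right provides a rational time.
\<close>

lemma ddmax_greater_iff_rat:
  "c < ddmax \<delta> w \<longleftrightarrow> (ddtime \<delta> w = \<infinity> \<and> c < \<infinity>) \<or> (ddtime \<delta> w < \<infinity> \<and> (\<exists>q\<in>\<rat>. 0 \<le> q \<and> ereal q < ddtime \<delta> w \<and> c < w q))"
proof (cases "ddtime \<delta> w = \<infinity>")
  case False
  then obtain D where D: "0 \<le> D" "ddtime \<delta> w = ereal D" using ddtime_finite by (auto simp: less_top)
  have "(\<exists>s. 0 \<le> s \<and> s < D \<and> c < w s) \<longleftrightarrow> (\<exists>q\<in>\<rat>. 0 \<le> q \<and> q < D \<and> c < w q)"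
  proof
    assume "\<exists>s. 0 \<le> s \<and> s < D \<and> c < w s"
    then obtain s where s: "0 \<le> s" "s < D" "c < w s" by auto
    obtain e where e: "0 < e" "\<And>r. s \<le> r \<Longrightarrow> r < s + e \<Longrightarrow> w r \<in> {c<..}"
      using right_nbhd[of "{c<..}" s] s by auto
    have "s < min (s + e) D" using e s by simp
    then obtain q where "q \<in> \<rat>" "s < q" "q < min (s + e) D" using Rats_dense_in_real by blast
    then show "\<exists>q\<in>\<rat>. 0 \<le> q \<and> q < D \<and> c < w q" using s e(2)[of q] by (intro bexI[of _ q]) auto
  qed auto
  then show ?thesis using ddmax_greater_iff[OF D(2)] D by auto
qed (simp add: ddtime_def ddmax_def max_at_drawdown_def)

lemma ddtime_less_iff_rat:
  "ddtime \<delta> w < ereal T \<longleftrightarrow>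
     (\<exists>q\<in>\<rat>. \<exists>r\<in>\<rat>. 0 \<le> r \<and> r \<le> q \<and> q < T \<and> w q < \<infinity> \<and> w q + ereal \<delta> < w r)"
proof
  assume "ddtime \<delta> w < ereal T"
  then obtain t where t: "drawn \<delta> w t" "t < T" by (auto simp: ddtime_less_iff)
  then obtain s where s: "0 \<le> s" "s \<le> t" "w t < \<infinity>" "w t + ereal \<delta> < w s" by (auto simp: drawn_def)
  then obtain c where c: "w t = ereal c" using path_props(3)[of t] by (cases "w t") auto
  obtain k where k: "ereal c + ereal \<delta> < ereal k" "ereal k < w s"
    using s(4) ereal_dense2[of "ereal c + ereal \<delta>" "w s"] c by auto
  obtain e where e: "0 < e" "\<And>r. t \<le> r \<Longrightarrow> r < t + e \<Longrightarrow> w r \<in> {..<ereal (k - \<delta>)}"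
    using right_nbhd[of "{..<ereal (k - \<delta>)}" t] s c k by auto
  obtain e' where e': "0 < e'" "\<And>r. s \<le> r \<Longrightarrow> r < s + e' \<Longrightarrow> w r \<in> {ereal k<..}"
    using right_nbhd[of "{ereal k<..}" s] s k by auto
  have "t < min (t + e) T" using e t by simp
  then obtain q where q: "q \<in> \<rat>" "t < q" "q < min (t + e) T" using Rats_dense_in_real by blast
  have "s < min (s + e') q" using e' q s by simp
  then obtain r where r: "r \<in> \<rat>" "s < r" "r < min (s + e') q" using Rats_dense_in_real by blast
  have wq: "w q < ereal (k - \<delta>)" using e(2)[of q] q by auto
  have wr: "ereal k < w r" using e'(2)[of r] r by auto
  have "w q + ereal \<delta> < w r" using wq wr by (cases "w q"; cases "w r") auto
  moreover have "w q < \<infinity>" using wq by auto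
  ultimately show "\<exists>q\<in>\<rat>. \<exists>r\<in>\<rat>. 0 \<le> r \<and> r \<le> q \<and> q < T \<and> w q < \<infinity> \<and> w q + ereal \<delta> < w r"
    using q r s by (intro bexI[of _ q] bexI[of _ r]) auto
next
  assume "\<exists>q\<in>\<rat>. \<exists>r\<in>\<rat>. 0 \<le> r \<and> r \<le> q \<and> q < T \<and> w q < \<infinity> \<and> w q + ereal \<delta> < w r"
  then show "ddtime \<delta> w < ereal T" unfolding ddtime_less_iff drawn_def by (metis atLeastAtMost_iff ereal_less_eq(3) less_ereal.simps(1) order_trans)
qed

end

text \<open>
  Reaching \<open>y\<close> is a closed condition: on a compact time interval it amounts to coming arbitrarily close
  to \<open>y\<close> at countably many times.  The endpoint \<open>t\<close> is added to the rationals because \<open>y\<close> may be reached only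
  there.
\<close>

lemma hit_le_iff_rat:
  assumes cont: "continuous_on {0..} w" and t: "0 \<le> t"
  shows "hit y w \<le> ereal t \<longleftrightarrow>
    (\<forall>n::nat. \<exists>q\<in>\<rat> \<union> {t}. 0 \<le> q \<and> q \<le> t \<and> ereal (y - 1 / Suc n) < w q \<and> w q < ereal (y + 1 / Suc n))"
proof
  assume "hit y w \<le> ereal t"
  then obtain s where s: "s \<in> {0..t}" "w s = ereal y" using cont by (auto simp: hit_le_iff)
  show "\<forall>n::nat. \<exists>q\<in>\<rat> \<union> {t}. 0 \<le> q \<and> q \<le> t \<and> ereal (y - 1 / Suc n) < w q \<and> w q < ereal (y + 1 / Suc n)"
  proof
    fix n :: nat
    show "\<exists>q\<in>\<rat> \<union> {t}. 0 \<le> q \<and> q \<le> t \<and> ereal (y - 1 / Suc n) < w q \<and> w q < ereal (y + 1 / Suc n)"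
    proof (cases "s = t")
      case True then show ?thesis using s by (intro bexI[of _ t]) auto
    next
      case False
      have "(w \<longlongrightarrow> w s) (at s within {0..})" using cont s(1) by (simp add: continuous_on_def)
      moreover have "w s \<in> {ereal (y - 1 / Suc n)<..<ereal (y + 1 / Suc n)}" using s by auto
      ultimately have "eventually (\<lambda>r. w r \<in> {ereal (y - 1 / Suc n)<..<ereal (y + 1 / Suc n)}) (at s within {0..})"
        by (rule topological_tendstoD[OF _ open_greaterThanLessThan])
      then obtain e where e: "e > 0" "\<And>r. r \<in> {0..} \<Longrightarrow> r \<noteq> s \<Longrightarrow> dist r s < e \<Longrightarrow>
          w r \<in> {ereal (y - 1 / Suc n)<..<ereal (y + 1 / Suc n)}"
        unfolding eventually_at by auto
      have "s < min (s + e) t" using e s False by auto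
      then obtain q where "q \<in> \<rat>" "s < q" "q < min (s + e) t" using Rats_dense_in_real by blast
      then show ?thesis using s e(2)[of q] by (intro bexI[of _ q]) (auto simp: dist_real_def)
    qed
  qed
next
  assume *: "\<forall>n::nat. \<exists>q\<in>\<rat> \<union> {t}. 0 \<le> q \<and> q \<le> t \<and> ereal (y - 1 / Suc n) < w q \<and> w q < ereal (y + 1 / Suc n)"
  show "hit y w \<le> ereal t"
  proof (rule ccontr)
    assume "\<not> ?thesis"
    then have no: "ereal y \<notin> w ` {0..t}" using cont by (force simp: hit_le_iff)
    have "continuous_on {0..t} w" by (rule continuous_on_subset[OF cont]) auto
    then have "compact (w ` {0..t})" by (rule compact_continuous_image) auto
    then have "open (- (w ` {0..t}))" by (intro open_Compl compact_imp_closed)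
    then obtain e where e: "e > 0" "{ereal y - e<..<ereal y + e} \<subseteq> - (w ` {0..t})"
      using no ereal_open_cont_interval[of "- (w ` {0..t})" "ereal y"] by auto
    obtain r where r: "0 < r" "ereal r < e" using ereal_dense2[OF e(1)] by auto
    obtain n where n: "1 / real (Suc n) < r" using reals_Archimedean[OF r(1)] by (auto simp: inverse_eq_divide)
    obtain q where q: "0 \<le> q" "q \<le> t" "ereal (y - 1 / Suc n) < w q" "w q < ereal (y + 1 / Suc n)"
      using * by blast
    have "ereal y - e \<le> ereal (y - 1 / Suc n)" "ereal (y + 1 / Suc n) \<le> ereal y + e"
      using r n by (cases e; simp)+
    then have "w q \<in> {ereal y - e<..<ereal y + e}" using q by auto
    then show False using e(2) q by auto
  qed
qed

lemma Inf_shift: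
  fixes Q Q' :: "real \<Rightarrow> bool"
  assumes "\<And>t. Q t \<longleftrightarrow> T \<le> t \<and> Q' (t - T)" "\<And>t. Q' t \<Longrightarrow> 0 \<le> t"
  shows "Inf {ereal t | t. Q t} = ereal T + Inf {ereal t | t. Q' t}"
proof -
  have e: "{ereal t | t. Q t} = (\<lambda>x. ereal T + x) ` {ereal t | t. Q' t}"
  proof (intro set_eqI iffI)
    fix x assume "x \<in> {ereal t | t. Q t}"
    then obtain t where "x = ereal t" "Q t" by auto
    then show "x \<in> (\<lambda>x. ereal T + x) ` {ereal t | t. Q' t}"
      using assms(1) by (intro image_eqI[of _ _ "ereal (t - T)"]) auto
  next
    fix x assume "x \<in> (\<lambda>x. ereal T + x) ` {ereal t | t. Q' t}"
    then obtain t where t: "x = ereal (T + t)" "Q' t" by auto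
    then show "x \<in> {ereal t | t. Q t}" using assms(1)[of "T + t"] assms(2)[of t] by auto
  qed
  show ?thesis
  proof (cases "{ereal t | t. Q' t} = {}")
    case True
    then have "{ereal t | t. Q t} = {}" unfolding e by simp
    then show ?thesis unfolding True by (simp add: top_ereal_def)
  next
    case False
    then show ?thesis unfolding e
      using INF_ereal_add_right[of "{ereal t | t. Q' t}" "ereal T" "\<lambda>x. x"] assms(2) by force
  qed
qed

lemma hit_shift:
  assumes "0 \<le> T" and w': "\<And>t. 0 \<le> t \<Longrightarrow> w' t = w (T + t)"
    and "\<And>s. 0 \<le> s \<Longrightarrow> s < T \<Longrightarrow> w s \<noteq> ereal y"
  shows "hit y w = ereal T + hit y w'"
  unfolding hit_eq_Inf
proof (rule Inf_shift)
  fix t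
  show "0 \<le> t \<and> w t = ereal y \<longleftrightarrow> T \<le> t \<and> 0 \<le> t - T \<and> w' (t - T) = ereal y"
    using assms(1) assms(3)[of t] w'[of "t - T"] by (cases "T \<le> t") auto
qed auto

lemma hit_shift_hit:
  assumes cont: "continuous_on {0..} w" and T: "0 \<le> T" "hit v w = ereal T" "hit v w \<le> hit y w"
    and w': "\<And>t. 0 \<le> t \<Longrightarrow> w' t = w (T + t)"
  shows "hit y w = ereal T + hit y w'"
proof (rule hit_shift[where T = T])
  show "0 \<le> T" "\<And>t. 0 \<le> t \<Longrightarrow> w' t = w (T + t)" by (fact T(1) w')+
  fix s assume "0 \<le> s" "s < T"
  then show "w s \<noteq> ereal y" using hit_le[of s w y] T by (metis ereal_less_eq(3) not_le order_trans)
qed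

text \<open>
  Up to \<open>hit v w\<close> the running maximum is \<open>v\<close>, which is also the starting point of the shifted path; forgetting
  the past therefore loses no part of the maximum.
\<close>

lemma ddtime_shift_hit:
  assumes path: "lifetime_path l w" and path': "lifetime_path l w'" and \<delta>: "0 < \<delta>" and "w 0 \<le> ereal v"
    and T: "0 \<le> T" "hit v w = ereal T" "hit v w \<le> ddtime \<delta> w"
    and w': "\<And>t. 0 \<le> t \<Longrightarrow> w' t = w (T + t)"
  shows "ddtime \<delta> w = ereal T + ddtime \<delta> w'"
  unfolding ddtime_path[OF path \<delta>] ddtime_path[OF path' \<delta>]
proof (rule Inf_shift)
  show "drawn \<delta> w' t \<Longrightarrow> 0 \<le> t" for t by (simp add: drawn_def)
  show "drawn \<delta> w t \<longleftrightarrow> T \<le> t \<and> drawn \<delta> w' (t - T)" for t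
  proof
    assume d: "drawn \<delta> w t"
    then have "T \<le> t" using ddtime_le[OF path \<delta> d] T by (auto dest: order_trans)
    obtain s where s: "0 \<le> s" "s \<le> t" "w t + ereal \<delta> < w s" using d by (auto simp: drawn_def)
    have "hit v w < \<infinity>" using T by simp
    from hit_attained[OF lifetime_pathD(1)[OF path] this] have "w T = ereal v" using T by (metis ereal.inject)
    then have "w s \<le> w T" if "s < T"
      using below_before_hit[OF lifetime_pathD(1)[OF path] assms(4), of s] s that T by auto
    then have "w t + ereal \<delta> < w (max s T)" using s(3) by (cases "s < T") (auto simp: max_def)
    then show "T \<le> t \<and> drawn \<delta> w' (t - T)"
      using d \<open>T \<le> t\<close> s T(1) unfolding drawn_def
      by (auto simp: w' intro!: bexI[of _ "max s T - T"])
  next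
    assume "T \<le> t \<and> drawn \<delta> w' (t - T)"
    then obtain s where "T \<le> t" "w t < \<infinity>" "0 \<le> s" "s \<le> t - T" "w t + ereal \<delta> < w (T + s)"
      by (auto simp: drawn_def w')
    then show "drawn \<delta> w t" unfolding drawn_def using T(1) by (auto intro!: bexI[of _ "T + s"])
  qed
qed

lemma lifetime_path_shift:
  assumes "lifetime_path l w" "0 \<le> T" "\<And>t. 0 \<le> t \<Longrightarrow> w' t = w (T + t)"
  shows "lifetime_path l w'"
proof -
  have "continuous_on {0..} (\<lambda>t. w (T + t))"
    by (rule continuous_on_compose2[OF lifetime_pathD(1)[OF assms(1)]]) (auto intro!: continuous_intros simp: assms)
  then have "continuous_on {0..} w'" by (rule continuous_on_eq) (simp add: assms)
  then show ?thesis unfolding lifetime_path_def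
    using lifetime_pathD(2,3)[OF assms(1)] lifetime_pathD(4)[OF assms(1)] assms(2,3)
    by (auto, meson add_left_mono add_nonneg_nonneg order_trans)
qed

section \<open>Measurability of the path functionals\<close>

text \<open>
  The hypotheses concern times up to \<open>t\<close> only, so that the lemma applies to the natural filtration.
\<close>

lemma pred_hitting_time_le:
  assumes meas: "\<And>s. 0 \<le> s \<Longrightarrow> s \<le> t \<Longrightarrow> X s \<in> borel_measurable N"
    and cont: "\<And>\<omega>. \<omega> \<in> space N \<Longrightarrow> continuous_on {0..} (\<lambda>t. X t \<omega>)" and t: "0 \<le> t"
  shows "Measurable.pred N (\<lambda>\<omega>. hitting_time X y \<omega> \<le> ereal t)"
proof -
  let ?Q = "{q \<in> \<rat> \<union> {t}. 0 \<le> q \<and> q \<le> t}"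
  have "Measurable.pred N (\<lambda>\<omega>. \<forall>n::nat. \<exists>q\<in>?Q. ereal (y - 1 / Suc n) < X q \<omega> \<and> X q \<omega> < ereal (y + 1 / Suc n))"
  proof (intro pred_intros_countable measurable_pred_countable pred_intros_logic)
    show "countable ?Q" by (rule countable_subset[of _ "\<rat> \<union> {t}"]) (auto simp: countable_rat)
    fix n :: nat and q assume "q \<in> ?Q"
    then have [measurable]: "X q \<in> borel_measurable N" using meas by auto
    show "Measurable.pred N (\<lambda>\<omega>. ereal (y - 1 / real (Suc n)) < X q \<omega>)" by measurable
    show "Measurable.pred N (\<lambda>\<omega>. X q \<omega> < ereal (y + 1 / real (Suc n)))" by measurable
  qed
  also have "?this \<longleftrightarrow> ?thesis"
    by (rule measurable_cong) (subst hitting_time_eq_hit, subst hit_le_iff_rat[OF cont t], auto)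
  finally show ?thesis .
qed

lemma pred_drawdown_time_less:
  assumes meas: "\<And>s. 0 \<le> s \<Longrightarrow> s < T \<Longrightarrow> X s \<in> borel_measurable N"
    and path: "\<And>\<omega>. \<omega> \<in> space N \<Longrightarrow> lifetime_path l (\<lambda>t. X t \<omega>)" and \<delta>: "0 < \<delta>"
  shows "Measurable.pred N (\<lambda>\<omega>. drawdown_time X \<delta> \<omega> < ereal T)"
proof -
  let ?Q = "{q \<in> \<rat>. 0 \<le> q \<and> q < T}"
  let ?R = "\<lambda>q::real. {r \<in> \<rat>. 0 \<le> r \<and> r \<le> q}"
  have cR: "countable (?R q)" for q by (rule countable_subset[of _ "\<rat>"]) (auto simp: countable_rat)
  have "Measurable.pred N (\<lambda>\<omega>. \<exists>q\<in>?Q. \<exists>r\<in>?R q. X q \<omega> < \<infinity> \<and> X q \<omega> + ereal \<delta> < X r \<omega>)"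
  proof (intro measurable_pred_countable)
    show "countable ?Q" by (rule countable_subset[of _ "\<rat>"]) (auto simp: countable_rat)
    fix q assume q: "q \<in> ?Q"
    show "countable (?R q)" by (rule cR)
    fix r assume qr: "r \<in> ?R q"
    have [measurable]: "X q \<in> borel_measurable N" "X r \<in> borel_measurable N" using meas q qr by auto
    show "Measurable.pred N (\<lambda>\<omega>. X q \<omega> < \<infinity> \<and> X q \<omega> + ereal \<delta> < X r \<omega>)" by measurable
  qed
  also have "?this \<longleftrightarrow> ?thesis"
  proof (rule measurable_cong)
    fix \<omega> assume "\<omega> \<in> space N"
    note p = path[OF this]
    show "(\<exists>q\<in>?Q. \<exists>r\<in>?R q. X q \<omega> < \<infinity> \<and> X q \<omega> + ereal \<delta> < X r \<omega>) = (drawdown_time X \<delta> \<omega> < ereal T)"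
      unfolding drawdown_time_eq_ddtime ddtime_less_iff_rat[OF p \<delta>] by fastforce
  qed
  finally show ?thesis .
qed

lemma measurable_hitting_time:
  assumes meas: "\<And>s. 0 \<le> s \<Longrightarrow> X s \<in> borel_measurable N"
    and cont: "\<And>\<omega>. \<omega> \<in> space N \<Longrightarrow> continuous_on {0..} (\<lambda>t. X t \<omega>)"
  shows "hitting_time X y \<in> borel_measurable N"
proof (rule borel_measurableI_le)
  fix t :: ereal
  have nn: "0 \<le> hitting_time X y \<omega>" for \<omega> unfolding hitting_time_eq_hit by (rule hit_nonneg)
  consider (r) r where "t = ereal r" "0 \<le> r" | (inf) "t = \<infinity>" | (neg) "t < 0" by (cases t) force+
  then show "{\<omega> \<in> space N. hitting_time X y \<omega> \<le> t} \<in> sets N"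
  proof cases
    case r
    then show ?thesis using pred_hitting_time_le[of r X N y] meas cont by (simp add: pred_def)
  next
    case neg
    then have "{\<omega> \<in> space N. hitting_time X y \<omega> \<le> t} = {}" using nn order_trans not_le by blast
    then show ?thesis by (simp only: sets.empty_sets)
  qed auto
qed

lemma measurable_drawdown_time:
  assumes meas: "\<And>s. 0 \<le> s \<Longrightarrow> X s \<in> borel_measurable N"
    and path: "\<And>\<omega>. \<omega> \<in> space N \<Longrightarrow> lifetime_path l (\<lambda>t. X t \<omega>)" and \<delta>: "0 < \<delta>"
  shows "drawdown_time X \<delta> \<in> borel_measurable N"
proof (rule borel_measurableI_less)
  fix t :: ereal
  have *: "{\<omega> \<in> space N. drawdown_time X \<delta> \<omega> < ereal r} \<in> sets N" for r
    using pred_drawdown_time_less[OF meas path \<delta>] by (auto simp: pred_def)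
  show "{\<omega> \<in> space N. drawdown_time X \<delta> \<omega> < t} \<in> sets N"
  proof (cases t)
    case PInf
    have "{\<omega> \<in> space N. drawdown_time X \<delta> \<omega> < t} = (\<Union>n::nat. {\<omega> \<in> space N. drawdown_time X \<delta> \<omega> < ereal n})"
    proof (intro equalityI subsetI)
      fix \<omega> assume w: "\<omega> \<in> {\<omega> \<in> space N. drawdown_time X \<delta> \<omega> < t}"
      then have "drawdown_time X \<delta> \<omega> < \<infinity>" using PInf by auto
      then obtain n :: nat where "drawdown_time X \<delta> \<omega> < ereal n"
        using less_PInf_Ex_of_nat by auto
      then show "\<omega> \<in> (\<Union>n::nat. {\<omega> \<in> space N. drawdown_time X \<delta> \<omega> < ereal n})" using w by auto
    qed (auto simp: PInf)
    then show ?thesis using * by simp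
  qed (use * in auto)
qed

lemma measurable_max_at_drawdown:
  assumes meas: "\<And>s. 0 \<le> s \<Longrightarrow> X s \<in> borel_measurable N"
    and path: "\<And>\<omega>. \<omega> \<in> space N \<Longrightarrow> lifetime_path l (\<lambda>t. X t \<omega>)" and \<delta>: "0 < \<delta>"
  shows "max_at_drawdown X \<delta> \<in> borel_measurable N"
proof (rule borel_measurableI_greater)
  fix c :: ereal
  let ?Q = "{q \<in> \<rat>. (0::real) \<le> q}"
  have [measurable]: "drawdown_time X \<delta> \<in> borel_measurable N" by (rule measurable_drawdown_time[OF meas path \<delta>])
  have "Measurable.pred N (\<lambda>\<omega>. \<exists>q\<in>?Q. ereal q < drawdown_time X \<delta> \<omega> \<and> c < X q \<omega>)"
  proof (intro measurable_pred_countable)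
    show "countable ?Q" by (rule countable_subset[of _ "\<rat>"]) (auto simp: countable_rat)
    fix q assume qr: "q \<in> ?Q"
    have [measurable]: "X q \<in> borel_measurable N" using meas qr by auto
    show "Measurable.pred N (\<lambda>\<omega>. ereal q < drawdown_time X \<delta> \<omega> \<and> c < X q \<omega>)" by measurable
  qed
  note [measurable] = this
  have "Measurable.pred N (\<lambda>\<omega>. (drawdown_time X \<delta> \<omega> = \<infinity> \<and> c < \<infinity>) \<or>
     (drawdown_time X \<delta> \<omega> < \<infinity> \<and> (\<exists>q\<in>?Q. ereal q < drawdown_time X \<delta> \<omega> \<and> c < X q \<omega>)))"
    by measurable
  also have "?this \<longleftrightarrow> Measurable.pred N (\<lambda>\<omega>. c < max_at_drawdown X \<delta> \<omega>)"
  proof (rule measurable_cong)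
    fix \<omega> assume "\<omega> \<in> space N"
    note p = path[OF this]
    show "((drawdown_time X \<delta> \<omega> = \<infinity> \<and> c < \<infinity>) \<or>
     (drawdown_time X \<delta> \<omega> < \<infinity> \<and> (\<exists>q\<in>?Q. ereal q < drawdown_time X \<delta> \<omega> \<and> c < X q \<omega>)))
      = (c < max_at_drawdown X \<delta> \<omega>)"
      unfolding drawdown_time_eq_ddtime max_at_drawdown_eq_ddmax ddmax_greater_iff_rat[OF p \<delta>] by fastforce
  qed
  finally show "{\<omega> \<in> space N. c < max_at_drawdown X \<delta> \<omega>} \<in> sets N" by (simp add: pred_def)
qed

text \<open>
  The path functionals are measurable only on continuous paths, and these do not form a measurable subset
  of the product space.  The trace of the product sigma-algebra on them avoids the difficulty: each of its
  sets is the trace of a measurable set, to which the strong Markov property applies.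
\<close>

definition lifetime_paths :: "ereal \<Rightarrow> (real \<Rightarrow> ereal) measure" where
  "lifetime_paths l = restrict_space path_space {w. lifetime_path l w}"

lemma space_lifetime_paths: "w \<in> space (lifetime_paths l) \<Longrightarrow> lifetime_path l w"
  by (simp add: lifetime_paths_def space_restrict_space)

lemma measurable_coord: "0 \<le> t \<Longrightarrow> coord t \<in> borel_measurable (lifetime_paths l)"
  unfolding lifetime_paths_def coord_def path_space_def
  by (intro measurable_restrict_space1 measurable_component_singleton) auto

lemma measurable_hit[measurable]: "hit y \<in> borel_measurable (lifetime_paths l)"
  unfolding hit_def by (intro measurable_hitting_time measurable_coord)
    (auto simp: coord_def dest!: space_lifetime_paths lifetime_pathD(1))

lemma measurable_ddtime[measurable]: "0 < \<delta> \<Longrightarrow> ddtime \<delta> \<in> borel_measurable (lifetime_paths l)"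
  unfolding ddtime_def by (rule measurable_drawdown_time[OF measurable_coord])
    (auto simp: coord_def dest!: space_lifetime_paths)

text \<open>
  The random time is approximated from the right by times with countably many values, and the paths are
  continuous.
\<close>

lemma measurable_process_at_random_time:
  fixes X :: "real \<Rightarrow> 'a \<Rightarrow> ereal"
  assumes meas: "\<And>s. 0 \<le> s \<Longrightarrow> X s \<in> borel_measurable N"
    and cont: "\<And>\<omega>. \<omega> \<in> space N \<Longrightarrow> continuous_on {0..} (\<lambda>t. X t \<omega>)"
    and T[measurable]: "T \<in> borel_measurable N" and T0: "\<And>\<omega>. \<omega> \<in> space N \<Longrightarrow> 0 \<le> T \<omega>"
  shows "(\<lambda>\<omega>. X (T \<omega>) \<omega>) \<in> borel_measurable N"
proof -
  \<comment> \<open>\<open>Tn n \<omega>\<close> is the least multiple of \<open>1 / (n + 1)\<close> that is not before \<open>T\<close>.\<close>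
  define k where "k n \<omega> = nat \<lceil>T \<omega> * real (Suc n)\<rceil>" for n \<omega>
  define Tn where "Tn n \<omega> = real (k n \<omega>) / real (Suc n)" for n \<omega>
  have m: "(\<lambda>\<omega>. X (Tn n \<omega>) \<omega>) \<in> borel_measurable N" for n
  proof -
    have [measurable]: "k n \<in> measurable N (count_space UNIV)" unfolding k_def by measurable
    have "(\<lambda>\<omega>. X (real (k n \<omega>) / real (Suc n)) \<omega>) \<in> borel_measurable N"
      by (rule measurable_compose_countable[where f="\<lambda>i \<omega>. X (real i / real (Suc n)) \<omega>" and g="k n"])
        (auto intro!: meas)
    then show ?thesis unfolding Tn_def .
  qed
  have lim: "(\<lambda>n. X (Tn n \<omega>) \<omega>) \<longlonglongrightarrow> X (T \<omega>) \<omega>" if w: "\<omega> \<in> space N" for \<omega>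
  proof -
    have b: "T \<omega> \<le> Tn n \<omega> \<and> Tn n \<omega> \<le> T \<omega> + 1 / real (Suc n)" for n
    proof -
      have "0 \<le> T \<omega> * real (Suc n)" using T0[OF w] by simp
      then have "real (k n \<omega>) = of_int \<lceil>T \<omega> * real (Suc n)\<rceil>" unfolding k_def by simp
      then have "T \<omega> * real (Suc n) \<le> real (k n \<omega>)" "real (k n \<omega>) \<le> T \<omega> * real (Suc n) + 1"
        by linarith+
      moreover define N where "N = real (Suc n)"
      moreover have "0 < N" by (simp add: N_def)
      ultimately show ?thesis unfolding Tn_def N_def[symmetric] by (simp add: field_simps)
    qed
    have "(\<lambda>n. Tn n \<omega>) \<longlonglongrightarrow> T \<omega>"
    proof (rule tendsto_sandwich[of "\<lambda>_. T \<omega>" _ _ "\<lambda>n. T \<omega> + 1 / real (Suc n)"])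
      have "(\<lambda>n. T \<omega> + 1 / real (Suc n)) \<longlonglongrightarrow> T \<omega> + 0"
        using LIMSEQ_Suc[OF lim_1_over_n] by (intro tendsto_add) auto
      then show "(\<lambda>n. T \<omega> + 1 / real (Suc n)) \<longlonglongrightarrow> T \<omega>" by simp
    qed (use b in auto)
    moreover have "Tn n \<omega> \<in> {0..}" for n by (simp add: Tn_def)
    moreover have "T \<omega> \<in> {0..}" using T0[OF w] by simp
    ultimately show ?thesis
      by (intro continuous_on_tendsto_compose[OF cont[OF w]]) auto
  qed
  have "(\<lambda>\<omega>. liminf (\<lambda>n. X (Tn n \<omega>) \<omega>)) \<in> borel_measurable N" using m by measurable
  also have "?this \<longleftrightarrow> ?thesis"
    by (rule measurable_cong) (use lim in \<open>auto intro!: lim_imp_Liminf\<close>)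
  finally show ?thesis .
qed

lemma measurable_path_from:
  fixes X :: "real \<Rightarrow> 'a \<Rightarrow> ereal"
  assumes meas: "\<And>s. 0 \<le> s \<Longrightarrow> X s \<in> borel_measurable N"
    and path: "\<And>\<omega>. \<omega> \<in> space N \<Longrightarrow> lifetime_path l (\<lambda>t. X t \<omega>)"
    and T[measurable]: "T \<in> borel_measurable N" and T0: "\<And>\<omega>. \<omega> \<in> space N \<Longrightarrow> 0 \<le> T \<omega>"
  shows "(\<lambda>\<omega>. path_from X (T \<omega>) \<omega>) \<in> measurable N (lifetime_paths l)"
  unfolding lifetime_paths_def
proof (rule measurable_restrict_space2)
  show "(\<lambda>\<omega>. path_from X (T \<omega>) \<omega>) \<in> space N \<rightarrow> {w. lifetime_path l w}"
  proof
    fix \<omega> assume w: "\<omega> \<in> space N"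
    show "path_from X (T \<omega>) \<omega> \<in> {w. lifetime_path l w}"
      using lifetime_path_shift[OF path[OF w] T0[OF w], of "path_from X (T \<omega>) \<omega>"]
      by (simp add: path_from_def)
  qed
  show "(\<lambda>\<omega>. path_from X (T \<omega>) \<omega>) \<in> measurable N path_space"
    unfolding path_space_def path_from_def
  proof (rule measurable_restrict)
    fix t :: real assume "t \<in> {0..}"
    then have "0 \<le> T \<omega> + t" if "\<omega> \<in> space N" for \<omega> using T0[OF that] by simp
    then show "(\<lambda>\<omega>. X (T \<omega> + t) \<omega>) \<in> borel_measurable N"
      using measurable_process_at_random_time[of X N "\<lambda>\<omega>. T \<omega> + t", OF meas lifetime_pathD(1)[OF path]]
      by simp
  qed
qed

lemma hit_path_from: "hit y (path_from X 0 \<omega>) = hitting_time X y \<omega>"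
  unfolding hitting_time_eq_hit by (rule hit_cong) (simp add: path_from_def)

lemma ddtime_path_from: "ddtime \<delta> (path_from X 0 \<omega>) = drawdown_time X \<delta> \<omega>"
  unfolding drawdown_time_eq_ddtime by (rule ddtime_cong) (simp add: path_from_def)

section \<open>The strong Markov property at a hitting time\<close>

context regular_diffusion
begin

abbreviation H :: "real \<Rightarrow> 'a \<Rightarrow> ereal" where
  "H \<equiv> hitting_time X"

abbreviation \<theta> :: "real \<Rightarrow> 'a \<Rightarrow> ereal" where
  "\<theta> \<equiv> drawdown_time X"

abbreviation before :: "('a \<Rightarrow> ereal) \<Rightarrow> ('a \<Rightarrow> ereal) \<Rightarrow> 'a \<Rightarrow> real" where
  "before T U \<equiv> indicator {\<omega>. T \<omega> < U \<omega>}"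

lemma path: "\<omega> \<in> space Om \<Longrightarrow> lifetime_path l (\<lambda>t. X t \<omega>)"
  unfolding lifetime_path_def
proof (intro conjI allI impI)
  assume w: "\<omega> \<in> space Om"
  show "continuous_on {0..} (\<lambda>t. X t \<omega>)" by (rule continuous_paths[OF w])
  fix t :: real assume t: "0 \<le> t"
  from state_space[OF w t] show "l \<le> X t \<omega>" "- \<infinity> < X t \<omega>"
    using state_interval by auto
next
  fix s t assume "\<omega> \<in> space Om" "0 \<le> s" "s \<le> t" "X s \<omega> = \<infinity>"
  then show "X t \<omega> = \<infinity>" by (rule cemetery)
qed

lemma space_natural: "space (natural_filtration Om X t) = space Om"
  unfolding natural_filtration_def by (rule space_measure_of) auto

lemma sets_natural: "sets (natural_filtration Om X t) =
    sigma_sets (space Om) {X s -` A \<inter> space Om | s A. 0 \<le> s \<and> ereal s \<le> t \<and> A \<in> sets borel}"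
  unfolding natural_filtration_def by (rule sets_measure_of) auto

lemma natural_mono: "t \<le> u \<Longrightarrow> sets (natural_filtration Om X t) \<subseteq> sets (natural_filtration Om X u)"
  unfolding sets_natural by (rule sigma_sets_mono') (blast intro: order_trans)

lemma natural_subset: "sets (natural_filtration Om X t) \<subseteq> sets Om"
  unfolding sets_natural by (rule sets.sigma_sets_subset) (auto intro!: measurable_sets[OF measurable_X])

lemma measurable_X_natural: "0 \<le> s \<Longrightarrow> ereal s \<le> t \<Longrightarrow> X s \<in> borel_measurable (natural_filtration Om X t)"
  by (rule measurableI) (auto simp: space_natural sets_natural intro!: sigma_sets.Basic)

lemma space_right: "space (right_filtration Om X t) = space Om"
  unfolding right_filtration_def by (rule space_measure_of) (auto dest: sets.sets_into_space)

lemma sets_right: "sets (right_filtration Om X t) =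
    sigma_sets (space Om) {A \<in> sets Om. \<forall>u>t. A \<in> sets (natural_filtration Om X u)}"
  unfolding right_filtration_def by (rule sets_measure_of) (auto dest: sets.sets_into_space)

lemma right_I:
  assumes "\<And>u. t < u \<Longrightarrow> A \<in> sets (natural_filtration Om X u)" "A \<in> sets Om"
  shows "A \<in> sets (right_filtration Om X t)"
  unfolding sets_right using assms natural_subset by (intro sigma_sets.Basic) auto

lemma natural_right: "sets (natural_filtration Om X t) \<subseteq> sets (right_filtration Om X t)"
proof (intro subsetI right_I)
  fix A assume A: "A \<in> sets (natural_filtration Om X t)"
  show "A \<in> sets Om" by (rule subsetD[OF natural_subset A])
  show "A \<in> sets (natural_filtration Om X u)" if "t < u" for u
    by (rule subsetD[OF natural_mono A]) (rule less_imp_le[OF that])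
qed

lemma right_subset: "sets (right_filtration Om X t) \<subseteq> sets Om"
  unfolding sets_right by (rule sets.sigma_sets_subset) auto

lemma right_filtration: "filtration (space Om) (right_filtration Om X)"
proof
  show "space (right_filtration Om X i) = space Om" for i by (rule space_right)
  fix i j :: ereal assume "i \<le> j"
  then show "sets (right_filtration Om X i) \<subseteq> sets (right_filtration Om X j)"
    unfolding sets_right by (intro sigma_sets_mono') auto
qed

sublocale right: filtration "space Om" "right_filtration Om X"
  by (rule right_filtration)

lemma pre_sigma_subset:
  assumes T: "stopping_time (right_filtration Om X) T"
  shows "sets (right.pre_sigma T) \<subseteq> sets Om"
proof
  fix A assume "A \<in> sets (right.pre_sigma T)"
  from right.sets_pre_sigmaD[OF T this, of \<infinity>] have "A \<in> sets (right_filtration Om X \<infinity>)" by simp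
  then show "A \<in> sets Om" using right_subset by auto
qed

text \<open>
  Whether a point is hit by time \<open>t\<close> is decided by approximate visits up to time \<open>t\<close>, so that hitting times
  are stopping times of the natural filtration already.
\<close>

lemma stopping_hit: "stopping_time (right_filtration Om X) (H y)"
proof
  fix t :: ereal
  have nn: "0 \<le> H y \<omega>" for \<omega> unfolding hitting_time_eq_hit by (rule hit_nonneg)
  have "Measurable.pred (natural_filtration Om X t) (\<lambda>\<omega>. H y \<omega> \<le> t)"
  proof -
    consider (r) r where "t = ereal r" "0 \<le> r" | (inf) "t = \<infinity>" | (neg) "t < 0" by (cases t) force+
    then show ?thesis
    proof cases
      case r
      then show ?thesis unfolding r
        by (intro pred_hitting_time_le measurable_X_natural continuous_paths) (auto simp: space_natural)
    next
      case neg
      then have "\<not> H y \<omega> \<le> t" for \<omega>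
        using less_le_trans[OF neg nn[of \<omega>]] by (simp add: not_le)
      then show ?thesis by simp
    qed auto
  qed
  then have "{\<omega> \<in> space Om. H y \<omega> \<le> t} \<in> sets (natural_filtration Om X t)"
    by (simp only: pred_def space_natural)
  then have "{\<omega> \<in> space Om. H y \<omega> \<le> t} \<in> sets (right_filtration Om X t)"
    by (rule subsetD[OF natural_right])
  then show "Measurable.pred (right_filtration Om X t) (\<lambda>\<omega>. H y \<omega> \<le> t)"
    by (simp only: pred_def space_right)
qed

text \<open>
  Whether the drawdown has begun by time \<open>t\<close> can be seen only immediately after \<open>t\<close>; this is why the
  right-continuous filtration enters.
\<close>

lemma stopping_drawdown:
  assumes \<delta>: "0 < \<delta>"
  shows "stopping_time (right_filtration Om X) (\<theta> \<delta>)"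
proof
  fix t :: ereal
  let ?A = "{\<omega> \<in> space Om. \<theta> \<delta> \<omega> \<le> t}"
  have nn: "0 \<le> \<theta> \<delta> \<omega>" if "\<omega> \<in> space Om" for \<omega>
    unfolding drawdown_time_eq_ddtime by (rule ddtime_nonneg[OF path[OF that] \<delta>])
  have "?A \<in> sets (right_filtration Om X t)"
  proof (rule right_I)
    show "?A \<in> sets Om"
      using measurable_drawdown_time[OF measurable_X path \<delta>] by measurable
    fix u assume "t < u"
    consider (r) r where "t = ereal r" "0 \<le> r" | (neg) "t < 0" using \<open>t < u\<close> by (cases t) force+
    then show "?A \<in> sets (natural_filtration Om X u)"
    proof cases
      case r
      then obtain e where e: "r < e" "ereal e \<le> u" using ereal_dense2[OF \<open>t < u\<close>] by auto
      define q where "q n = r + (e - r) / Suc n" for n :: nat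
      have q: "r < q n" "q n \<le> e" for n
      proof -
        have "0 < (e - r) / Suc n" using e by simp
        moreover have "(e - r) / Suc n \<le> (e - r) / 1" using e by (intro divide_left_mono) auto
        ultimately show "r < q n" "q n \<le> e" by (auto simp: q_def)
      qed
      have "(\<lambda>n. r + (e - r) * (1 / Suc n)) \<longlonglongrightarrow> r + (e - r) * 0"
        using LIMSEQ_Suc[OF lim_1_over_n] by (intro tendsto_intros) auto
      then have lim: "q \<longlonglongrightarrow> r" by (simp add: q_def[abs_def])
      have "?A = (\<Inter>n. {\<omega> \<in> space Om. \<theta> \<delta> \<omega> < ereal (q n)})"
      proof (intro equalityI subsetI)
        fix \<omega> assume "\<omega> \<in> ?A"
        then show "\<omega> \<in> (\<Inter>n. {\<omega> \<in> space Om. \<theta> \<delta> \<omega> < ereal (q n)})"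
          using q(1) r by (auto intro: le_less_trans)
      next
        fix \<omega> assume w: "\<omega> \<in> (\<Inter>n. {\<omega> \<in> space Om. \<theta> \<delta> \<omega> < ereal (q n)})"
        have "(\<lambda>n. ereal (q n)) \<longlonglongrightarrow> ereal r" using lim by simp
        then have "\<theta> \<delta> \<omega> \<le> ereal r"
          by (rule LIMSEQ_le_const) (use w in \<open>auto intro: less_imp_le\<close>)
        then show "\<omega> \<in> ?A" using w r by auto
      qed
      moreover have "{\<omega> \<in> space Om. \<theta> \<delta> \<omega> < ereal (q n)} \<in> sets (natural_filtration Om X u)" for n
      proof -
        have "Measurable.pred (natural_filtration Om X u) (\<lambda>\<omega>. \<theta> \<delta> \<omega> < ereal (q n))"
        proof (rule pred_drawdown_time_less[OF _ path \<delta>])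
          fix s assume "0 \<le> s" "s < q n"
          then have "ereal s \<le> ereal e" using q(2)[of n] by simp
          then show "X s \<in> borel_measurable (natural_filtration Om X u)"
            using e \<open>0 \<le> s\<close> by (intro measurable_X_natural) (auto intro: order_trans[of "ereal s" "ereal e"])
        qed (simp add: space_natural)
        then show ?thesis by (simp add: pred_def space_natural)
      qed
      ultimately show ?thesis by auto
    next
      case neg
      have "\<not> \<theta> \<delta> \<omega> \<le> t" if "\<omega> \<in> space Om" for \<omega>
        using less_le_trans[OF neg nn[OF that]] by (simp add: not_le)
      then have "?A = {}" by blast
      then show ?thesis by (simp only: sets.empty_sets)
    qed
  qed
  then show "Measurable.pred (right_filtration Om X t) (\<lambda>\<omega>. \<theta> \<delta> \<omega> \<le> t)"
    by (simp add: pred_def space_right)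
qed

lemma space_P: "x \<in> I \<Longrightarrow> space (P x) = space Om"
  using sets_P by (rule sets_eq_imp_space_eq)

lemma measurable_P: "x \<in> I \<Longrightarrow> measurable (P x) N = measurable Om N"
  using sets_P by (intro measurable_cong_sets) auto

lemma measurable_hit_P: "x \<in> I \<Longrightarrow> H y \<in> borel_measurable (P x)"
  unfolding measurable_P by (intro measurable_hitting_time measurable_X continuous_paths)

lemma measurable_drawdown_P: "0 < \<delta> \<Longrightarrow> x \<in> I \<Longrightarrow> \<theta> \<delta> \<in> borel_measurable (P x)"
  unfolding measurable_P by (rule measurable_drawdown_time[OF measurable_X path])

lemma measurable_max_P: "0 < \<delta> \<Longrightarrow> x \<in> I \<Longrightarrow> max_at_drawdown X \<delta> \<in> borel_measurable (P x)"
  unfolding measurable_P by (rule measurable_max_at_drawdown[OF measurable_X path])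

lemma measurable_path_from_P:
  assumes "x \<in> I" "T \<in> borel_measurable Om" "\<And>\<omega>. 0 \<le> T \<omega>"
  shows "(\<lambda>\<omega>. path_from X (T \<omega>) \<omega>) \<in> measurable (P x) (lifetime_paths l)"
  using assms by (subst measurable_P) (auto intro!: measurable_path_from measurable_X path)

abbreviation path_after_hit :: "real \<Rightarrow> 'a \<Rightarrow> real \<Rightarrow> ereal" where
  "path_after_hit v \<omega> \<equiv> path_from X (real_of_ereal (H v \<omega>)) \<omega>"

lemma measurable_after_hit:
  "x \<in> I \<Longrightarrow> path_after_hit v \<in> measurable (P x) (lifetime_paths l)"
proof (rule measurable_path_from_P)
  have "H v \<in> borel_measurable Om"
    by (intro measurable_hitting_time measurable_X continuous_paths)
  then show "(\<lambda>\<omega>. real_of_ereal (H v \<omega>)) \<in> borel_measurable Om" by simp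
  show "0 \<le> real_of_ereal (H v \<omega>)" for \<omega>
    by (subst hitting_time_eq_hit) (intro real_of_ereal_pos hit_nonneg)
qed

lemma measurable_path_P: "x \<in> I \<Longrightarrow> path_from X 0 \<in> measurable (P x) (lifetime_paths l)"
  using measurable_path_from_P[of x "\<lambda>_. 0"] by simp

lemma sets_lifetime_paths_trace:
  assumes "B \<in> sets (lifetime_paths l)"
  obtains B' where "B' \<in> sets path_space" "B = B' \<inter> {w. lifetime_path l w}"
  using assms unfolding lifetime_paths_def by (auto simp: sets_restrict_space)

lemma alive_at_hit:
  assumes w: "\<omega> \<in> space Om"
  shows "alive_at X (H v) \<omega> \<longleftrightarrow> H v \<omega> < \<infinity>"
    and "H v \<omega> < \<infinity> \<Longrightarrow> X (real_of_ereal (H v \<omega>)) \<omega> = ereal v"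
proof -
  show *: "X (real_of_ereal (H v \<omega>)) \<omega> = ereal v" if "H v \<omega> < \<infinity>"
    using hit_attained[OF continuous_paths[OF w], of v] that unfolding hitting_time_eq_hit by (metis real_of_ereal.simps(1))
  show "alive_at X (H v) \<omega> \<longleftrightarrow> H v \<omega> < \<infinity>"
    unfolding alive_at_def using * by auto
qed

text \<open>
  At a hitting time of \<open>v\<close> the state is the constant \<open>v\<close>, so the strong Markov property says that past and
  future are independent on \<open>{H v < \<infinity>}\<close>, the future having law \<open>P v\<close>.
\<close>

lemma strong_Markov_hit_sets:
  assumes x: "x \<in> I" and v: "v \<in> I" and A: "A \<in> sets (right.pre_sigma (H v))"
    and B: "B \<in> sets (lifetime_paths l)"
  shows "emeasure (P x) {\<omega> \<in> A. H v \<omega> < \<infinity> \<and> path_after_hit v \<omega> \<in> B} =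
     emeasure (P x) {\<omega> \<in> A. H v \<omega> < \<infinity>} *
     emeasure (P v) {\<omega> \<in> space Om. path_from X 0 \<omega> \<in> B}"
proof -
  obtain B' where B': "B' \<in> sets path_space" "B = B' \<inter> {w. lifetime_path l w}"
    using sets_lifetime_paths_trace[OF B] by metis
  have AOm: "A \<in> sets Om" using pre_sigma_subset[OF stopping_hit] A by auto
  then have sub: "\<omega> \<in> space Om" if "\<omega> \<in> A" for \<omega> using sets.sets_into_space that by auto
  have B_iff: "path_from X (real_of_ereal T) \<omega> \<in> B \<longleftrightarrow> path_from X (real_of_ereal T) \<omega> \<in> B'"
    if "\<omega> \<in> space Om" "0 \<le> T" for \<omega> and T
  proof -
    have "lifetime_path l (path_from X (real_of_ereal T) \<omega>)"
      using lifetime_path_shift[OF path[OF that(1)], of "real_of_ereal T"] that(2)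
      by (simp add: path_from_def real_of_ereal_pos)
    then show ?thesis using B' by auto
  qed
  have nn: "0 \<le> H y \<omega>" for y \<omega> unfolding hitting_time_eq_hit by (rule hit_nonneg)
  have "{\<omega> \<in> A. H v \<omega> < \<infinity> \<and> path_after_hit v \<omega> \<in> B} =
     {\<omega> \<in> A. alive_at X (H v) \<omega> \<and> path_after_hit v \<omega> \<in> B'}"
    using alive_at_hit(1) sub B_iff nn by auto
  then have "emeasure (P x) {\<omega> \<in> A. H v \<omega> < \<infinity> \<and> path_after_hit v \<omega> \<in> B} =
     (\<integral>\<^sup>+ \<omega>. indicator {\<omega> \<in> A. alive_at X (H v) \<omega>} \<omega> *
          emeasure (P (real_of_ereal (X (real_of_ereal (H v \<omega>)) \<omega>)))
            {\<omega>' \<in> space Om. path_from X 0 \<omega>' \<in> B'} \<partial>P x)"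
    using strong_Markov[OF x nn stopping_hit A B'(1)] by simp
  also have "\<dots> = (\<integral>\<^sup>+ \<omega>. indicator {\<omega> \<in> A. H v \<omega> < \<infinity>} \<omega> *
          emeasure (P v) {\<omega>' \<in> space Om. path_from X 0 \<omega>' \<in> B} \<partial>P x)"
  proof (intro nn_integral_cong)
    fix \<omega>
    have e: "{\<omega>' \<in> space Om. path_from X 0 \<omega>' \<in> B'} = {\<omega>' \<in> space Om. path_from X 0 \<omega>' \<in> B}"
      using B_iff[of _ 0] by auto
    show "indicator {\<omega> \<in> A. alive_at X (H v) \<omega>} \<omega> *
          emeasure (P (real_of_ereal (X (real_of_ereal (H v \<omega>)) \<omega>)))
            {\<omega>' \<in> space Om. path_from X 0 \<omega>' \<in> B'} =
       indicator {\<omega> \<in> A. H v \<omega> < \<infinity>} \<omega> * emeasure (P v) {\<omega>' \<in> space Om. path_from X 0 \<omega>' \<in> B}"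
      using alive_at_hit[of \<omega> v] sub[of \<omega>] e by (auto split: split_indicator)
  qed
  also have "\<dots> = emeasure (P v) {\<omega>' \<in> space Om. path_from X 0 \<omega>' \<in> B} *
     emeasure (P x) {\<omega> \<in> A. H v \<omega> < \<infinity>}"
  proof -
    have [measurable]: "H v \<in> borel_measurable (P x)" "A \<in> sets (P x)"
      using measurable_hit_P[OF x] AOm sets_P[OF x] by auto
    have "{\<omega> \<in> A. H v \<omega> < \<infinity>} = A \<inter> {\<omega> \<in> space (P x). H v \<omega> < \<infinity>}"
      using sub space_P[OF x] by auto
    also have "\<dots> \<in> sets (P x)" by measurable
    finally show ?thesis by (subst nn_integral_multc) (auto simp: mult.commute)
  qed
  finally show ?thesis by (simp add: mult.commute)
qed

lemma strong_Markov_hit_indicator: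
  assumes x: "x \<in> I" and v: "v \<in> I" and A: "A \<in> sets (right.pre_sigma (H v))"
    and F[measurable]: "F \<in> borel_measurable (lifetime_paths l)"
  shows "(\<integral>\<^sup>+ \<omega>. indicator {\<omega> \<in> A. H v \<omega> < \<infinity>} \<omega> * F (path_after_hit v \<omega>) \<partial>P x) =
     emeasure (P x) {\<omega> \<in> A. H v \<omega> < \<infinity>} * (\<integral>\<^sup>+ \<omega>. F (path_from X 0 \<omega>) \<partial>P v)"
proof -
  have AOm: "A \<in> sets Om" using pre_sigma_subset[OF stopping_hit] A by auto
  have [measurable]: "H v \<in> borel_measurable (P x)" "A \<in> sets (P x)"
    "path_after_hit v \<in> measurable (P x) (lifetime_paths l)" "path_from X 0 \<in> measurable (P v) (lifetime_paths l)"
    using measurable_hit_P[OF x] AOm sets_P[OF x] measurable_after_hit[OF x] measurable_path_P[OF v] by auto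
  let ?A = "{\<omega> \<in> A. H v \<omega> < \<infinity>}"
  have "?A = A \<inter> {\<omega> \<in> space (P x). H v \<omega> < \<infinity>}"
    using AOm[THEN sets.sets_into_space] space_P[OF x] by auto
  also have "\<dots> \<in> sets (P x)" by measurable
  finally have [measurable]: "?A \<in> sets (P x)" .
  \<comment> \<open>Both sides are integrals of \<open>F\<close> against a measure on the path space; the measures agree on sets.\<close>
  define M1 where "M1 = distr (density (P x) (indicator ?A)) (lifetime_paths l) (path_after_hit v)"
  define M2 where "M2 = scale_measure (emeasure (P x) ?A) (distr (P v) (lifetime_paths l) (path_from X 0))"
  have "M1 = M2"
  proof (rule measure_eqI)
    show "sets M1 = sets M2" by (simp add: M1_def M2_def)
    fix B assume "B \<in> sets M1"
    then have [measurable]: "B \<in> sets (lifetime_paths l)" by (simp add: M1_def)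
    have "emeasure M1 B = (\<integral>\<^sup>+ \<omega>. indicator ?A \<omega> * indicator (path_after_hit v -` B \<inter> space (P x)) \<omega> \<partial>P x)"
      unfolding M1_def by (subst emeasure_distr) (auto simp: emeasure_density)
    also have "\<dots> = (\<integral>\<^sup>+ \<omega>. indicator {\<omega> \<in> A. H v \<omega> < \<infinity> \<and> path_after_hit v \<omega> \<in> B} \<omega> \<partial>P x)"
      by (intro nn_integral_cong) (auto split: split_indicator)
    also have "\<dots> = emeasure (P x) {\<omega> \<in> A. H v \<omega> < \<infinity> \<and> path_after_hit v \<omega> \<in> B}"
    proof (rule nn_integral_indicator)
      have "{\<omega> \<in> A. H v \<omega> < \<infinity> \<and> path_after_hit v \<omega> \<in> B} = ?A \<inter> (path_after_hit v -` B \<inter> space (P x))"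
        using AOm[THEN sets.sets_into_space] space_P[OF x] by auto
      also have "\<dots> \<in> sets (P x)" by measurable
      finally show "{\<omega> \<in> A. H v \<omega> < \<infinity> \<and> path_after_hit v \<omega> \<in> B} \<in> sets (P x)" .
    qed
    also have "\<dots> = emeasure M2 B"
      unfolding strong_Markov_hit_sets[OF x v A \<open>B \<in> sets (lifetime_paths l)\<close>] M2_def
      by (auto simp: emeasure_distr space_P[OF v] vimage_def Int_def conj_commute)
    finally show "emeasure M1 B = emeasure M2 B" .
  qed
  have "(\<integral>\<^sup>+ \<omega>. indicator ?A \<omega> * F (path_after_hit v \<omega>) \<partial>P x) = (\<integral>\<^sup>+ w. F w \<partial>M1)"
    unfolding M1_def by (subst nn_integral_distr) (auto simp: nn_integral_density)
  also have "\<dots> = (\<integral>\<^sup>+ w. F w \<partial>M2)" by (simp add: \<open>M1 = M2\<close>)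
  also have "\<dots> = emeasure (P x) ?A * (\<integral>\<^sup>+ \<omega>. F (path_from X 0 \<omega>) \<partial>P v)"
    unfolding M2_def by (subst nn_integral_scale_measure) (auto simp: nn_integral_distr)
  finally show ?thesis .
qed

text \<open>
  The product formula extends from events to measurable weights: for the future by equality of two
  measures, for the past by approximation with simple functions.
\<close>

theorem strong_Markov_hit:
  assumes x: "x \<in> I" and v: "v \<in> I" and Y: "Y \<in> borel_measurable (right.pre_sigma (H v))"
    and F[measurable]: "F \<in> borel_measurable (lifetime_paths l)"
  shows "(\<integral>\<^sup>+ \<omega>. Y \<omega> * indicator {\<omega>. H v \<omega> < \<infinity>} \<omega> * F (path_after_hit v \<omega>) \<partial>P x) =
     (\<integral>\<^sup>+ \<omega>. Y \<omega> * indicator {\<omega>. H v \<omega> < \<infinity>} \<omega> \<partial>P x) * (\<integral>\<^sup>+ \<omega>. F (path_from X 0 \<omega>) \<partial>P v)"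
proof -
  have sp: "space (right.pre_sigma (H v)) = space (P x)"
    by (simp add: right.space_pre_sigma space_P[OF x])
  have sub: "f \<in> borel_measurable (P x)" if "f \<in> borel_measurable (right.pre_sigma (H v))" for f :: "'a \<Rightarrow> ennreal"
    using that pre_sigma_subset[OF stopping_hit, of v] measurable_P[OF x]
    by (intro measurable_mono[THEN subsetD, of borel borel "right.pre_sigma (H v)" "P x"])
       (auto simp: sets_P[OF x] sp)
  have [measurable]: "H v \<in> borel_measurable (P x)"
    "path_after_hit v \<in> measurable (P x) (lifetime_paths l)"
    using measurable_hit_P[OF x] measurable_after_hit[OF x] by auto
  show ?thesis
    using Y
  proof (induction rule: borel_measurable_induct)
    case (cong f g)
    have *: "(\<integral>\<^sup>+ \<omega>. f \<omega> * indicator {\<omega>. H v \<omega> < \<infinity>} \<omega> * F (path_after_hit v \<omega>) \<partial>P x) =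
      (\<integral>\<^sup>+ \<omega>. g \<omega> * indicator {\<omega>. H v \<omega> < \<infinity>} \<omega> * F (path_after_hit v \<omega>) \<partial>P x)"
      "(\<integral>\<^sup>+ \<omega>. f \<omega> * indicator {\<omega>. H v \<omega> < \<infinity>} \<omega> \<partial>P x) =
      (\<integral>\<^sup>+ \<omega>. g \<omega> * indicator {\<omega>. H v \<omega> < \<infinity>} \<omega> \<partial>P x)"
      by (intro nn_integral_cong, simp add: cong(3) sp)+
    show ?case unfolding * by (rule cong(4))
  next
    case (set A)
    have AOm: "A \<in> sets Om" using pre_sigma_subset[OF stopping_hit] set by auto
    have e: "indicator A \<omega> * indicator {\<omega>. H v \<omega> < \<infinity>} \<omega> = (indicator {\<omega> \<in> A. H v \<omega> < \<infinity>} \<omega> :: ennreal)" for \<omega>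
      by (auto split: split_indicator)
    have [measurable]: "A \<in> sets (P x)" using AOm sets_P[OF x] by simp
    have "{\<omega> \<in> A. H v \<omega> < \<infinity>} = A \<inter> {\<omega> \<in> space (P x). H v \<omega> < \<infinity>}"
      using AOm[THEN sets.sets_into_space] space_P[OF x] by auto
    also have "\<dots> \<in> sets (P x)" by measurable
    finally show ?case unfolding e strong_Markov_hit_indicator[OF x v set F] by simp
  next
    case (mult u c)
    note [measurable] = sub[OF mult(2)]
    have [measurable]: "indicator {\<omega>. H v \<omega> < \<infinity>} \<in> borel_measurable (P x)"
      by (rule borel_measurable_indicator') measurable
    show ?case using mult by (simp add: mult.assoc nn_integral_cmult)
  next
    case (add u w)
    note [measurable] = sub[OF add(1)] sub[OF add(3)]
    have [measurable]: "indicator {\<omega>. H v \<omega> < \<infinity>} \<in> borel_measurable (P x)"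
      by (rule borel_measurable_indicator') measurable
    show ?case using add.IH by (simp add: distrib_right nn_integral_add)
  next
    case (seq U)
    note [measurable] = sub[OF seq(1)]
    have [measurable]: "indicator {\<omega>. H v \<omega> < \<infinity>} \<in> borel_measurable (P x)"
      by (rule borel_measurable_indicator') measurable
    have inc: "incseq (\<lambda>i \<omega>. U i \<omega> * f \<omega>)" for f :: "'a \<Rightarrow> ennreal"
      using seq.hyps(3) by (auto simp: incseq_def le_fun_def intro!: mult_right_mono)
    have sup: "(SUP i. U i) \<omega> * c = (SUP i. U i \<omega> * c)" for \<omega> and c :: ennreal
      unfolding SUP_apply by (rule SUP_mult_right_ennreal)
    let ?h = "indicator {\<omega>. H v \<omega> < \<infinity>} :: 'a \<Rightarrow> ennreal"
    have 1: "(\<integral>\<^sup>+ \<omega>. (SUP i. U i) \<omega> * (?h \<omega> * F (path_after_hit v \<omega>)) \<partial>P x) =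
      (SUP i. \<integral>\<^sup>+ \<omega>. U i \<omega> * (?h \<omega> * F (path_after_hit v \<omega>)) \<partial>P x)"
      unfolding sup by (rule nn_integral_monotone_convergence_SUP[OF inc]) measurable
    have 2: "(\<integral>\<^sup>+ \<omega>. (SUP i. U i) \<omega> * ?h \<omega> \<partial>P x) = (SUP i. \<integral>\<^sup>+ \<omega>. U i \<omega> * ?h \<omega> \<partial>P x)"
      unfolding sup by (rule nn_integral_monotone_convergence_SUP[OF inc]) measurable
    show ?case
      using seq.IH unfolding mult.assoc 1 2 by (simp add: SUP_mult_right_ennreal)
  qed
qed

end

section \<open>One-sided derivatives with respect to the scale\<close>

text \<open>
  A mean value inequality for one-sided derivatives.  For \<open>e > 0\<close> the function \<open>f - (K + e) S\<close> is strictly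
  greater just to the left of every point of the interval, so its maximum on the interval can only be
  at \<open>x\<close>.
\<close>

lemma S_increment_le:
  fixes f S D :: "real \<Rightarrow> real"
  assumes xz: "x \<le> z" and f: "continuous_on {x..z} f" and S: "continuous_on {x..z} S"
    and mono: "strict_mono_on {x..z} S"
    and lim: "\<And>t. x < t \<Longrightarrow> t \<le> z \<Longrightarrow> (S_quotient S f t \<longlongrightarrow> D t) (at_left t)"
    and le: "\<And>t. x < t \<Longrightarrow> t \<le> z \<Longrightarrow> D t \<le> K"
  shows "f z - f x \<le> K * (S z - S x)"
proof -
  \<comment> \<open>The slack \<open>e\<close> makes the comparison strict.\<close>
  have step: "f z - f x \<le> (K + e) * (S z - S x)" if e: "0 < e" for e
  proof -
    define g where "g t = f t - (K + e) * S t" for t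
    have "continuous_on {x..z} g" unfolding g_def by (intro continuous_intros f S)
    then obtain s where s: "s \<in> {x..z}" "\<And>t. t \<in> {x..z} \<Longrightarrow> g t \<le> g s"
      using continuous_attains_sup[of "{x..z}" g] xz by auto
    have "s = x"
    proof (rule ccontr)
      assume "s \<noteq> x"
      then have s': "x < s" "s \<le> z" using s(1) by auto
      have "D s < K + e" using le[OF s'] e by simp
      then have "eventually (\<lambda>t. S_quotient S f s t < K + e) (at_left s)"
        using lim[OF s'] by (rule order_tendstoD(2)[rotated])
      moreover have "eventually (\<lambda>t. t \<in> {x<..<s}) (at_left s)"
        using s'(1) by (rule eventually_at_left_real)
      ultimately have "eventually (\<lambda>t. S_quotient S f s t < K + e \<and> t \<in> {x<..<s}) (at_left s)"
        by (rule eventually_conj)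
      then obtain t where t: "S_quotient S f s t < K + e" "x < t" "t < s"
        using eventually_happens'[OF trivial_limit_at_left_real] by fastforce
      have "S t < S s" using mono t s' unfolding strict_mono_on_def by auto
      then have "(f t - f s) > (K + e) * (S t - S s)"
        using t(1) unfolding S_quotient_def by (simp add: neg_divide_less_eq)
      then have "g s < g t" by (simp add: g_def algebra_simps)
      then show False using s(2)[of t] t s' by auto
    qed
    then have "g z \<le> g x" using s(2)[of z] xz by simp
    then show ?thesis by (simp add: g_def algebra_simps)
  qed
  show ?thesis
  proof (cases "S z - S x = 0")
    case True then show ?thesis using step[of 1] by simp
  next
    case False
    then have "x < z" using xz by (cases "x = z") auto
    then have pos: "0 < S z - S x" using mono unfolding strict_mono_on_def by auto
    show ?thesis
    proof (rule field_le_epsilon)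
      fix e :: real assume "0 < e"
      then show "f z - f x \<le> K * (S z - S x) + e"
        using step[of "e / (S z - S x)"] pos by (simp add: distrib_right)
    qed
  qed
qed

lemma S_increment_ge:
  fixes f S D :: "real \<Rightarrow> real"
  assumes xz: "x \<le> z" and f: "continuous_on {x..z} f" and S: "continuous_on {x..z} S"
    and mono: "strict_mono_on {x..z} S"
    and lim: "\<And>t. x < t \<Longrightarrow> t \<le> z \<Longrightarrow> (S_quotient S f t \<longlongrightarrow> D t) (at_left t)"
    and le: "\<And>t. x < t \<Longrightarrow> t \<le> z \<Longrightarrow> K \<le> D t"
  shows "K * (S z - S x) \<le> f z - f x"
proof -
  have "(\<lambda>t. - f t) z - (\<lambda>t. - f t) x \<le> (- K) * (S z - S x)"
  proof (rule S_increment_le[where D="\<lambda>t. - D t"])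
    fix t assume "x < t" "t \<le> z"
    from tendsto_minus[OF lim[OF this]] show "(S_quotient S (\<lambda>t. - f t) t \<longlongrightarrow> - D t) (at_left t)"
      by (rule tendsto_cong[THEN iffD1, rotated]) (auto simp: S_quotient_def divide_simps)
  qed (use assms in \<open>auto intro!: continuous_intros\<close>)
  then show ?thesis by simp
qed

lemma DERIV_of_left_S_deriv:
  fixes f S D :: "real \<Rightarrow> real"
  assumes ab: "a < y" "y < b" and f: "continuous_on {a<..<b} f" and S: "continuous_on {a<..<b} S"
    and mono: "strict_mono_on {a<..<b} S"
    and lim: "\<And>t. a < t \<Longrightarrow> t < b \<Longrightarrow> (S_quotient S f t \<longlongrightarrow> D t) (at_left t)"
    and D: "isCont D y" and S': "(S has_real_derivative S') (at y)"
  shows "(f has_real_derivative D y * S') (at y)"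
proof -
  have quot: "(S_quotient S f y \<longlongrightarrow> D y) (at y)"
  proof (rule tendstoI)
    fix e :: real assume e: "0 < e"
    then have "eventually (\<lambda>t. dist (D t) (D y) < e / 2) (at y)"
      using D unfolding isCont_def by (intro tendstoD) auto
    then obtain d where d: "0 < d" "\<And>t. t \<noteq> y \<Longrightarrow> dist t y < d \<Longrightarrow> dist (D t) (D y) < e / 2"
      unfolding eventually_at by auto
    define r where "r = min d (min (y - a) (b - y))"
    have r: "0 < r" "r \<le> d" "r \<le> y - a" "r \<le> b - y" using d ab by (auto simp: r_def)
    have Dt: "D y - e / 2 \<le> D t" "D t \<le> D y + e / 2" if "\<bar>t - y\<bar> < r" for t
    proof -
      have "\<bar>D t - D y\<bar> \<le> e / 2"
        using d(2)[of t] that r e by (cases "t = y") (auto simp: dist_real_def)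
      then show "D y - e / 2 \<le> D t" "D t \<le> D y + e / 2" by linarith+
    qed
    have bound: "(D y - e/2) * (S z - S x) \<le> f z - f x" "f z - f x \<le> (D y + e/2) * (S z - S x)"
      if "x \<le> z" "\<bar>x - y\<bar> < r" "\<bar>z - y\<bar> < r" for x z
    proof -
      have sub: "{x..z} \<subseteq> {a<..<b}"
      proof
        fix t assume "t \<in> {x..z}"
        then have "x \<le> t" "t \<le> z" by auto
        then show "t \<in> {a<..<b}" using that r unfolding abs_less_iff greaterThanLessThan_iff by linarith
      qed
      note h = continuous_on_subset[OF f sub] continuous_on_subset[OF S sub] monotone_on_subset[OF mono sub]
      have tr: "\<bar>t - y\<bar> < r \<and> a < t \<and> t < b" if "x < t" "t \<le> z" for t
        using that \<open>\<bar>x - y\<bar> < r\<close> \<open>\<bar>z - y\<bar> < r\<close> r unfolding abs_less_iff by linarith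
      show "(D y - e/2) * (S z - S x) \<le> f z - f x"
        using S_increment_ge[OF that(1) h, of D "D y - e/2"] lim Dt tr by blast
      show "f z - f x \<le> (D y + e/2) * (S z - S x)"
        using S_increment_le[OF that(1) h, of D "D y + e/2"] lim Dt tr by blast
    qed
    have "dist (S_quotient S f y t) (D y) < e" if t: "t \<noteq> y" "\<bar>t - y\<bar> < r" for t
    proof (cases "y < t")
      case True
      then have s: "S y < S t" using mono t r ab unfolding strict_mono_on_def by auto
      then have "D y - e/2 \<le> S_quotient S f y t" "S_quotient S f y t \<le> D y + e/2"
        using bound[of y t] True t r unfolding S_quotient_def by (auto simp: field_simps)
      then show ?thesis using e by (simp add: dist_real_def abs_less_iff)
    next
      case False
      then have s: "S t < S y" using mono t r ab unfolding strict_mono_on_def by auto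
      have "S_quotient S f y t = (f y - f t) / (S y - S t)"
        unfolding S_quotient_def using s by (simp add: field_simps)
      then have "D y - e/2 \<le> S_quotient S f y t" "S_quotient S f y t \<le> D y + e/2"
        using bound[of t y] False t r s by (simp_all add: pos_le_divide_eq pos_divide_le_eq)
      then show ?thesis using e by (simp add: dist_real_def abs_less_iff)
    qed
    then show "eventually (\<lambda>t. dist (S_quotient S f y t) (D y) < e) (at y)"
      unfolding eventually_at using r(1) by (auto simp: dist_real_def intro!: exI[of _ r])
  qed
  have "((\<lambda>t. S_quotient S f y t * ((S t - S y) / (t - y))) \<longlongrightarrow> D y * S') (at y)"
    using quot S' unfolding has_field_derivative_iff by (rule tendsto_mult)
  moreover have "eventually (\<lambda>t. S_quotient S f y t * ((S t - S y) / (t - y)) = (f t - f y) / (t - y)) (at y)"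
  proof -
    have "eventually (\<lambda>t. t \<in> {a<..<b}) (at y)" using ab by (intro eventually_at_in_open') auto
    moreover have "eventually (\<lambda>t. t \<noteq> y) (at y)" by (simp add: eventually_at_filter)
    ultimately show ?thesis
    proof eventually_elim
      case (elim t)
      then have "S t \<noteq> S y" using mono ab unfolding strict_mono_on_def
        by (metis greaterThanLessThan_iff less_irrefl linorder_neqE_linordered_idom)
      then show ?case by (simp add: S_quotient_def)
    qed
  qed
  ultimately show ?thesis unfolding has_field_derivative_iff by (rule Lim_transform_eventually)
qed

section \<open>The differential equations\<close>

text \<open>
  For two solutions \<open>p\<close> and \<open>q\<close> of a linear equation, \<open>cross p q a\<close> is the combination of them that vanishes
  at \<open>a\<close>.
\<close>

definition cross :: "(real \<Rightarrow> real) \<Rightarrow> (real \<Rightarrow> real) \<Rightarrow> real \<Rightarrow> real \<Rightarrow> real" where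
  "cross p q a v = q a * p v - q v * p a"

text \<open>
  The analytic data of the exit problem.  \<open>p\<close> increases relative to \<open>q\<close>, which is what positivity of \<open>cross\<close>
  means; the two instances are \<open>p = \<psi>\<close>, \<open>q = \<phi>\<close> for a positive discount rate and \<open>p = S\<close>, \<open>q = 1\<close> for rate \<open>0\<close>.
  Derivatives are taken with respect to the real variable, so they contain the factor \<open>S'\<close>.  At \<open>L\<close> the lower
  barrier \<open>L - \<delta>\<close> may be the left endpoint \<open>lo\<close>, where nothing is known about \<open>p\<close> and \<open>q\<close>.
\<close>

locale drawdown_analysis =
  fixes lo :: ereal and p q p' q' :: "real \<Rightarrow> real" and \<delta> L :: real
  assumes \<delta>: "0 < \<delta>" and L: "lo \<le> ereal (L - \<delta>)"
    and dp: "\<And>y. lo < ereal y \<Longrightarrow> (p has_real_derivative p' y) (at y)"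
    and dq: "\<And>y. lo < ereal y \<Longrightarrow> (q has_real_derivative q' y) (at y)"
    and cp': "\<And>y. lo < ereal y \<Longrightarrow> isCont p' y"
    and cq': "\<And>y. lo < ereal y \<Longrightarrow> isCont q' y"
    and cross_pos: "\<And>a v. lo < ereal a \<Longrightarrow> a < v \<Longrightarrow> 0 < cross p q a v"
    and q_pos: "\<And>a. lo < ereal a \<Longrightarrow> 0 < q a"
    and q_anti: "\<And>a v. lo < ereal a \<Longrightarrow> a \<le> v \<Longrightarrow> q v \<le> q a"
begin

text \<open>
  In the intended instances \<open>hazard\<close> is \<open>b S'\<close> and \<open>drop_rate\<close> is \<open>c S'\<close>.
\<close>

definition hazard :: "real \<Rightarrow> real" where
  "hazard y = (q (y - \<delta>) * p' y - p (y - \<delta>) * q' y) / cross p q (y - \<delta>) y"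

definition drop_rate :: "real \<Rightarrow> real" where
  "drop_rate y = (q y * p' y - p y * q' y) / cross p q (y - \<delta>) y"

lemma lo_less: "L < y \<Longrightarrow> lo < ereal (y - \<delta>)" "L \<le> y \<Longrightarrow> lo < ereal y" "L < y + \<delta> \<Longrightarrow> lo < ereal y"
proof -
  have *: "lo < ereal z" if "L - \<delta> < z" for z
  proof -
    have "ereal (L - \<delta>) < ereal z" using that by simp
    then show ?thesis using L by (rule le_less_trans[rotated])
  qed
  show "L < y \<Longrightarrow> lo < ereal (y - \<delta>)" "L \<le> y \<Longrightarrow> lo < ereal y" "L < y + \<delta> \<Longrightarrow> lo < ereal y"
    using * \<delta> by auto
qed

lemma isCont_p: "lo < ereal y \<Longrightarrow> isCont p y" using DERIV_isCont[OF dp] .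
lemma isCont_q: "lo < ereal y \<Longrightarrow> isCont q y" using DERIV_isCont[OF dq] .

lemma tendsto_p: "lo < ereal y \<Longrightarrow> (v \<longlongrightarrow> y) F \<Longrightarrow> ((\<lambda>t. p (v t)) \<longlongrightarrow> p y) F"
  using isCont_tendsto_compose[OF isCont_p] .
lemma tendsto_q: "lo < ereal y \<Longrightarrow> (v \<longlongrightarrow> y) F \<Longrightarrow> ((\<lambda>t. q (v t)) \<longlongrightarrow> q y) F"
  using isCont_tendsto_compose[OF isCont_q] .

lemma tendsto_cross:
  assumes "lo < ereal a0" "lo < ereal y" "(a \<longlongrightarrow> a0) F" "(v \<longlongrightarrow> y) F"
  shows "((\<lambda>t. cross p q (a t) (v t)) \<longlongrightarrow> cross p q a0 y) F"
  unfolding cross_def by (intro tendsto_intros tendsto_p tendsto_q assms)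

lemma slope_limit:
  assumes y: "lo < ereal y" and f: "(f has_real_derivative f') (at y)" and F: "F \<le> at y"
    and uv: "\<And>t. u t = t \<and> v t = y \<or> u t = y \<and> v t = t"
  shows "((\<lambda>t. (f (v t) - f (u t)) / (v t - u t)) \<longlongrightarrow> f') F"
proof -
  have e: "(f (v t) - f (u t)) / (v t - u t) = (f t - f y) / (t - y)" for t
  proof -
    have "(f y - f t) / (y - t) = (f t - f y) / (t - y)"
      using nonzero_minus_divide_divide[of "t - y" "f t - f y"] by (cases "t = y") auto
    then show ?thesis using uv[of t] by auto
  qed
  show ?thesis unfolding e using f F unfolding has_field_derivative_iff by (rule tendsto_mono[rotated])
qed

lemma uv_limit:
  assumes F: "F \<le> at (y::real)" and uv: "\<And>t. u t = t \<and> v t = y \<or> u t = y \<and> v t = t"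
  shows "(u \<longlongrightarrow> y) F" "(v \<longlongrightarrow> y) F"
proof -
  have t: "((\<lambda>t. t) \<longlongrightarrow> y) F" using F tendsto_ident_at tendsto_mono by blast
  have "dist (u t) y \<le> dist t y" for t using uv[of t] by auto
  then show "(u \<longlongrightarrow> y) F" by (intro metric_tendsto_imp_tendsto[OF t] always_eventually allI)
  have "dist (v t) y \<le> dist t y" for t using uv[of t] by auto
  then show "(v \<longlongrightarrow> y) F" by (intro metric_tendsto_imp_tendsto[OF t] always_eventually allI)
qed

text \<open>
  The first order term of both bounds.  One of the points \<open>u\<close> and \<open>v\<close> is the fixed point \<open>y\<close> and the other one
  moves, so that left and right derivatives are treated at once.  The choice \<open>e = a\<close> gives \<open>hazard\<close>, the choice
  \<open>e = u\<close> gives \<open>drop_rate\<close>.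
\<close>

lemma cross_quotient_limit:
  assumes y: "L < y" and F: "F \<le> at y" and a: "(a \<longlongrightarrow> y - \<delta>) F" and e: "(e \<longlongrightarrow> e0) F" "lo < ereal e0"
    and uv: "\<And>t. u t = t \<and> v t = y \<or> u t = y \<and> v t = t"
  shows "((\<lambda>t. (cross p q (e t) (v t) - cross p q (e t) (u t)) / cross p q (a t) (v t) / (v t - u t)) \<longlongrightarrow>
    (q e0 * p' y - p e0 * q' y) / cross p q (y - \<delta>) y) F"
proof -
  have lo: "lo < ereal y" "lo < ereal (y - \<delta>)" using lo_less y by auto
  have c: "((\<lambda>t. cross p q (a t) (v t)) \<longlongrightarrow> cross p q (y - \<delta>) y) F"
    by (rule tendsto_cross[OF lo(2,1) a uv_limit(2)[OF F uv]])
  have pos: "0 < cross p q (y - \<delta>) y" using cross_pos lo \<delta> by simp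
  have "((\<lambda>t. (q (e t) * ((p (v t) - p (u t)) / (v t - u t)) - p (e t) * ((q (v t) - q (u t)) / (v t - u t)))
      / cross p q (a t) (v t)) \<longlongrightarrow> (q e0 * p' y - p e0 * q' y) / cross p q (y - \<delta>) y) F"
    using pos
    by (intro tendsto_intros tendsto_p tendsto_q e c slope_limit[OF lo(1) dp[OF lo(1)] F uv]
        slope_limit[OF lo(1) dq[OF lo(1)] F uv]) auto
  moreover have "(q (e t) * ((p (v t) - p (u t)) / (v t - u t)) - p (e t) * ((q (v t) - q (u t)) / (v t - u t)))
      / cross p q (a t) (v t) =
    (cross p q (e t) (v t) - cross p q (e t) (u t)) / cross p q (a t) (v t) / (v t - u t)" for t
  proof -
    have "cross p q (e t) (v t) - cross p q (e t) (u t) = q (e t) * (p (v t) - p (u t)) - p (e t) * (q (v t) - q (u t))"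
      by (simp add: cross_def algebra_simps)
    then show ?thesis
      by (simp only: times_divide_eq_right diff_divide_distrib[symmetric] divide_divide_eq_left mult.commute)
  qed
  ultimately show ?thesis by simp
qed

lemma hazard_limit:
  assumes y: "L < y" and F: "F \<le> at y" and a: "(a \<longlongrightarrow> y - \<delta>) F"
    and uv: "\<And>t. u t = t \<and> v t = y \<or> u t = y \<and> v t = t"
  shows "((\<lambda>t. (1 - cross p q (a t) (u t) / cross p q (a t) (v t)) / (v t - u t)) \<longlongrightarrow> hazard y) F"
proof (rule Lim_transform_eventually)
  have lo: "lo < ereal y" "lo < ereal (y - \<delta>)" using lo_less y by auto
  show "((\<lambda>t. (cross p q (a t) (v t) - cross p q (a t) (u t)) / cross p q (a t) (v t) / (v t - u t)) \<longlongrightarrow> hazard y) F"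
    unfolding hazard_def by (rule cross_quotient_limit[OF y F a a lo(2) uv])
  have "((\<lambda>t. cross p q (a t) (v t)) \<longlongrightarrow> cross p q (y - \<delta>) y) F"
    by (rule tendsto_cross[OF lo(2,1) a uv_limit(2)[OF F uv]])
  then have "eventually (\<lambda>t. 0 < cross p q (a t) (v t)) F"
    by (rule order_tendstoD(1)) (use cross_pos lo \<delta> in simp)
  then show "eventually (\<lambda>t. (cross p q (a t) (v t) - cross p q (a t) (u t)) / cross p q (a t) (v t) / (v t - u t) =
      (1 - cross p q (a t) (u t) / cross p q (a t) (v t)) / (v t - u t)) F"
    by eventually_elim (simp add: diff_divide_distrib)
qed

lemma drop_rate_limit:
  assumes y: "L < y" and F: "F \<le> at y" and a: "(a \<longlongrightarrow> y - \<delta>) F"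
    and uv: "\<And>t. u t = t \<and> v t = y \<or> u t = y \<and> v t = t"
  shows "((\<lambda>t. cross p q (u t) (v t) / cross p q (a t) (v t) / (v t - u t)) \<longlongrightarrow> drop_rate y) F"
proof -
  have "lo < ereal y" using lo_less y by auto
  moreover have "cross p q z z = 0" for z by (simp add: cross_def)
  ultimately show ?thesis
    using cross_quotient_limit[OF y F a uv_limit(1)[OF F uv] _ uv] unfolding drop_rate_def by simp
qed

text \<open>
  The path has to go strictly below \<open>u - \<delta>\<close> for a certain drawdown; by continuity in the lower barrier the
  bounds persist for the barrier \<open>u - \<delta>\<close> itself.
\<close>

lemma cross_ratio_left_limit:
  assumes lo: "lo < ereal a0" "lo < ereal v" and av: "a0 < v" and f: "(f \<longlongrightarrow> c) (at_left a0)"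
    and g: "\<And>a. lo < ereal a \<Longrightarrow> a < a0 \<Longrightarrow> d \<le> f a / cross p q a v"
  shows "d \<le> c / cross p q a0 v"
proof (rule tendsto_lowerbound)
  show "((\<lambda>a. f a / cross p q a v) \<longlongrightarrow> c / cross p q a0 v) (at_left a0)"
    using cross_pos[OF lo(1) av] by (intro tendsto_divide f tendsto_cross lo tendsto_ident_at tendsto_const) auto
  obtain r where r: "lo < ereal r" "r < a0" using ereal_dense2[OF lo(1)] by auto
  have "eventually (\<lambda>a. a \<in> {r<..<a0}) (at_left a0)" by (rule eventually_at_left_real[OF r(2)])
  then show "eventually (\<lambda>a. d \<le> f a / cross p q a v) (at_left a0)"
  proof eventually_elim
    case (elim a)
    then have "lo < ereal a" using r by (auto intro: less_trans)
    then show ?case using g elim by auto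
  qed
qed simp

text \<open>
  At the lower limit \<open>L\<close> the barrier \<open>v - \<delta>\<close> may tend to the left endpoint, where \<open>p\<close> and \<open>q\<close> need not be continuous.
  Division by \<open>q (v - \<delta>)\<close> leaves only \<open>r = p / q\<close> at the barrier, and \<open>r\<close> is increasing: its value at a fixed
  point \<open>a1\<close> bounds it from above, which is the only direction required.
\<close>

lemma start_limit:
  "\<exists>W. (W \<longlongrightarrow> 0) (at_right L) \<and>
     eventually (\<lambda>v. 1 - cross p q (v - \<delta>) L / cross p q (v - \<delta>) v \<le> W v) (at_right L)"
proof -
  have loL: "lo < ereal L" using lo_less(2) by simp
  define r where "r a = p a / q a" for a
  define a1 where "a1 = L - \<delta> / 2"
  have a1: "lo < ereal a1" "a1 < L" using lo_less(3)[of a1] \<delta> by (auto simp: a1_def)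
  define B where "B v = p v - q v * r a1" for v
  define N where "N v = \<bar>p v - p L\<bar> + \<bar>r a1\<bar> * (q L - q v)" for v
  have cr: "cross p q a v = q a * (p v - q v * r a)" if "lo < ereal a" for a v
    using q_pos[OF that] by (simp add: cross_def r_def field_simps)
  have r_mono: "r a \<le> r a1" if "lo < ereal a" "a \<le> a1" for a
    using cross_pos[OF that(1), of a1] q_pos[OF that(1)] q_pos[OF a1(1)] that
    by (cases "a = a1") (auto simp: cross_def r_def field_simps)
  have BL: "0 < B L"
    using cross_pos[OF a1] q_pos[OF a1(1)] cr[OF a1(1), of L] by (simp add: B_def zero_less_mult_iff)
  have idt: "((\<lambda>v. v) \<longlongrightarrow> L) (at_right L)" by (rule tendsto_ident_at)
  have Blim: "(B \<longlongrightarrow> B L) (at_right L)"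
    unfolding B_def by (intro tendsto_intros tendsto_p tendsto_q loL idt)
  have "(N \<longlongrightarrow> \<bar>p L - p L\<bar> + \<bar>r a1\<bar> * (q L - q L)) (at_right L)"
    unfolding N_def by (intro tendsto_intros tendsto_p tendsto_q loL idt)
  then have lim: "((\<lambda>v. N v / B v) \<longlongrightarrow> 0) (at_right L)"
    using tendsto_divide[OF _ Blim, of N 0] BL by simp
  have ev: "eventually (\<lambda>v. v \<in> {L<..<L + \<delta> / 2}) (at_right L)"
    using \<delta> by (intro eventually_at_right_real) simp
  have Bpos: "eventually (\<lambda>v. 0 < B v) (at_right L)" using Blim BL by (rule order_tendstoD(1))
  show ?thesis
  proof (intro exI conjI)
    show "((\<lambda>v. N v / B v) \<longlongrightarrow> 0) (at_right L)" by (rule lim)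
    show "eventually (\<lambda>v. 1 - cross p q (v - \<delta>) L / cross p q (v - \<delta>) v \<le> N v / B v) (at_right L)"
      using ev Bpos
    proof eventually_elim
      case (elim v)
      then have l: "L < v" "v - \<delta> \<le> a1" and lo: "lo < ereal (v - \<delta>)" "lo < ereal v"
        using \<delta> lo_less(1)[of v] lo_less(2)[of v] by (auto simp: a1_def)
      define a where "a = v - \<delta>"
      have lo': "lo < ereal a" using lo by (simp add: a_def)
      have qa: "0 < q a" by (rule q_pos[OF lo'])
      have ra: "r a \<le> r a1" using r_mono[OF lo'] l by (simp add: a_def)
      have d: "B v \<le> p v - q v * r a"
        unfolding B_def using ra q_pos[OF lo(2)] by simp
      have n: "(p v - q v * r a) - (p L - q L * r a) \<le> N v"
      proof -
        have "r a * (q L - q v) \<le> \<bar>r a1\<bar> * (q L - q v)"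
          using ra q_anti[OF loL, of v] l by (intro mult_right_mono) auto
        then show ?thesis unfolding N_def by (simp add: algebra_simps)
      qed
      have "1 - cross p q a L / cross p q a v = ((p v - q v * r a) - (p L - q L * r a)) / (p v - q v * r a)"
        unfolding cr[OF lo'] using qa d elim by (simp add: field_simps)
      also have "\<dots> \<le> N v / B v"
      proof (rule frac_le)
        show "0 \<le> N v" unfolding N_def using q_anti[OF loL, of v] l by auto
      qed (use n d elim in auto)
      finally show ?case by (simp add: a_def)
    qed
  qed
qed

lemma isCont_hazard: "L < y \<Longrightarrow> isCont hazard y"
  and isCont_drop_rate: "L < y \<Longrightarrow> isCont drop_rate y"
proof -
  assume y: "L < y"
  note lo = lo_less(1)[OF y] lo_less(2)[OF less_imp_le[OF y]]
  have sh: "((\<lambda>t. t - \<delta>) \<longlongrightarrow> y - \<delta>) (at y)" by (intro tendsto_intros)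
  have c: "((\<lambda>t. cross p q (t - \<delta>) t) \<longlongrightarrow> cross p q (y - \<delta>) y) (at y)"
    by (intro tendsto_cross lo sh tendsto_ident_at)
  have pos: "cross p q (y - \<delta>) y \<noteq> 0" using cross_pos[OF lo(1), of y] \<delta> by simp
  have p': "(p' \<longlongrightarrow> p' y) (at y)" "(q' \<longlongrightarrow> q' y) (at y)" using cp'[OF lo(2)] cq'[OF lo(2)] by (auto simp: isCont_def)
  show "isCont hazard y"
    unfolding isCont_def hazard_def[abs_def]
    by (intro tendsto_intros tendsto_p[OF lo(1)] tendsto_q[OF lo(1)] sh p' c pos)
  show "isCont drop_rate y"
    unfolding isCont_def drop_rate_def[abs_def]
    by (intro tendsto_intros tendsto_p[OF lo(2)] tendsto_q[OF lo(2)] tendsto_ident_at p' c pos)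
qed

end

text \<open>
  The function \<open>G\<close> stands for \<open>g(x,\<cdot>)\<close> with a fixed starting point \<open>x \<le> L\<close>, and \<open>\<gamma>\<close> for \<open>g\<close> itself.
\<close>

locale drawdown_survival = drawdown_analysis +
  fixes G :: "real \<Rightarrow> real" and \<gamma> :: "real \<Rightarrow> real \<Rightarrow> real"
  assumes G_mult: "\<And>u v. L \<le> u \<Longrightarrow> u < v \<Longrightarrow> G v = G u * \<gamma> u v"
    and G_start: "0 < G L"
    and \<gamma>_le_1: "\<And>u v. L \<le> u \<Longrightarrow> u < v \<Longrightarrow> \<gamma> u v \<le> 1"
    and \<gamma>_lower: "\<And>u v. L \<le> u \<Longrightarrow> u < v \<Longrightarrow> v < u + \<delta> \<Longrightarrow>
       cross p q (v - \<delta>) u / cross p q (v - \<delta>) v \<le> \<gamma> u v"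
    and \<gamma>_upper: "\<And>a u v. L \<le> u \<Longrightarrow> u < v \<Longrightarrow> lo < ereal a \<Longrightarrow> a < u - \<delta> \<Longrightarrow>
       \<gamma> u v \<le> cross p q a u / cross p q a v"
begin

lemma \<gamma>_upper':
  assumes "L < u" "u < v"
  shows "\<gamma> u v \<le> cross p q (u - \<delta>) u / cross p q (u - \<delta>) v"
proof (rule cross_ratio_left_limit)
  show lo: "lo < ereal (u - \<delta>)" "lo < ereal v"
    using lo_less(1)[of u] lo_less(2)[of v] assms by auto
  show "((\<lambda>a. cross p q a u) \<longlongrightarrow> cross p q (u - \<delta>) u) (at_left (u - \<delta>))"
    using lo_less(2)[of u] assms lo by (intro tendsto_cross tendsto_ident_at tendsto_const) auto
qed (use assms \<delta> in \<open>auto intro: \<gamma>_upper\<close>)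

lemma \<gamma>_pos: "L \<le> u \<Longrightarrow> u < v \<Longrightarrow> v < u + \<delta> \<Longrightarrow> 0 < \<gamma> u v"
proof -
  assume uv: "L \<le> u" "u < v" "v < u + \<delta>"
  have "lo < ereal (v - \<delta>)" using lo_less(1)[of v] uv by simp
  then have "0 < cross p q (v - \<delta>) u" "0 < cross p q (v - \<delta>) v" using cross_pos uv \<delta> by auto
  then have "0 < cross p q (v - \<delta>) u / cross p q (v - \<delta>) v" by simp
  then show ?thesis using \<gamma>_lower[OF uv] by linarith
qed

text \<open>
  Over stretches shorter than \<open>\<delta>\<close> the lower bound for \<open>\<gamma>\<close> is positive, and finitely many of them reach any
  level.
\<close>

lemma G_pos: "L \<le> v \<Longrightarrow> 0 < G v"
proof -
  assume v: "L \<le> v"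
  have *: "0 < G (L + real n * (\<delta> / 2))" for n
  proof (induction n)
    case (Suc n)
    let ?u = "L + real n * (\<delta> / 2)" and ?v = "L + real (Suc n) * (\<delta> / 2)"
    have v: "?v = ?u + \<delta> / 2" by (simp add: algebra_simps)
    have "0 \<le> real n * (\<delta> / 2)" using \<delta> by simp
    then have uv: "L \<le> ?u" "?u < ?v" "?v < ?u + \<delta>" using \<delta> unfolding v by linarith+
    show ?case using G_mult[OF uv(1,2)] \<gamma>_pos[OF uv] Suc by simp
  qed (use G_start in simp)
  define n where "n = nat \<lfloor>(v - L) / (\<delta> / 2)\<rfloor>"
  have "0 \<le> (v - L) / (\<delta> / 2)" using v \<delta> by simp
  then have n: "real n \<le> (v - L) / (\<delta> / 2)" "(v - L) / (\<delta> / 2) < real n + 1" unfolding n_def by linarith+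
  let ?u = "L + real n * (\<delta> / 2)"
  have u: "?u \<le> v" "v < ?u + \<delta>" "L \<le> ?u"
    using n \<delta> by (simp_all add: pos_le_divide_eq pos_divide_less_eq distrib_right)
  show "0 < G v"
  proof (cases "?u = v")
    case True then show ?thesis using *[of n] by simp
  next
    case False
    then show ?thesis using G_mult[of ?u v] \<gamma>_pos[of ?u v] u *[of n] by simp
  qed
qed

lemma eventually_near:
  assumes "L < y"
  shows "eventually (\<lambda>t. L < min t y \<and> min t y < max t y \<and> max t y < min t y + \<delta>) (at y)"
proof -
  have "eventually (\<lambda>t. t \<in> {max L (y - \<delta>)<..<y + \<delta>}) (at y)"
    using assms \<delta> by (intro eventually_at_in_open') auto
  moreover have "eventually (\<lambda>t. t \<noteq> y) (at y)" by (simp add: eventually_at_filter)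
  ultimately show ?thesis
  proof eventually_elim
    case (elim t)
    then have "L < t" "y - \<delta> < t" "t < y + \<delta>" "t \<noteq> y" by auto
    then show ?case using assms \<delta> by (cases "t \<le> y") auto
  qed
qed

lemma min_max_at: "min t y = t \<and> max t y = y \<or> min t y = y \<and> max t y = (t::real)"
  by (auto simp: min_def max_def)

lemmas min_max_limit = uv_limit[OF order_refl min_max_at]

text \<open>
  With \<open>u = min t y\<close> and \<open>v = max t y\<close> one squeeze serves both sides of \<open>y\<close>.
\<close>

lemma \<gamma>_quotient:
  assumes y: "L < y"
  shows "((\<lambda>t. (1 - \<gamma> (min t y) (max t y)) / (max t y - min t y)) \<longlongrightarrow> hazard y) (at y)"
proof (rule tendsto_sandwich)
  note ev = eventually_near[OF y]
  let ?Q = "\<lambda>a t. (1 - cross p q a (min t y) / cross p q a (max t y)) / (max t y - min t y)"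
  show "((\<lambda>t. ?Q (min t y - \<delta>) t) \<longlongrightarrow> hazard y) (at y)" "((\<lambda>t. ?Q (max t y - \<delta>) t) \<longlongrightarrow> hazard y) (at y)"
    by (intro hazard_limit[OF y order_refl _ min_max_at] tendsto_diff min_max_limit tendsto_const)+
  show "eventually (\<lambda>t. ?Q (min t y - \<delta>) t \<le> (1 - \<gamma> (min t y) (max t y)) / (max t y - min t y)) (at y)"
    using ev by eventually_elim (intro divide_right_mono diff_left_mono \<gamma>_upper'; simp)
  show "eventually (\<lambda>t. (1 - \<gamma> (min t y) (max t y)) / (max t y - min t y) \<le> ?Q (max t y - \<delta>) t) (at y)"
    using ev by eventually_elim (intro divide_right_mono diff_left_mono \<gamma>_lower; simp)
qed

lemma hazard_nonneg: "L < y \<Longrightarrow> 0 \<le> hazard y"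
proof (rule tendsto_lowerbound[OF \<gamma>_quotient])
  assume y: "L < y"
  show "eventually (\<lambda>t. 0 \<le> (1 - \<gamma> (min t y) (max t y)) / (max t y - min t y)) (at y)"
    using eventually_near[OF y]
    by eventually_elim (auto intro!: divide_nonneg_nonneg \<gamma>_le_1 simp: less_imp_le)
qed auto

text \<open>
  Left continuity of \<open>G\<close> is needed before its derivative exists.  It comes from multiplicativity: \<open>G y\<close> is
  \<open>G u\<close> times \<open>\<gamma>(u,y)\<close>, and the second factor tends to \<open>1\<close>.
\<close>

lemma G_min_limit:
  assumes y: "L < y"
  shows "((\<lambda>t. G (min t y)) \<longlongrightarrow> G y) (at y)"
proof (rule tendsto_sandwich[where f = "\<lambda>_. G y"])
  have "((\<lambda>t. 1 - (1 - \<gamma> (min t y) (max t y)) / (max t y - min t y) * (max t y - min t y)) \<longlongrightarrow>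
      1 - hazard y * (y - y)) (at y)"
    by (intro tendsto_intros \<gamma>_quotient y min_max_limit)
  moreover have "eventually (\<lambda>t. 1 - (1 - \<gamma> (min t y) (max t y)) / (max t y - min t y) * (max t y - min t y) =
      \<gamma> (min t y) (max t y)) (at y)"
    using eventually_near[OF y] by eventually_elim simp
  ultimately have "((\<lambda>t. \<gamma> (min t y) (max t y)) \<longlongrightarrow> 1) (at y)"
    by (auto intro: Lim_transform_eventually)
  then have "((\<lambda>t. G y / \<gamma> (min t y) (max t y)) \<longlongrightarrow> G y / 1) (at y)"
    by (intro tendsto_divide tendsto_const) auto
  then show "((\<lambda>t. G y / \<gamma> (min t y) (max t y)) \<longlongrightarrow> G y) (at y)" by simp
  have "eventually (\<lambda>t. G y \<le> G (min t y) \<and> G (min t y) \<le> G y / \<gamma> (min t y) (max t y)) (at y)"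
    using eventually_near[OF y]
  proof eventually_elim
    case (elim t)
    define u v where "u = min t y" and "v = max t y"
    have uv: "L \<le> u" "u < v" "v < u + \<delta>" "y = u \<or> y = v" using elim by (auto simp: u_def v_def)
    have g: "0 < \<gamma> u v" "\<gamma> u v \<le> 1" using \<gamma>_pos \<gamma>_le_1 uv by auto
    have Gu: "0 < G u" using G_pos uv by simp
    have "G v \<le> G u" using G_mult[OF uv(1,2)] g Gu by (simp add: mult_left_le)
    moreover have "G u \<le> G u / \<gamma> u v" using g Gu by (simp add: pos_le_divide_eq mult_left_le)
    moreover have "G v / \<gamma> u v = G u" using G_mult[OF uv(1,2)] g by simp
    ultimately have "G y \<le> G u" "G u \<le> G y / \<gamma> u v" using uv(4) by auto
    then show ?case by (simp add: u_def v_def)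
  qed
  then show "eventually (\<lambda>t. G y \<le> G (min t y)) (at y)"
    "eventually (\<lambda>t. G (min t y) \<le> G y / \<gamma> (min t y) (max t y)) (at y)"
    by (auto elim: eventually_mono)
qed simp

lemma slope_min_max: "(f t - f y) / (t - y) = (f (max t y) - f (min t y)) / (max t y - min t (y::real) :: real)"
  using nonzero_minus_divide_divide[of "t - y" "f t - f y"] by (cases "t = y") (auto simp: min_def max_def)

lemma DERIV_G:
  assumes y: "L < y"
  shows "(G has_real_derivative - G y * hazard y) (at y)"
  unfolding has_field_derivative_iff
proof (rule Lim_transform_eventually)
  show "((\<lambda>t. - G (min t y) * ((1 - \<gamma> (min t y) (max t y)) / (max t y - min t y))) \<longlongrightarrow> - G y * hazard y) (at y)"
    by (intro tendsto_intros \<gamma>_quotient G_min_limit y)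
  show "eventually (\<lambda>t. - G (min t y) * ((1 - \<gamma> (min t y) (max t y)) / (max t y - min t y)) = (G t - G y) / (t - y)) (at y)"
    using eventually_near[OF y]
  proof eventually_elim
    case (elim t)
    then have "G (max t y) - G (min t y) = - (G (min t y) * (1 - \<gamma> (min t y) (max t y)))"
      using G_mult[of "min t y" "max t y"] by (simp add: right_diff_distrib)
    then show ?case by (subst slope_min_max) simp
  qed
qed

lemma \<gamma>_start: "((\<lambda>v. \<gamma> L v) \<longlongrightarrow> 1) (at_right L)"
proof -
  obtain W where W: "(W \<longlongrightarrow> 0) (at_right L)"
    "eventually (\<lambda>v. 1 - cross p q (v - \<delta>) L / cross p q (v - \<delta>) v \<le> W v) (at_right L)"
    using start_limit by blast
  have ev: "eventually (\<lambda>v. v \<in> {L<..<L + \<delta>}) (at_right L)"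
    using \<delta> by (intro eventually_at_right_real) simp
  have "((\<lambda>v. 1 - W v) \<longlongrightarrow> 1 - 0) (at_right L)" by (intro tendsto_intros W)
  then have W': "((\<lambda>v. 1 - W v) \<longlongrightarrow> 1) (at_right L)" by simp
  show ?thesis
  proof (rule tendsto_sandwich[OF _ _ W' tendsto_const])
    show "eventually (\<lambda>v. 1 - W v \<le> \<gamma> L v) (at_right L)"
      using ev W(2)
    proof eventually_elim
      case (elim v)
      then show ?case using \<gamma>_lower[of L v] by simp
    qed
    show "eventually (\<lambda>v. \<gamma> L v \<le> 1) (at_right L)"
      using ev by eventually_elim (auto intro: \<gamma>_le_1)
  qed
qed

lemma G_right_start: "(G \<longlongrightarrow> G L) (at_right L)"
proof -
  have "((\<lambda>v. G L * \<gamma> L v) \<longlongrightarrow> G L * 1) (at_right L)" by (intro tendsto_intros \<gamma>_start)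
  moreover have "eventually (\<lambda>v. G L * \<gamma> L v = G v) (at_right L)"
    using eventually_at_right_real[of L "L + 1"] by (auto elim!: eventually_mono simp: G_mult[of L])
  ultimately show ?thesis by (auto intro: Lim_transform_eventually)
qed

text \<open>
  The hazard is nonnegative, so that it is integrable up to the boundary point \<open>L\<close>, where it may be
  unbounded, as soon as \<open>ln G\<close> has a finite limit there.
\<close>

theorem survival_integral:
  assumes y: "L < y"
  shows "set_integrable lborel {L<..y} hazard" "(LINT z:{L<..y}|lborel. hazard z) = ln (G L / G y)"
proof -
  let ?F = "\<lambda>z. - ln (G z)"
  have int: "set_integrable lborel (einterval L v) hazard" "(LBINT z=L..v. hazard z) = - ln (G v) - (- ln (G L))" if v: "L < v" for v
  proof -
    have lim1: "((?F \<circ> real_of_ereal) \<longlongrightarrow> - ln (G L)) (at_right (ereal L))"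
      unfolding ereal_tendsto_simps using G_right_start G_pos[of L]
      by (intro tendsto_minus tendsto_ln) auto
    have lim2: "((?F \<circ> real_of_ereal) \<longlongrightarrow> - ln (G v)) (at_left (ereal v))"
      unfolding ereal_tendsto_simps using G_pos[of v] v
      by (intro tendsto_minus tendsto_ln tendsto_mono[OF at_le DERIV_isCont[OF DERIV_G, unfolded isCont_def]]) auto
    have d: "(?F has_real_derivative hazard z) (at z)" if "ereal L < ereal z" "ereal z < ereal v" for z
      using that G_pos[of z] by (auto intro!: derivative_eq_intros DERIV_G)
    have c: "isCont hazard z" if "ereal L < ereal z" "ereal z < ereal v" for z using that isCont_hazard by simp
    have n: "AE z in lborel. ereal L < ereal z \<longrightarrow> ereal z < ereal v \<longrightarrow> 0 \<le> hazard z"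
      using hazard_nonneg by (intro always_eventually) auto
    have Lv: "ereal L < ereal v" using v by simp
    show "set_integrable lborel (einterval L v) hazard" "(LBINT z=L..v. hazard z) = - ln (G v) - (- ln (G L))"
      using interval_integral_FTC_nonneg[OF Lv d c n lim1 lim2] by auto
  qed
  show "set_integrable lborel {L<..y} hazard"
    using int(1)[of "y + 1"] y by (rule_tac set_integrable_subset) auto
  have "(LINT z:{L<..y}|lborel. hazard z) = (LBINT z=L..y. hazard z)"
    using y by (simp add: interval_integral_Ioc)
  also have "\<dots> = ln (G L / G y)"
    using int(2)[OF y] G_pos[of y] G_pos[of L] y by (simp add: ln_div)
  finally show "(LINT z:{L<..y}|lborel. hazard z) = ln (G L / G y)" .
qed

lemma survival_formula: "L < y \<Longrightarrow> G y = G L * exp (- (LINT z:{L<..y}|lborel. hazard z))"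
  using survival_integral(2)[of y] G_pos[of y] G_pos[of L] by (simp add: ln_div exp_diff)

end

text \<open>
  The functions \<open>K\<close> and \<open>\<kappa>\<close> stand for \<open>K\<close> and \<open>k\<close> of the introduction.  That \<open>\<kappa>\<close> is at most \<open>1 - \<gamma>\<close> expresses that
  drawdown and passage are disjoint events; it replaces an estimate of \<open>\<kappa>\<close> near \<open>L\<close>.
\<close>

locale drawdown_law = drawdown_survival +
  fixes K :: "real \<Rightarrow> real" and \<kappa> :: "real \<Rightarrow> real \<Rightarrow> real" and \<beta> Kinf :: real
  assumes \<beta>: "0 \<le> \<beta>"
    and K_start: "K L = 0"
    and K_lower: "\<And>u v. L \<le> u \<Longrightarrow> u < v \<Longrightarrow> exp (- \<beta> * v) * (G u * \<kappa> u v) \<le> K v - K u"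
    and K_upper: "\<And>u v. L \<le> u \<Longrightarrow> u < v \<Longrightarrow> K v - K u \<le> exp (- \<beta> * u) * (G u * \<kappa> u v)"
    and \<kappa>_nonneg: "\<And>u v. L \<le> u \<Longrightarrow> u < v \<Longrightarrow> 0 \<le> \<kappa> u v"
    and \<kappa>_le: "\<And>u v. L \<le> u \<Longrightarrow> u < v \<Longrightarrow> \<kappa> u v \<le> 1 - \<gamma> u v"
    and \<kappa>_upper: "\<And>u v. L \<le> u \<Longrightarrow> u < v \<Longrightarrow> v < u + \<delta> \<Longrightarrow> \<kappa> u v \<le> cross p q u v / cross p q (v - \<delta>) v"
    and \<kappa>_lower: "\<And>a u v. L \<le> u \<Longrightarrow> u < v \<Longrightarrow> lo < ereal a \<Longrightarrow> a < u - \<delta> \<Longrightarrow>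
       cross p q u v / cross p q a v \<le> \<kappa> u v"
    and K_limit: "(K \<longlongrightarrow> Kinf) at_top"
begin

lemma \<kappa>_lower':
  assumes "L < u" "u < v"
  shows "cross p q u v / cross p q (u - \<delta>) v \<le> \<kappa> u v"
proof -
  have "- \<kappa> u v \<le> - cross p q u v / cross p q (u - \<delta>) v"
  proof (rule cross_ratio_left_limit)
    show "lo < ereal (u - \<delta>)" "lo < ereal v"
      using lo_less(1)[of u] lo_less(2)[of v] assms by auto
    show "- \<kappa> u v \<le> - cross p q u v / cross p q a v" if "lo < ereal a" "a < u - \<delta>" for a
      using \<kappa>_lower[of u v a] assms that by simp
  qed (use assms \<delta> in auto)
  then show ?thesis by simp
qed

lemma \<kappa>_quotient:
  assumes y: "L < y"
  shows "((\<lambda>t. \<kappa> (min t y) (max t y) / (max t y - min t y)) \<longlongrightarrow> drop_rate y) (at y)"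
proof (rule tendsto_sandwich)
  note ev = eventually_near[OF y]
  let ?Q = "\<lambda>a t. cross p q (min t y) (max t y) / cross p q a (max t y) / (max t y - min t y)"
  show "((\<lambda>t. ?Q (min t y - \<delta>) t) \<longlongrightarrow> drop_rate y) (at y)" "((\<lambda>t. ?Q (max t y - \<delta>) t) \<longlongrightarrow> drop_rate y) (at y)"
    by (intro drop_rate_limit[OF y order_refl _ min_max_at] tendsto_diff min_max_limit tendsto_const)+
  show "eventually (\<lambda>t. ?Q (min t y - \<delta>) t \<le> \<kappa> (min t y) (max t y) / (max t y - min t y)) (at y)"
    using ev by eventually_elim (intro divide_right_mono \<kappa>_lower'; simp)
  show "eventually (\<lambda>t. \<kappa> (min t y) (max t y) / (max t y - min t y) \<le> ?Q (max t y - \<delta>) t) (at y)"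
    using ev by eventually_elim (intro divide_right_mono \<kappa>_upper; simp)
qed

lemma drop_rate_nonneg: "L < y \<Longrightarrow> 0 \<le> drop_rate y"
proof (rule tendsto_lowerbound[OF \<kappa>_quotient])
  assume y: "L < y"
  show "eventually (\<lambda>t. 0 \<le> \<kappa> (min t y) (max t y) / (max t y - min t y)) (at y)"
    using eventually_near[OF y] by eventually_elim (auto intro!: divide_nonneg_nonneg \<kappa>_nonneg simp: less_imp_le)
qed auto

lemma DERIV_K:
  assumes y: "L < y"
  shows "(K has_real_derivative exp (- \<beta> * y) * (G y * drop_rate y)) (at y)"
  unfolding has_field_derivative_iff
proof (subst slope_min_max, rule tendsto_sandwich)
  note ev = eventually_near[OF y]
  let ?B = "\<lambda>z t. exp (- \<beta> * z) * (G (min t y) * (\<kappa> (min t y) (max t y) / (max t y - min t y)))"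
  show "((\<lambda>t. ?B (max t y) t) \<longlongrightarrow> exp (- \<beta> * y) * (G y * drop_rate y)) (at y)"
    "((\<lambda>t. ?B (min t y) t) \<longlongrightarrow> exp (- \<beta> * y) * (G y * drop_rate y)) (at y)"
    by (intro tendsto_intros \<kappa>_quotient G_min_limit y min_max_limit)+
  show "eventually (\<lambda>t. ?B (max t y) t \<le> (K (max t y) - K (min t y)) / (max t y - min t y)) (at y)"
    using ev
  proof eventually_elim
    case (elim t)
    then show ?case using divide_right_mono[OF K_lower[of "min t y" "max t y"], of "max t y - min t y"] by simp
  qed
  show "eventually (\<lambda>t. (K (max t y) - K (min t y)) / (max t y - min t y) \<le> ?B (min t y) t) (at y)"
    using ev
  proof eventually_elim
    case (elim t)
    then show ?case using divide_right_mono[OF K_upper[of "min t y" "max t y"], of "max t y - min t y"] by simp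
  qed
qed

lemma K_right_start: "(K \<longlongrightarrow> 0) (at_right L)"
proof (rule tendsto_sandwich)
  have ev: "eventually (\<lambda>t. t \<in> {L<..<L+1}) (at_right L)" by (rule eventually_at_right_real) simp
  show "((\<lambda>v. 0) \<longlongrightarrow> 0) (at_right L)" by simp
  have "((\<lambda>v. exp (- \<beta> * L) * (G L * (1 - \<gamma> L v))) \<longlongrightarrow> exp (- \<beta> * L) * (G L * (1 - 1))) (at_right L)"
    by (intro tendsto_intros \<gamma>_start)
  then show "((\<lambda>v. exp (- \<beta> * L) * (G L * (1 - \<gamma> L v))) \<longlongrightarrow> 0) (at_right L)" by simp
  show "eventually (\<lambda>v. 0 \<le> K v) (at_right L)"
    using ev
  proof eventually_elim
    case (elim v)
    then have "0 \<le> exp (- \<beta> * v) * (G L * \<kappa> L v)" using \<kappa>_nonneg[of L v] G_pos[of L] by simp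
    then show ?case using K_lower[of L v] K_start elim by simp
  qed
  show "eventually (\<lambda>v. K v \<le> exp (- \<beta> * L) * (G L * (1 - \<gamma> L v))) (at_right L)"
    using ev
  proof eventually_elim
    case (elim v)
    then have "exp (- \<beta> * L) * (G L * \<kappa> L v) \<le> exp (- \<beta> * L) * (G L * (1 - \<gamma> L v))"
      using \<kappa>_le[of L v] G_pos[of L] by (intro mult_left_mono) auto
    moreover have "K v \<le> exp (- \<beta> * L) * (G L * \<kappa> L v)" using K_upper[of L v] K_start elim by simp
    ultimately show ?case by (rule order_trans[rotated])
  qed
qed

theorem law_integral:
  shows "set_integrable lborel {L<..} (\<lambda>y. exp (- \<beta> * y) * (G y * drop_rate y))"
    and "(LINT y:{L<..}|lborel. exp (- \<beta> * y) * (G y * drop_rate y)) = Kinf"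
proof -
  let ?f = "\<lambda>y. exp (- \<beta> * y) * (G y * drop_rate y)"
  have lim1: "((K \<circ> real_of_ereal) \<longlongrightarrow> 0) (at_right (ereal L))"
    unfolding ereal_tendsto_simps by (rule K_right_start)
  have lim2: "((K \<circ> real_of_ereal) \<longlongrightarrow> Kinf) (at_left \<infinity>)"
    unfolding ereal_tendsto_simps by (rule K_limit)
  have d: "(K has_real_derivative ?f z) (at z)" if "ereal L < ereal z" "ereal z < \<infinity>" for z
    using that by (intro DERIV_K) simp
  have c: "isCont ?f z" if "ereal L < ereal z" "ereal z < \<infinity>" for z
    using that DERIV_isCont[OF DERIV_G] isCont_drop_rate by (intro continuous_intros) auto
  have n: "AE z in lborel. ereal L < ereal z \<longrightarrow> ereal z < \<infinity> \<longrightarrow> 0 \<le> ?f z"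
  proof (intro always_eventually allI impI)
    fix z assume "ereal L < ereal z"
    then show "0 \<le> ?f z" by (intro mult_nonneg_nonneg drop_rate_nonneg less_imp_le[OF G_pos]) auto
  qed
  have L: "ereal L < \<infinity>" by simp
  have e: "einterval L \<infinity> = {L<..}" by (auto simp: einterval_def)
  show "set_integrable lborel {L<..} ?f" "(LINT y:{L<..}|lborel. ?f y) = Kinf"
    using interval_integral_FTC_nonneg[OF L d c n lim1 lim2]
    by (auto simp: e interval_lebesgue_integral_def)
qed

end

section \<open>Renewal at first passage times\<close>

text \<open>
  Unlike \<^const>\<open>exp_neg\<close> applied to a multiple, this discount factor vanishes at \<open>\<infinity>\<close> also for \<open>\<alpha> = 0\<close>,
  where it is the indicator of finiteness.
\<close>

definition disc :: "real \<Rightarrow> ereal \<Rightarrow> real" where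
  "disc \<alpha> a = (if a = \<infinity> then 0 else exp (- \<alpha> * real_of_ereal a))"

lemma disc_nonneg[simp]: "0 \<le> disc \<alpha> a"
  by (simp add: disc_def)

lemma disc_infinity[simp]: "disc \<alpha> \<infinity> = 0"
  by (simp add: disc_def)

lemma disc_le_1: "0 \<le> \<alpha> \<Longrightarrow> 0 \<le> a \<Longrightarrow> disc \<alpha> a \<le> 1"
  by (simp add: disc_def real_of_ereal_pos)

lemma disc_0: "disc 0 a = (if a = \<infinity> then 0 else 1)"
  by (simp add: disc_def)

lemma disc_antimono: "0 \<le> \<alpha> \<Longrightarrow> 0 \<le> a \<Longrightarrow> a \<le> b \<Longrightarrow> disc \<alpha> b \<le> disc \<alpha> a"
  by (cases a; cases b) (auto simp: disc_def mult_left_mono)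

lemma disc_add: "0 \<le> b \<Longrightarrow> disc \<alpha> (ereal a + b) = disc \<alpha> (ereal a) * disc \<alpha> b"
  by (cases b) (auto simp: disc_def exp_add[symmetric] algebra_simps)

lemma measurable_disc[measurable]: "disc \<alpha> \<in> borel_measurable borel"
  unfolding disc_def[abs_def] by measurable

lemma exp_neg_eq_disc: "0 < \<alpha> \<Longrightarrow> 0 \<le> a \<Longrightarrow> exp_neg (ereal \<alpha> * a) = disc \<alpha> a"
  by (cases a) (auto simp: exp_neg_def disc_def)

context regular_diffusion
begin

text \<open>
  These are \<open>g\<close> and \<open>k\<close> of the introduction, the Laplace transform of a hitting time, and that of a hitting time
  of \<open>v\<close> on the event that \<open>v\<close> is reached before \<open>a\<close>.
\<close>

definition surv :: "real \<Rightarrow> real \<Rightarrow> real \<Rightarrow> real \<Rightarrow> real" where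
  "surv \<alpha> \<delta> x v = (LINT \<omega>|P x. disc \<alpha> (H v \<omega>) *
     before (H v) (\<theta> \<delta>) \<omega>)"

definition drop :: "real \<Rightarrow> real \<Rightarrow> real \<Rightarrow> real \<Rightarrow> real" where
  "drop \<alpha> \<delta> x v = (LINT \<omega>|P x. disc \<alpha> (\<theta> \<delta> \<omega>) *
     before (\<theta> \<delta>) (H v) \<omega>)"

definition hit_lap :: "real \<Rightarrow> real \<Rightarrow> real \<Rightarrow> real" where
  "hit_lap \<alpha> x v = (LINT \<omega>|P x. disc \<alpha> (H v \<omega>))"

definition hit_before :: "real \<Rightarrow> real \<Rightarrow> real \<Rightarrow> real \<Rightarrow> real" where
  "hit_before \<alpha> x v a = (LINT \<omega>|P x. disc \<alpha> (H v \<omega>) *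
     before (H v) (H a) \<omega>)"

lemma in_I: "l < ereal a \<Longrightarrow> a \<in> I"
  using state_interval by auto

lemma I_ge: "a \<in> I \<Longrightarrow> l \<le> ereal a"
  using state_interval by auto

lemma hit_0: "0 \<le> H y \<omega>"
  unfolding hitting_time_eq_hit by (rule hit_nonneg)

lemma drawdown_0: "0 < \<delta> \<Longrightarrow> \<omega> \<in> space Om \<Longrightarrow> 0 \<le> \<theta> \<delta> \<omega>"
  unfolding drawdown_time_eq_ddtime by (rule ddtime_nonneg[OF path])

lemma AE_start: "x \<in> I \<Longrightarrow> AE \<omega> in P x. \<omega> \<in> space Om \<and> X 0 \<omega> = ereal x"
  using start[of x] AE_space[of "P x"] by (auto simp: space_P)

lemma integrable_bounded:
  assumes x: "x \<in> I" and f: "f \<in> borel_measurable (P x)"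
    and b: "\<And>\<omega>. \<omega> \<in> space Om \<Longrightarrow> 0 \<le> f \<omega> \<and> f \<omega> \<le> (1::real)"
  shows "integrable (P x) f"
proof -
  interpret prob_space "P x" by (rule prob[OF x])
  show ?thesis
    by (rule integrable_const_bound[where B=1]) (use f b space_P[OF x] in auto)
qed

lemma markov_product:
  assumes x: "x \<in> I" and v: "v \<in> I" and R: "Measurable.pred (right.pre_sigma (H v)) R"
    and F[measurable]: "F \<in> borel_measurable (lifetime_paths l)" and F0: "\<And>w. w \<in> space (lifetime_paths l) \<Longrightarrow> 0 \<le> F w"
  shows "(LINT \<omega>|P x. (disc \<alpha> (H v \<omega>) * indicator {\<omega>. R \<omega>} \<omega>) * F (path_after_hit v \<omega>)) =
    (LINT \<omega>|P x. disc \<alpha> (H v \<omega>) * indicator {\<omega>. R \<omega>} \<omega>) * (LINT \<omega>|P v. (F (path_from X 0 \<omega>) :: real))"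
proof -
  have [measurable]: "H v \<in> borel_measurable (right.pre_sigma (H v))"
    by (rule right.measurable_stopping_time_pre_sigma[OF stopping_hit])
  note R[measurable]
  have Rm[measurable]: "Measurable.pred (P x) R"
    using R pre_sigma_subset[OF stopping_hit, of v] sets_P[OF x] by (auto simp: pred_def right.space_pre_sigma space_P[OF x])
  note [measurable] = measurable_hit_P[OF x, of v] measurable_after_hit[OF x, of v] measurable_path_P[OF v]
  let ?Y = "\<lambda>\<omega>. disc \<alpha> (H v \<omega>) * indicator {\<omega>. R \<omega>} \<omega>"
  have Y: "(\<lambda>\<omega>. ennreal (?Y \<omega>)) \<in> borel_measurable (right.pre_sigma (H v))"
    by measurable
  have Ym[measurable]: "?Y \<in> borel_measurable (P x)" by measurable
  have sp: "path_after_hit v \<omega> \<in> space (lifetime_paths l)" if "\<omega> \<in> space (P x)" for \<omega>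
    using measurable_space[OF measurable_after_hit[OF x] that] .
  have sp0: "path_from X 0 \<omega> \<in> space (lifetime_paths l)" if "\<omega> \<in> space (P v)" for \<omega>
    using measurable_space[OF measurable_path_P[OF v] that] .
  have Yz: "ennreal (?Y \<omega>) * indicator {\<omega>. H v \<omega> < \<infinity>} \<omega> = ennreal (?Y \<omega>)" for \<omega>
    by (auto split: split_indicator)
  have 1: "(LINT \<omega>|P x. ?Y \<omega> * F (path_after_hit v \<omega>)) =
    enn2real (\<integral>\<^sup>+\<omega>. ennreal (?Y \<omega>) * ennreal (F (path_after_hit v \<omega>)) \<partial>P x)"
    using F0 sp by (subst integral_eq_nn_integral)
      (auto intro!: AE_I2 arg_cong[where f=enn2real] nn_integral_cong simp: ennreal_mult' mult.assoc)
  have 2: "(LINT \<omega>|P x. ?Y \<omega>) = enn2real (\<integral>\<^sup>+\<omega>. ennreal (?Y \<omega>) \<partial>P x)"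
    by (subst integral_eq_nn_integral) auto
  have 3: "(LINT \<omega>|P v. F (path_from X 0 \<omega>)) = enn2real (\<integral>\<^sup>+\<omega>. ennreal (F (path_from X 0 \<omega>)) \<partial>P v)"
    using F0 sp0 by (subst integral_eq_nn_integral) (auto intro!: AE_I2)
  have "(\<lambda>w. ennreal (F w)) \<in> borel_measurable (lifetime_paths l)" by measurable
  from strong_Markov_hit[OF x v Y this] show ?thesis
    unfolding 1 2 3 Yz by (simp add: enn2real_mult)
qed

lemma stopping_less_pre_sigma:
  assumes "stopping_time (right_filtration Om X) T"
  shows "Measurable.pred (right.pre_sigma (H v)) (\<lambda>\<omega>. H v \<omega> < T \<omega>)"
  using right.stopping_time_less[OF stopping_hit assms] .

context
  fixes x v :: real and \<omega> :: 'a and T :: real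
  assumes w: "\<omega> \<in> space Om" and T: "H v \<omega> = ereal T"
begin

lemma T_nonneg: "0 \<le> T"
  using hit_0[of v \<omega>] T by simp

lemma path_after_hit_apply: "0 \<le> t \<Longrightarrow> path_after_hit v \<omega> t = X (T + t) \<omega>"
  by (simp add: path_from_def T)

lemma lifetime_path_after_hit: "lifetime_path l (path_after_hit v \<omega>)"
  by (rule lifetime_path_shift[OF path[OF w] T_nonneg]) (simp add: path_after_hit_apply)

lemma hitting_time_after:
  "H v \<omega> \<le> H y \<omega> \<Longrightarrow> H y \<omega> = ereal T + hit y (path_after_hit v \<omega>)"
  using hit_shift_hit[OF continuous_paths[OF w] T_nonneg, of v y "path_after_hit v \<omega>"] T path_after_hit_apply
  unfolding hitting_time_eq_hit by blast

lemma drawdown_time_after: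
  assumes "0 < \<delta>" "X 0 \<omega> \<le> ereal v" "H v \<omega> \<le> \<theta> \<delta> \<omega>"
  shows "\<theta> \<delta> \<omega> = ereal T + ddtime \<delta> (path_after_hit v \<omega>)"
  using ddtime_shift_hit[OF path[OF w] lifetime_path_after_hit assms(1) _ T_nonneg, of v] T path_after_hit_apply assms
  unfolding hitting_time_eq_hit drawdown_time_eq_ddtime by blast

end

lemma ereal_plus_less: "ereal T + a < ereal T + b \<longleftrightarrow> a < b"
  by (cases a; cases b) auto

lemma hit_lap_decompose:
  assumes x: "x \<in> I" and a: "a \<in> I" and y: "y \<in> I"
  shows "(LINT \<omega>|P x. disc \<alpha> (H y \<omega>) * before (H a) (H y) \<omega>) =
    hit_before \<alpha> x a y * hit_lap \<alpha> a y"
proof -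
  have F: "(\<lambda>w. disc \<alpha> (hit y w)) \<in> borel_measurable (lifetime_paths l)" by measurable
  have "(LINT \<omega>|P x. disc \<alpha> (H y \<omega>) * before (H a) (H y) \<omega>) =
    (LINT \<omega>|P x. (disc \<alpha> (H a \<omega>) * before (H a) (H y) \<omega>) *
       disc \<alpha> (hit y (path_after_hit a \<omega>)))"
  proof (rule Bochner_Integration.integral_cong[OF refl])
    fix \<omega> assume "\<omega> \<in> space (P x)"
    then have w: "\<omega> \<in> space Om" by (simp add: space_P[OF x])
    show "disc \<alpha> (H y \<omega>) * before (H a) (H y) \<omega> =
      disc \<alpha> (H a \<omega>) * before (H a) (H y) \<omega> *
       disc \<alpha> (hit y (path_after_hit a \<omega>))"
    proof (cases "H a \<omega> < H y \<omega>")
      case True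
      then obtain T where T: "H a \<omega> = ereal T" using hit_0[of a \<omega>] by (cases "H a \<omega>") auto
      show ?thesis
        using True hitting_time_after[OF w T less_imp_le[OF True]] disc_add[OF hit_nonneg] by (simp add: T)
    qed simp
  qed
  then show ?thesis
    unfolding hit_before_def hit_lap_def hit_path_from[symmetric]
    using markov_product[OF x a stopping_less_pre_sigma[OF stopping_hit] F] by (simp add: hit_path_from)
qed

text \<open>
  On \<open>H v < \<theta>\<close> both \<open>H w\<close> and \<open>\<theta>\<close> are \<open>H v\<close> plus the corresponding time of the path after \<open>H v\<close>.  A functional of
  the two times that turns this common delay into a discount factor therefore splits into a product.
\<close>

lemma renewal:
  assumes \<delta>: "0 < \<delta>" and x: "x \<in> I" and v: "v \<in> I" and xv: "x \<le> v" "v \<le> w"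
    and \<Phi>[measurable]: "case_prod \<Phi> \<in> borel_measurable (borel \<Otimes>\<^sub>M borel)" and \<Phi>0: "\<And>h d. 0 \<le> \<Phi> h d"
    and shift: "\<And>T h d. 0 \<le> h \<Longrightarrow> 0 \<le> d \<Longrightarrow> \<Phi> (ereal T + h) (ereal T + d) = disc \<alpha> (ereal T) * \<Phi> h d"
  shows "(LINT \<omega>|P x. before (H v) (\<theta> \<delta>) \<omega> *
      \<Phi> (H w \<omega>) (\<theta> \<delta> \<omega>)) =
    surv \<alpha> \<delta> x v * (LINT \<omega>|P v. \<Phi> (H w \<omega>) (\<theta> \<delta> \<omega>))"
proof -
  note [measurable] = measurable_ddtime[OF \<delta>]
  have F[measurable]: "(\<lambda>p. \<Phi> (hit w p) (ddtime \<delta> p)) \<in> borel_measurable (lifetime_paths l)"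
    by measurable
  note [measurable] = measurable_drawdown_P[OF \<delta> x] measurable_hit_P[OF x] measurable_after_hit[OF x]
  have "(LINT \<omega>|P x. before (H v) (\<theta> \<delta>) \<omega> *
      \<Phi> (H w \<omega>) (\<theta> \<delta> \<omega>)) =
    (LINT \<omega>|P x. (disc \<alpha> (H v \<omega>) * before (H v) (\<theta> \<delta>) \<omega>) *
       \<Phi> (hit w (path_after_hit v \<omega>)) (ddtime \<delta> (path_after_hit v \<omega>)))"
  proof (rule integral_cong_AE)
    show "AE \<omega> in P x. before (H v) (\<theta> \<delta>) \<omega> *
        \<Phi> (H w \<omega>) (\<theta> \<delta> \<omega>) =
      disc \<alpha> (H v \<omega>) * before (H v) (\<theta> \<delta>) \<omega> *
        \<Phi> (hit w (path_after_hit v \<omega>)) (ddtime \<delta> (path_after_hit v \<omega>))"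
      using AE_start[OF x]
    proof eventually_elim
      case (elim \<omega>)
      then have w: "\<omega> \<in> space Om" and s: "X 0 \<omega> \<le> ereal v" using xv by auto
      have le: "H v \<omega> \<le> H w \<omega>"
        unfolding hitting_time_eq_hit using hit_mono[OF continuous_paths[OF w] s xv(2)] .
      show ?case
      proof (cases "H v \<omega> < \<theta> \<delta> \<omega>")
        case True
        then obtain T where T: "H v \<omega> = ereal T" using hit_0[of v \<omega>] by (cases "H v \<omega>") auto
        show ?thesis
          unfolding hitting_time_after[OF w T le] drawdown_time_after[OF w T \<delta> s less_imp_le[OF True]]
          using shift[OF hit_nonneg ddtime_nonneg[OF lifetime_path_after_hit[OF w T] \<delta>]]
          by (simp add: T split: split_indicator)
      qed simp
    qed
  qed measurable
  also have "\<dots> = surv \<alpha> \<delta> x v * (LINT \<omega>|P v. \<Phi> (H w \<omega>) (\<theta> \<delta> \<omega>))"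
    unfolding surv_def
    using markov_product[OF x v stopping_less_pre_sigma[OF stopping_drawdown[OF \<delta>]] F] \<Phi>0
    by (simp add: hit_path_from ddtime_path_from)
  finally show ?thesis .
qed

lemma surv_mult:
  assumes \<delta>: "0 < \<delta>" and x: "x \<in> I" and v: "v \<in> I" and xv: "x \<le> v" "v < w"
  shows "surv \<alpha> \<delta> x w = surv \<alpha> \<delta> x v * surv \<alpha> \<delta> v w"
proof -
  note [measurable] = measurable_drawdown_P[OF \<delta> x] measurable_hit_P[OF x]
  let ?\<Phi> = "\<lambda>h d. disc \<alpha> h * indicator {(h, d). h < d} (h, d)"
  have "surv \<alpha> \<delta> x w = (LINT \<omega>|P x. before (H v) (\<theta> \<delta>) \<omega> *
      ?\<Phi> (H w \<omega>) (\<theta> \<delta> \<omega>))"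
    unfolding surv_def
  proof (rule integral_cong_AE)
    show "AE \<omega> in P x. disc \<alpha> (H w \<omega>) * before (H w) (\<theta> \<delta>) \<omega> =
      before (H v) (\<theta> \<delta>) \<omega> * ?\<Phi> (H w \<omega>) (\<theta> \<delta> \<omega>)"
      using AE_start[OF x]
    proof eventually_elim
      case (elim \<omega>)
      then have "H v \<omega> \<le> H w \<omega>"
        unfolding hitting_time_eq_hit using hit_mono[OF continuous_paths, of \<omega> v w] xv by simp
      then show ?case by (auto split: split_indicator)
    qed
  qed measurable
  also have "\<dots> = surv \<alpha> \<delta> x v * (LINT \<omega>|P v. ?\<Phi> (H w \<omega>) (\<theta> \<delta> \<omega>))"
    by (rule renewal[OF \<delta> x v xv(1) less_imp_le[OF xv(2)]])
      (auto simp: disc_add ereal_plus_less split: split_indicator)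
  also have "(LINT \<omega>|P v. ?\<Phi> (H w \<omega>) (\<theta> \<delta> \<omega>)) = surv \<alpha> \<delta> v w"
    unfolding surv_def by (rule Bochner_Integration.integral_cong) (auto split: split_indicator)
  finally show ?thesis .
qed

lemma drop_increment:
  assumes \<delta>: "0 < \<delta>" and x: "x \<in> I" and v: "v \<in> I" and xv: "x \<le> v" "v < w"
  shows "(LINT \<omega>|P x. disc \<alpha> (\<theta> \<delta> \<omega>) *
      indicator {\<omega>. H v \<omega> < \<theta> \<delta> \<omega> \<and> \<theta> \<delta> \<omega> < H w \<omega>} \<omega>) =
    surv \<alpha> \<delta> x v * drop \<alpha> \<delta> v w"
proof -
  let ?\<Phi> = "\<lambda>h d. disc \<alpha> d * indicator {(h, d). d < h} (h, d)"
  have "(LINT \<omega>|P x. disc \<alpha> (\<theta> \<delta> \<omega>) *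
      indicator {\<omega>. H v \<omega> < \<theta> \<delta> \<omega> \<and> \<theta> \<delta> \<omega> < H w \<omega>} \<omega>) =
    (LINT \<omega>|P x. before (H v) (\<theta> \<delta>) \<omega> *
      ?\<Phi> (H w \<omega>) (\<theta> \<delta> \<omega>))"
    by (rule Bochner_Integration.integral_cong) (auto split: split_indicator)
  also have "\<dots> = surv \<alpha> \<delta> x v * (LINT \<omega>|P v. ?\<Phi> (H w \<omega>) (\<theta> \<delta> \<omega>))"
    by (rule renewal[OF \<delta> x v xv(1) less_imp_le[OF xv(2)]])
      (auto simp: disc_add ereal_plus_less split: split_indicator)
  also have "(LINT \<omega>|P v. ?\<Phi> (H w \<omega>) (\<theta> \<delta> \<omega>)) = drop \<alpha> \<delta> v w"
    unfolding drop_def by (rule Bochner_Integration.integral_cong) (auto split: split_indicator)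
  finally show ?thesis .
qed

end

context regular_diffusion
begin

lemma integrable_disc_hit:
  assumes x: "x \<in> I" and \<alpha>: "0 \<le> \<alpha>" and R: "Measurable.pred (P x) R"
  shows "integrable (P x) (\<lambda>\<omega>. disc \<alpha> (H v \<omega>) * indicator {\<omega>. R \<omega>} \<omega>)"
proof (rule integrable_bounded[OF x])
  note [measurable] = measurable_hit_P[OF x] R
  show "(\<lambda>\<omega>. disc \<alpha> (H v \<omega>) * indicator {\<omega>. R \<omega>} \<omega>) \<in> borel_measurable (P x)" by measurable
qed (use disc_le_1[OF \<alpha> hit_0] in \<open>auto split: split_indicator\<close>)

lemma integrable_disc_drawdown:
  assumes \<delta>: "0 < \<delta>" and x: "x \<in> I" and \<alpha>: "0 \<le> \<alpha>" and R: "Measurable.pred (P x) R"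
  shows "integrable (P x) (\<lambda>\<omega>. disc \<alpha> (\<theta> \<delta> \<omega>) * indicator {\<omega>. R \<omega>} \<omega>)"
proof (rule integrable_bounded[OF x])
  note [measurable] = measurable_drawdown_P[OF \<delta> x] R
  show "(\<lambda>\<omega>. disc \<alpha> (\<theta> \<delta> \<omega>) * indicator {\<omega>. R \<omega>} \<omega>) \<in> borel_measurable (P x)" by measurable
qed (use disc_le_1[OF \<alpha> drawdown_0[OF \<delta>]] in \<open>auto split: split_indicator\<close>)

lemma pred_hit_hit: "x \<in> I \<Longrightarrow> Measurable.pred (P x) (\<lambda>\<omega>. H a \<omega> < H b \<omega>)"
proof -
  assume "x \<in> I"
  note [measurable] = measurable_hit_P[OF this]
  show ?thesis by measurable
qed

lemma pred_hit_drawdown: "x \<in> I \<Longrightarrow> 0 < \<delta> \<Longrightarrow> Measurable.pred (P x) (\<lambda>\<omega>. H a \<omega> < \<theta> \<delta> \<omega>)"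
  and pred_drawdown_hit: "x \<in> I \<Longrightarrow> 0 < \<delta> \<Longrightarrow> Measurable.pred (P x) (\<lambda>\<omega>. \<theta> \<delta> \<omega> < H a \<omega>)"
proof -
  assume "x \<in> I" "0 < \<delta>"
  note [measurable] = measurable_hit_P[OF this(1)] measurable_drawdown_P[OF this(2,1)]
  show "Measurable.pred (P x) (\<lambda>\<omega>. H a \<omega> < \<theta> \<delta> \<omega>)"
    "Measurable.pred (P x) (\<lambda>\<omega>. \<theta> \<delta> \<omega> < H a \<omega>)" by measurable
qed

lemma hit_attained_X:
  assumes "\<omega> \<in> space Om" "H v \<omega> < \<infinity>"
  obtains T where "0 \<le> T" "H v \<omega> = ereal T" "X T \<omega> = ereal v"
  using hit_attained[OF continuous_paths[OF assms(1)], of v] assms(2) unfolding hitting_time_eq_hit by metis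

lemma hits_distinct:
  assumes "\<omega> \<in> space Om" "a \<noteq> b" "H a \<omega> = H b \<omega>"
  shows "H a \<omega> = \<infinity>"
proof (rule ccontr)
  assume "\<not> ?thesis"
  then have f: "H a \<omega> < \<infinity>" "H b \<omega> < \<infinity>" using assms by auto
  obtain T T' where "H a \<omega> = ereal T" "X T \<omega> = ereal a" "H b \<omega> = ereal T'" "X T' \<omega> = ereal b"
    using hit_attained_X[OF assms(1) f(1)] hit_attained_X[OF assms(1) f(2)] by metis
  then show False using assms by simp
qed

section \<open>Two-sided exit and drawdown\<close>

text \<open>
  The path reaches \<open>y\<close> either before \<open>a\<close>, or after \<open>a\<close>, when it starts afresh from \<open>a\<close>.  There are no ties, except
  when neither point is reached.
\<close>

lemma hit_lap_split:
  assumes \<alpha>: "0 \<le> \<alpha>" and x: "x \<in> I" and a: "a \<in> I" and y: "y \<in> I" and ay: "a \<noteq> y"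
  shows "hit_lap \<alpha> x y = hit_before \<alpha> x y a + hit_before \<alpha> x a y * hit_lap \<alpha> a y"
proof -
  have "hit_lap \<alpha> x y = (LINT \<omega>|P x. disc \<alpha> (H y \<omega>) * before (H y) (H a) \<omega> +
      disc \<alpha> (H y \<omega>) * before (H a) (H y) \<omega>)"
    unfolding hit_lap_def
  proof (rule Bochner_Integration.integral_cong[OF refl])
    fix \<omega> assume "\<omega> \<in> space (P x)"
    then have w: "\<omega> \<in> space Om" by (simp add: space_P[OF x])
    show "disc \<alpha> (H y \<omega>) = disc \<alpha> (H y \<omega>) * before (H y) (H a) \<omega> +
      disc \<alpha> (H y \<omega>) * before (H a) (H y) \<omega>"
      using hits_distinct[OF w ay] by (cases "H a \<omega> = H y \<omega>") (auto split: split_indicator)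
  qed
  also have "\<dots> = hit_before \<alpha> x y a + hit_before \<alpha> x a y * hit_lap \<alpha> a y"
    unfolding hit_lap_decompose[OF x a y, symmetric] unfolding hit_before_def
    by (intro Bochner_Integration.integral_add integrable_disc_hit x \<alpha> pred_hit_hit)
  finally show ?thesis .
qed

lemma hit_lap_exp_neg:
  assumes "0 < \<alpha>"
  shows "(LINT \<omega>|P x. exp_neg (ereal \<alpha> * H y \<omega>)) = hit_lap \<alpha> x y"
  unfolding hit_lap_def using exp_neg_eq_disc[OF assms hit_0] by simp

text \<open>
  The hitting time of another point is positive by continuity.  This is the source of the strict
  monotonicity of \<open>\<psi>\<close>.
\<close>

lemma hit_lap_less_1:
  assumes \<alpha>: "0 < \<alpha>" and x: "x \<in> I" and xy: "x \<noteq> y"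
  shows "hit_lap \<alpha> x y < 1"
proof -
  interpret prob_space "P x" by (rule prob[OF x])
  have "integrable (P x) (\<lambda>\<omega>. disc \<alpha> (H y \<omega>))"
    using integrable_disc_hit[OF x, of \<alpha> "\<lambda>_. True"] \<alpha> by simp
  moreover have "AE \<omega> in P x. disc \<alpha> (H y \<omega>) < 1"
    using AE_start[OF x]
  proof eventually_elim
    case (elim \<omega>)
    show ?case
    proof (cases "H y \<omega> < \<infinity>")
      case True
      then obtain T where T: "0 \<le> T" "H y \<omega> = ereal T" "X T \<omega> = ereal y"
        using hit_attained_X[of \<omega> y] elim by metis
      then have "T \<noteq> 0" using elim xy by auto
      then show ?thesis using T \<alpha> by (simp add: disc_def)
    qed simp
  qed
  ultimately show ?thesis unfolding hit_lap_def by (rule expectation_less)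
qed

context
  fixes S :: "real \<Rightarrow> real" and m :: "real measure" and \<alpha> :: real and \<psi> \<phi> :: "real \<Rightarrow> real"
  assumes inc: "increasing_solution P X I S m \<alpha> \<psi>" and dec: "decreasing_solution P X I S m \<alpha> \<phi>"
    and \<alpha>: "0 < \<alpha>"
begin

lemma \<psi>_pos: "x \<in> I \<Longrightarrow> 0 < \<psi> x" and \<phi>_pos: "x \<in> I \<Longrightarrow> 0 < \<phi> x"
  using inc dec by (auto simp: increasing_solution_def decreasing_solution_def)

lemma hit_lap_up: "x \<in> I \<Longrightarrow> y \<in> I \<Longrightarrow> x \<le> y \<Longrightarrow> hit_lap \<alpha> x y = \<psi> x / \<psi> y"
  using inc by (simp add: increasing_solution_def hit_lap_exp_neg[OF \<alpha>])

lemma hit_lap_down: "x \<in> I \<Longrightarrow> y \<in> I \<Longrightarrow> y \<le> x \<Longrightarrow> hit_lap \<alpha> x y = \<phi> x / \<phi> y"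
  using dec by (simp add: decreasing_solution_def hit_lap_exp_neg[OF \<alpha>])

lemma \<psi>_strict: "x \<in> I \<Longrightarrow> y \<in> I \<Longrightarrow> x < y \<Longrightarrow> \<psi> x < \<psi> y"
  using hit_lap_less_1[OF \<alpha>, of x y] hit_lap_up[of x y] \<psi>_pos[of y] by (simp add: divide_less_eq)

lemma \<phi>_anti: "x \<in> I \<Longrightarrow> y \<in> I \<Longrightarrow> x \<le> y \<Longrightarrow> \<phi> y \<le> \<phi> x"
  using dec by (auto simp: decreasing_solution_def monotone_on_def)

lemma cross_pos: "a \<in> I \<Longrightarrow> v \<in> I \<Longrightarrow> a < v \<Longrightarrow> 0 < cross \<psi> \<phi> a v"
proof -
  assume h: "a \<in> I" "v \<in> I" "a < v"
  have "\<phi> v * \<psi> a < \<phi> v * \<psi> v" using \<psi>_strict[OF h] \<phi>_pos[OF h(2)] by simp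
  also have "\<dots> \<le> \<phi> a * \<psi> v" using \<phi>_anti[of a v] h \<psi>_pos[OF h(2)] by (intro mult_right_mono) auto
  finally show ?thesis by (simp add: cross_def)
qed

text \<open>
  Reaching \<open>v\<close> and reaching \<open>a\<close> from \<open>u\<close> give two linear equations for the two unknown transforms; \<open>cross\<close> is
  the determinant in Cramer's rule.
\<close>

lemma hit_before_laplace:
  assumes I: "a \<in> I" "u \<in> I" "v \<in> I" and au: "a < u" "u < v"
  shows "hit_before \<alpha> u v a = cross \<psi> \<phi> a u / cross \<psi> \<phi> a v"
    and "hit_before \<alpha> u a v = cross \<psi> \<phi> u v / cross \<psi> \<phi> a v"
proof -
  have c: "0 < cross \<psi> \<phi> a v" using cross_pos I au by auto
  have p: "0 < \<psi> v" "0 < \<phi> a" using \<psi>_pos \<phi>_pos I by auto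
  let ?s = "hit_before \<alpha> u v a" and ?t = "hit_before \<alpha> u a v"
  have "\<psi> u / \<psi> v = ?s + ?t * (\<psi> a / \<psi> v)"
    using hit_lap_split[of \<alpha> u a v] hit_lap_up[of u v] hit_lap_up[of a v] I au \<alpha> by simp
  then have 1: "\<psi> u = ?s * \<psi> v + ?t * \<psi> a" using p by (simp add: field_simps)
  have "\<phi> u / \<phi> a = ?t + ?s * (\<phi> v / \<phi> a)"
    using hit_lap_split[of \<alpha> u v a] hit_lap_down[of u a] hit_lap_down[of v a] I au \<alpha> by simp
  then have 2: "\<phi> u = ?t * \<phi> a + ?s * \<phi> v" using p by (simp add: field_simps)
  have "cross \<psi> \<phi> a u = ?s * cross \<psi> \<phi> a v" unfolding cross_def 1 2 by (simp add: algebra_simps)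
  then show "?s = cross \<psi> \<phi> a u / cross \<psi> \<phi> a v" using c by simp
  have "cross \<psi> \<phi> u v = ?t * cross \<psi> \<phi> a v" unfolding cross_def 1 2 by (simp add: algebra_simps)
  then show "?t = cross \<psi> \<phi> u v / cross \<psi> \<phi> a v" using c by simp
qed

end

lemma hit_before_le_surv:
  assumes \<delta>: "0 < \<delta>" and \<alpha>: "0 \<le> \<alpha>" and u: "u \<in> I" and uv: "u < v" "v < u + \<delta>"
  shows "hit_before \<alpha> u v (v - \<delta>) \<le> surv \<alpha> \<delta> u v"
  unfolding hit_before_def surv_def
proof (intro integral_mono_AE integrable_disc_hit u \<alpha> pred_hit_hit pred_hit_drawdown \<delta>)
  show "AE \<omega> in P u. disc \<alpha> (H v \<omega>) * before (H v) (H (v - \<delta>)) \<omega>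
    \<le> disc \<alpha> (H v \<omega>) * before (H v) (\<theta> \<delta>) \<omega>"
    using AE_start[OF u]
  proof eventually_elim
    case (elim \<omega>)
    then have "H v \<omega> < H (v - \<delta>) \<omega> \<Longrightarrow> H v \<omega> < \<theta> \<delta> \<omega>"
      unfolding hitting_time_eq_hit drawdown_time_eq_ddtime
      using up_first_imp_no_drawdown[OF path \<delta>, of \<omega> v] uv by simp
    then show ?case by (auto split: split_indicator)
  qed
qed

lemma surv_le_hit_before:
  assumes \<delta>: "0 < \<delta>" and \<alpha>: "0 \<le> \<alpha>" and u: "u \<in> I" and au: "a < u - \<delta>"
  shows "surv \<alpha> \<delta> u v \<le> hit_before \<alpha> u v a"
  unfolding hit_before_def surv_def
proof (intro integral_mono_AE integrable_disc_hit u \<alpha> pred_hit_hit pred_hit_drawdown \<delta>)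
  show "AE \<omega> in P u. disc \<alpha> (H v \<omega>) * before (H v) (\<theta> \<delta>) \<omega>
    \<le> disc \<alpha> (H v \<omega>) * before (H v) (H a) \<omega>"
    using AE_start[OF u]
  proof eventually_elim
    case (elim \<omega>)
    then have "H v \<omega> < \<theta> \<delta> \<omega> \<Longrightarrow> H v \<omega> < H a \<omega>"
      unfolding hitting_time_eq_hit drawdown_time_eq_ddtime
      using no_drawdown_imp_up_first[OF path \<delta>, of \<omega> a v] au by simp
    then show ?case by (auto split: split_indicator)
  qed
qed

lemma drop_le_hit_before:
  assumes \<delta>: "0 < \<delta>" and \<alpha>: "0 \<le> \<alpha>" and u: "u \<in> I" and uv: "u < v" "v < u + \<delta>"
  shows "drop \<alpha> \<delta> u v \<le> hit_before \<alpha> u (v - \<delta>) v"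
  unfolding hit_before_def drop_def
proof (intro integral_mono_AE integrable_disc_hit integrable_disc_drawdown u \<alpha> pred_hit_hit pred_drawdown_hit \<delta>)
  show "AE \<omega> in P u. disc \<alpha> (\<theta> \<delta> \<omega>) * before (\<theta> \<delta>) (H v) \<omega>
    \<le> disc \<alpha> (H (v - \<delta>) \<omega>) * before (H (v - \<delta>)) (H v) \<omega>"
    using AE_start[OF u]
  proof eventually_elim
    case (elim \<omega>)
    then have "\<theta> \<delta> \<omega> < H v \<omega> \<Longrightarrow> H (v - \<delta>) \<omega> \<le> \<theta> \<delta> \<omega>"
      unfolding hitting_time_eq_hit drawdown_time_eq_ddtime
      using drawdown_imp_hit[OF path \<delta>, of \<omega> v] uv by simp
    then show ?case using disc_antimono[OF \<alpha> hit_0] by (auto split: split_indicator)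
  qed
qed

lemma hit_before_le_drop:
  assumes \<delta>: "0 < \<delta>" and \<alpha>: "0 \<le> \<alpha>" and u: "u \<in> I" and au: "a < u - \<delta>"
  shows "hit_before \<alpha> u a v \<le> drop \<alpha> \<delta> u v"
  unfolding hit_before_def drop_def
proof (intro integral_mono_AE integrable_disc_hit integrable_disc_drawdown u \<alpha> pred_hit_hit pred_drawdown_hit \<delta>)
  show "AE \<omega> in P u. disc \<alpha> (H a \<omega>) * before (H a) (H v) \<omega>
    \<le> disc \<alpha> (\<theta> \<delta> \<omega>) * before (\<theta> \<delta>) (H v) \<omega>"
    using AE_start[OF u]
  proof eventually_elim
    case (elim \<omega>)
    then have le: "H a \<omega> < \<infinity> \<Longrightarrow> \<theta> \<delta> \<omega> \<le> H a \<omega>"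
      unfolding hitting_time_eq_hit drawdown_time_eq_ddtime
      using hit_imp_drawdown[OF path \<delta>, of \<omega> a] au by simp
    have "\<theta> \<delta> \<omega> \<le> H a \<omega> \<and> \<theta> \<delta> \<omega> < H v \<omega>"
      if "H a \<omega> < H v \<omega>"
      using le[OF less_le_trans[OF that ereal_less_eq(1)]] that by (auto intro: le_less_trans)
    then show ?case using disc_antimono[OF \<alpha> drawdown_0[OF \<delta>], of \<omega> "H a \<omega>"] elim
      by (auto split: split_indicator)
  qed
qed

lemma surv_plus_drop_le_1:
  assumes \<delta>: "0 < \<delta>" and \<alpha>: "0 \<le> \<alpha>" and u: "u \<in> I"
  shows "surv \<alpha> \<delta> u v + drop \<alpha> \<delta> u v \<le> 1"
proof -
  interpret prob_space "P u" by (rule prob[OF u])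
  have "surv \<alpha> \<delta> u v + drop \<alpha> \<delta> u v = (LINT \<omega>|P u. disc \<alpha> (H v \<omega>) *
     before (H v) (\<theta> \<delta>) \<omega> +
     disc \<alpha> (\<theta> \<delta> \<omega>) * before (\<theta> \<delta>) (H v) \<omega>)"
    unfolding surv_def drop_def
    by (intro Bochner_Integration.integral_add[symmetric] integrable_disc_hit integrable_disc_drawdown u \<alpha>
        pred_hit_drawdown pred_drawdown_hit \<delta>)
  also have "\<dots> \<le> (LINT \<omega>|P u. 1)"
  proof (intro integral_mono Bochner_Integration.integrable_add integrable_disc_hit integrable_disc_drawdown u \<alpha>
        pred_hit_drawdown pred_drawdown_hit \<delta> integrable_const)
    fix \<omega> assume "\<omega> \<in> space (P u)"
    then show "disc \<alpha> (H v \<omega>) *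
     before (H v) (\<theta> \<delta>) \<omega> +
     disc \<alpha> (\<theta> \<delta> \<omega>) * before (\<theta> \<delta>) (H v) \<omega> \<le> (1::real)"
      using disc_le_1[OF \<alpha> hit_0] disc_le_1[OF \<alpha> drawdown_0[OF \<delta>]] space_P[OF u] by (auto split: split_indicator)
  qed
  finally show ?thesis by (simp add: prob_space)
qed

lemma drop_nonneg: "0 \<le> drop \<alpha> \<delta> u v"
  unfolding drop_def by (rule Bochner_Integration.integral_nonneg) (auto split: split_indicator)

end

context regular_diffusion
begin

lemma in_I_above: "l < ereal a \<Longrightarrow> a \<le> b \<Longrightarrow> b \<in> I"
  by (rule in_I) (auto intro: less_le_trans)

lemma prob_hit_finite:
  assumes x: "x \<in> I"
  shows "hit_lap 0 x y = measure (P x) {\<omega> \<in> space (P x). H y \<omega> < \<infinity>}"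
proof -
  note [measurable] = measurable_hit_P[OF x]
  have "hit_lap 0 x y = (LINT \<omega>|P x. indicator {\<omega> \<in> space (P x). H y \<omega> < \<infinity>} \<omega>)"
    unfolding hit_lap_def by (rule Bochner_Integration.integral_cong) (auto simp: disc_0 split: split_indicator)
  then show ?thesis by simp
qed

lemma hit_before_0:
  assumes x: "x \<in> I"
  shows "hit_before 0 x v a = measure (P x) {\<omega> \<in> space (P x). H v \<omega> < H a \<omega>}"
proof -
  note [measurable] = measurable_hit_P[OF x]
  have "hit_before 0 x v a = (LINT \<omega>|P x. indicator {\<omega> \<in> space (P x). H v \<omega> < H a \<omega>} \<omega>)"
    unfolding hit_before_def by (rule Bochner_Integration.integral_cong) (auto simp: disc_0 split: split_indicator)
  then show ?thesis by simp
qed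

section \<open>Levels above the start are reached\<close>

text \<open>
  The Green function is bounded and the speed measure has a bounded density on a compact interval in the
  interior, so that the mean exit time is finite.
\<close>

lemma AE_exit:
  assumes S: "scale_function P X I S" and m: "speed_measure P X I S m" and dens: "has_continuous_density I m"
    and a: "l < ereal a" and axb: "a \<le> x" "x \<le> b" "a < b"
  shows "AE \<omega> in P x. H a \<omega> < \<infinity> \<or> H b \<omega> < \<infinity>"
proof -
  have I: "a \<in> I" "b \<in> I" "x \<in> I" and lo: "\<And>y. a \<le> y \<Longrightarrow> l < ereal y"
    using in_I_above[OF a] axb by (auto intro: less_le_trans[OF a])
  have int: "{a..b} \<subseteq> interior I"
  proof (rule subset_trans[OF _ interior_maximal])
    show "{x. l < ereal x} \<subseteq> I" using in_I by auto
    show "open {x. l < ereal x}"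
      using open_Collect_less[of "\<lambda>_. l" ereal] by (simp add: continuous_on_ereal)
    show "{a..b} \<subseteq> {x. l < ereal x}" using lo by auto
  qed
  note [measurable] = measurable_hit_P[OF I(3)]
  obtain m' where m': "continuous_on (interior I) m'" "\<And>y. y \<in> interior I \<Longrightarrow> 0 \<le> m' y"
    "m = density lborel (\<lambda>y. ennreal (m' y) * indicator (interior I) y)"
    using dens unfolding has_continuous_density_def by auto
  obtain B where B: "\<And>y. y \<in> {a..b} \<Longrightarrow> m' y \<le> B"
  proof -
    have "compact {a..b}" "{a..b} \<noteq> {}" using axb by auto
    from continuous_attains_sup[OF this continuous_on_subset[OF m'(1) int]] that show thesis by blast
  qed
  have Smono: "S u \<le> S v" if "a \<le> u" "u \<le> v" for u v
    using S in_I lo[of u] lo[of v] that unfolding scale_function_def strict_mono_on_def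
    by (cases "u = v") (auto intro!: less_imp_le)
  have green: "(S (min x y) - S a) * (S b - S (max x y)) / (S b - S a) \<le> S b - S a" if "y \<in> {a<..<b}" for y
  proof (cases "S b - S a = 0")
    case False
    then have pos: "0 < S b - S a" using Smono[of a b] axb by simp
    have "(S (min x y) - S a) * (S b - S (max x y)) \<le> (S b - S a) * (S b - S a)"
      using that axb by (intro mult_mono) (auto intro!: Smono simp: min_def max_def)
    then show ?thesis using pos by (simp add: divide_le_eq)
  qed simp
  have "(\<integral>\<^sup>+ \<omega>. e2ennreal (min (H a \<omega>) (H b \<omega>)) \<partial>P x) =
        (\<integral>\<^sup>+ y\<in>{a<..<b}. ennreal ((S (min x y) - S a) * (S b - S (max x y)) / (S b - S a)) \<partial>m)"
    using m I axb unfolding speed_measure_def by auto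
  also have "\<dots> \<le> (\<integral>\<^sup>+ y. ennreal (S b - S a) * indicator {a<..<b} y \<partial>m)"
    using green by (intro nn_integral_mono) (auto split: split_indicator intro!: ennreal_leI)
  also have "\<dots> = ennreal (S b - S a) * emeasure m {a<..<b}"
    by (rule nn_integral_cmult_indicator) (simp add: m'(3))
  also have "emeasure m {a<..<b} = (\<integral>\<^sup>+ y. ennreal (m' y) * indicator (interior I) y * indicator {a<..<b} y \<partial>lborel)"
  proof -
    have "(\<lambda>y. ennreal (indicator (interior I) y * m' y)) \<in> borel_measurable borel"
      using borel_measurable_continuous_on_indicator[OF _ m'(1)] by simp
    also have "(\<lambda>y. ennreal (indicator (interior I) y * m' y)) = (\<lambda>y. ennreal (m' y) * indicator (interior I) y)"
      by (auto split: split_indicator)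
    finally show ?thesis unfolding m'(3) by (subst emeasure_density) auto
  qed
  also have "\<dots> \<le> (\<integral>\<^sup>+ y. ennreal B * indicator {a<..<b} y \<partial>lborel)"
    using B by (intro nn_integral_mono) (auto split: split_indicator intro!: ennreal_leI)
  also have "\<dots> = ennreal B * ennreal (b - a)"
    using axb by (subst nn_integral_cmult_indicator) auto
  also have "ennreal (S b - S a) * (ennreal B * ennreal (b - a)) < \<infinity>"
    by (simp add: ennreal_mult_less_top)
  finally have fin: "(\<integral>\<^sup>+ \<omega>. e2ennreal (min (H a \<omega>) (H b \<omega>)) \<partial>P x) < \<infinity>"
    by (simp add: mult_left_mono)
  have "AE \<omega> in P x. e2ennreal (min (H a \<omega>) (H b \<omega>)) \<noteq> \<infinity>"
    using fin by (intro nn_integral_PInf_AE) auto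
  then show ?thesis
  proof eventually_elim
    case (elim \<omega>)
    then show ?case by (auto simp: min_def split: if_splits)
  qed
qed

text \<open>
  The scale function gives the probability of leaving below; since the exit is certain, the complement is
  the probability of leaving above.
\<close>

lemma hit_before_scale:
  assumes S: "scale_function P X I S" and m: "speed_measure P X I S m" and dens: "has_continuous_density I m"
    and a: "l < ereal a" and axb: "a < x" "x < b"
  shows "hit_before 0 x a b = (S b - S x) / (S b - S a)"
    and "hit_before 0 x b a = (S x - S a) / (S b - S a)"
proof -
  have I: "a \<in> I" "b \<in> I" "x \<in> I" using in_I_above[OF a] axb by auto
  interpret prob_space "P x" by (rule prob[OF I(3)])
  note [measurable] = measurable_hit_P[OF I(3)]
  show 1: "hit_before 0 x a b = (S b - S x) / (S b - S a)"
    unfolding hit_before_0[OF I(3)] using S I axb unfolding scale_function_def by auto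
  have "S a < S b" using S I axb unfolding scale_function_def strict_mono_on_def by auto
  have "hit_before 0 x b a = prob (space (P x) - {\<omega> \<in> space (P x). H a \<omega> < H b \<omega>})"
    unfolding hit_before_0[OF I(3)]
  proof (rule finite_measure_eq_AE)
    have "AE \<omega> in P x. H a \<omega> < \<infinity> \<or> H b \<omega> < \<infinity>"
      using AE_exit[OF S m dens a] axb by simp
    then show "AE \<omega> in P x. \<omega> \<in> {\<omega> \<in> space (P x). H b \<omega> < H a \<omega>} \<longleftrightarrow>
      \<omega> \<in> space (P x) - {\<omega> \<in> space (P x). H a \<omega> < H b \<omega>}"
      using AE_start[OF I(3)]
    proof eventually_elim
      case (elim \<omega>)
      then have "H a \<omega> \<noteq> H b \<omega>" using hits_distinct[of \<omega> a b] axb by auto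
      then show ?case by auto
    qed
  qed measurable
  also have "\<dots> = 1 - (S b - S x) / (S b - S a)"
    using 1 unfolding hit_before_0[OF I(3)] by (subst prob_compl) auto
  also have "\<dots> = (S x - S a) / (S b - S a)" using \<open>S a < S b\<close> by (simp add: field_simps)
  finally show "hit_before 0 x b a = (S x - S a) / (S b - S a)" .
qed

text \<open>
  The probability of reaching \<open>y\<close> before \<open>a\<close> tends to \<open>1\<close> as \<open>S a\<close> tends to \<open>-\<infinity>\<close>.  Such points \<open>a\<close> lie in the interior,
  because \<open>S\<close> would be bounded below if the left endpoint belonged to the state space.
\<close>

lemma hit_lap_0_unbounded_scale:
  assumes S: "scale_function P X I S" and m: "speed_measure P X I S m" and dens: "has_continuous_density I m"
    and unb: "scale_left I S = -\<infinity>" and x: "x \<in> I" and xy: "x < y"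
  shows "hit_lap 0 x y = 1"
proof -
  interpret prob_space "P x" by (rule prob[OF x])
  have y: "y \<in> I" using I_ge[OF x] xy by (intro in_I) (auto intro: le_less_trans)
  have mono: "strict_mono_on I S" using S by (simp add: scale_function_def)
  then have Sxy: "S x < S y" using x y xy by (auto simp: strict_mono_on_def)
  have "1 \<le> hit_lap 0 x y + e" if e: "0 < e" for e
  proof -
    \<comment> \<open>Below this value of \<open>S a\<close> the exit probability \<open>(S y - S x) / (S y - S a)\<close> is less than \<open>e\<close>.\<close>
    define K where "K = min (S x) (S y - (S y - S x) / e)"
    have "scale_left I S < ereal K" using unb by simp
    then obtain a where a: "a \<in> I" "S a < K" unfolding scale_left_def by (auto simp: INF_less_iff)
    have ax: "a < x"
      using a x mono unfolding strict_mono_on_def K_def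
      by (metis linorder_neqE_linordered_idom min_less_iff_conj order_less_imp_not_less)
    have "ereal a \<noteq> l"
    proof
      assume al: "ereal a = l"
      have "S a \<le> S z" if "z \<in> I" for z
        using I_ge[OF that] mono a(1) that unfolding strict_mono_on_def al[symmetric]
        by (cases "a = z") (auto intro!: less_imp_le)
      then have "ereal (S a) \<le> scale_left I S" unfolding scale_left_def by (intro INF_greatest) simp
      then show False using unb by simp
    qed
    then have la: "l < ereal a" using I_ge[OF a(1)] by simp
    have Sa: "S a < S x" using a by (simp add: K_def)
    have "(S y - S x) / e < S y - S a" using a by (simp add: K_def)
    then have "(S y - S x) / (S y - S a) < e" using e Sa Sxy by (simp add: field_simps)
    then have "1 - e < (S x - S a) / (S y - S a)" using Sa Sxy by (simp add: field_simps)
    also have "\<dots> = hit_before 0 x y a" using hit_before_scale(2)[OF S m dens la ax xy] by simp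
    also have "\<dots> \<le> hit_lap 0 x y"
      unfolding hit_before_def hit_lap_def
      using integrable_disc_hit[OF x, of 0 "\<lambda>_. True"]
      by (intro integral_mono integrable_disc_hit pred_hit_hit x) (auto split: split_indicator)
    finally show ?thesis by simp
  qed
  then have "1 \<le> hit_lap 0 x y" by (rule field_le_epsilon)
  moreover have "hit_lap 0 x y \<le> 1" unfolding prob_hit_finite[OF x] by simp
  ultimately show ?thesis by simp
qed

definition hit_by :: "real \<Rightarrow> real \<Rightarrow> real \<Rightarrow> real" where
  "hit_by x y s = measure (P x) {\<omega> \<in> space (P x). H y \<omega> \<le> ereal s}"

text \<open>
  A path from \<open>a\<close> to \<open>y\<close> passes through every \<open>x\<close> in between, so \<open>a\<close> is the worst starting point.
\<close>

lemma hit_by_mono_start: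
  assumes a: "a \<in> I" and x: "x \<in> I" and ax: "a \<le> x" "x \<le> y"
  shows "hit_by a y s \<le> hit_by x y s"
proof -
  interpret pa: prob_space "P a" by (rule prob[OF a])
  interpret px: prob_space "P x" by (rule prob[OF x])
  note [measurable] = measurable_hit_P[OF a] measurable_hit_P[OF x] measurable_after_hit[OF a]
  let ?F = "\<lambda>w. indicator {w. hit y w \<le> ereal s} w :: real"
  have F: "?F \<in> borel_measurable (lifetime_paths l)" by measurable
  have R: "Measurable.pred (right.pre_sigma (H x)) (\<lambda>_. True)" by simp
  have [measurable]: "?F \<in> borel_measurable (lifetime_paths l)" by (rule F)
  have "hit_by a y s = (LINT \<omega>|P a. indicator {\<omega> \<in> space (P a). H y \<omega> \<le> ereal s} \<omega>)"
    unfolding hit_by_def by simp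
  also have "\<dots> \<le> (LINT \<omega>|P a. (disc 0 (H x \<omega>) * indicator {\<omega>. True} \<omega>) * ?F (path_after_hit x \<omega>))"
  proof (rule integral_mono_AE)
    show "integrable (P a) (\<lambda>\<omega>. (disc 0 (H x \<omega>) * indicator {\<omega>. True} \<omega>) * ?F (path_after_hit x \<omega>))"
    proof (rule integrable_bounded[OF a])
      have "(\<lambda>\<omega>. ?F (path_after_hit x \<omega>)) \<in> borel_measurable (P a)"
        by (rule measurable_compose[OF measurable_after_hit[OF a] F])
      note [measurable] = this
      show "(\<lambda>\<omega>. (disc 0 (H x \<omega>) * indicator {\<omega>. True} \<omega>) * ?F (path_after_hit x \<omega>)) \<in> borel_measurable (P a)"
        by measurable
    qed (auto simp: disc_0 split: split_indicator)
    show "AE \<omega> in P a. indicator {\<omega> \<in> space (P a). H y \<omega> \<le> ereal s} \<omega>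
      \<le> (disc 0 (H x \<omega>) * indicator {\<omega>. True} \<omega>) * ?F (path_after_hit x \<omega>)"
      using AE_start[OF a]
    proof eventually_elim
      case (elim \<omega>)
      show ?case
      proof (cases "H y \<omega> \<le> ereal s")
        case True
        have s: "X 0 \<omega> \<le> ereal x" and w: "\<omega> \<in> space Om" using elim ax by auto
        have le: "H x \<omega> \<le> H y \<omega>"
          unfolding hitting_time_eq_hit using hit_mono[OF continuous_paths[OF w] s ax(2)] by simp
        obtain T where T: "H x \<omega> = ereal T"
          using order_trans[OF le True] hit_0[of x \<omega>] by (cases "H x \<omega>") auto
        have "hit y (path_after_hit x \<omega>) \<le> H y \<omega>"
          unfolding hitting_time_after[OF w T le] using T_nonneg[OF w T] hit_nonneg[of y "path_after_hit x \<omega>"]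
          by (cases "hit y (path_after_hit x \<omega>)") auto
        then have "hit y (path_after_hit x \<omega>) \<le> ereal s" using True by (rule order_trans)
        then show ?thesis by (simp add: T disc_0 indicator_def)
      qed (simp add: indicator_def)
    qed
    show "integrable (P a) (indicat_real {\<omega> \<in> space (P a). H y \<omega> \<le> ereal s})"
      by (intro integrable_real_indicator) (simp_all add: pa.emeasure_eq_measure)
  qed
  also have "\<dots> = (LINT \<omega>|P a. disc 0 (H x \<omega>) * indicator {\<omega>. True} \<omega>) * (LINT \<omega>|P x. ?F (path_from X 0 \<omega>))"
    by (rule markov_product[OF a x R F]) simp
  also have "(LINT \<omega>|P x. ?F (path_from X 0 \<omega>)) = (LINT \<omega>|P x. indicator {\<omega> \<in> space (P x). H y \<omega> \<le> ereal s} \<omega>)"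
    by (rule Bochner_Integration.integral_cong) (auto simp: hit_path_from split: split_indicator)
  also have "\<dots> = hit_by x y s" unfolding hit_by_def by simp
  also have "(LINT \<omega>|P a. disc 0 (H x \<omega>) * indicator {\<omega>. True} \<omega>) * hit_by x y s \<le> 1 * hit_by x y s"
  proof (rule mult_right_mono)
    have "(LINT \<omega>|P a. disc 0 (H x \<omega>) * indicator {\<omega>. True} \<omega>) = hit_lap 0 a x" by (simp add: hit_lap_def)
    then show "(LINT \<omega>|P a. disc 0 (H x \<omega>) * indicator {\<omega>. True} \<omega>) \<le> 1" by (simp add: prob_hit_finite[OF a])
  qed (simp add: hit_by_def)
  finally show ?thesis by simp
qed

lemma hit_by_le_1: "x \<in> I \<Longrightarrow> hit_by x y s \<le> 1"
  using prob_space.prob_le_1[OF prob] by (simp add: hit_by_def)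

lemma emeasure_not_hit_by:
  assumes x: "x \<in> I"
  shows "emeasure (P x) {\<omega> \<in> space (P x). ereal s < H y \<omega>} = ennreal (1 - hit_by x y s)"
proof -
  interpret prob_space "P x" by (rule prob[OF x])
  note [measurable] = measurable_hit_P[OF x]
  have "{\<omega> \<in> space (P x). ereal s < H y \<omega>} = space (P x) - {\<omega> \<in> space (P x). H y \<omega> \<le> ereal s}"
    by auto
  then show ?thesis unfolding hit_by_def emeasure_eq_measure by (simp add: prob_compl)
qed

text \<open>
  The strong Markov property at the constant time \<open>s\<close>: a path that has not reached \<open>y\<close> is somewhere between
  the left endpoint and \<open>y\<close>, and from there it reaches \<open>y\<close> within time \<open>n\<close> at least as likely as from the
  endpoint.
\<close>

lemma hit_by_survival_step:
  assumes a: "a \<in> I" "l = ereal a" and x: "x \<in> I" "x < y" and s: "0 \<le> s" and n: "0 \<le> n"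
  shows "1 - hit_by x y (s + n) \<le> (1 - hit_by a y n) * (1 - hit_by x y s)"
proof -
  interpret px: prob_space "P x" by (rule prob[OF x(1)])
  note [measurable] = measurable_hit_P[OF x(1)]
  let ?A = "{\<omega> \<in> space Om. ereal s < H y \<omega>}"
  let ?T = "\<lambda>_::'a. ereal s"
  have T: "stopping_time (right_filtration Om X) ?T" by (rule stopping_time_const)
  have A: "?A \<in> sets (right.pre_sigma ?T)"
    using right.stopping_time_less[OF T stopping_hit, of y] by (simp add: pred_def right.space_pre_sigma)
  have "{w \<in> space (lifetime_paths l). ereal n < hit y w} \<in> sets (lifetime_paths l)" by measurable
  then obtain B where B: "B \<in> sets path_space" "{w \<in> space (lifetime_paths l). ereal n < hit y w} = B \<inter> {w. lifetime_path l w}"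
    by (rule sets_lifetime_paths_trace)
  have B_iff: "path_from X t \<omega> \<in> B \<longleftrightarrow> ereal n < hit y (path_from X t \<omega>)" if "\<omega> \<in> space Om" "0 \<le> t" for \<omega> t
  proof -
    have "path_from X t \<in> measurable (P x) (lifetime_paths l)"
      by (rule measurable_path_from_P[OF x(1)]) (use that in auto)
    then have "path_from X t \<omega> \<in> space (lifetime_paths l)"
      by (rule measurable_space) (use that in \<open>simp add: space_P[OF x(1)]\<close>)
    note sp = this
    have "path_from X t \<omega> \<in> B \<longleftrightarrow> path_from X t \<omega> \<in> B \<inter> {w. lifetime_path l w}"
      using space_lifetime_paths[OF sp] by simp
    then show ?thesis unfolding B(2)[symmetric] using sp by simp
  qed
  have alive: "alive_at X ?T \<omega> \<and> (\<exists>z. X s \<omega> = ereal z \<and> z \<in> I \<and> z < y)" if "\<omega> \<in> ?A" "X 0 \<omega> = ereal x" for \<omega>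
  proof -
    have w: "\<omega> \<in> space Om" and h: "ereal s < hit y (\<lambda>t. X t \<omega>)" using that by (auto simp: hitting_time_eq_hit)
    have lt: "X s \<omega> < ereal y"
      using below_before_hit[OF continuous_paths[OF w] _ s h] that(2) x by simp
    then show ?thesis using state_space[OF w s] by (auto simp: alive_at_def)
  qed
  have "emeasure (P x) {\<omega> \<in> space (P x). ereal (s + n) < H y \<omega>} \<le>
    emeasure (P x) {\<omega> \<in> ?A. alive_at X ?T \<omega> \<and> path_from X (real_of_ereal (?T \<omega>)) \<omega> \<in> B}"
  proof (rule emeasure_mono_AE)
    show "AE \<omega> in P x. \<omega> \<in> {\<omega> \<in> space (P x). ereal (s + n) < H y \<omega>} \<longrightarrow>
      \<omega> \<in> {\<omega> \<in> ?A. alive_at X ?T \<omega> \<and> path_from X (real_of_ereal (?T \<omega>)) \<omega> \<in> B}"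
      using AE_start[OF x(1)]
    proof eventually_elim
      case (elim \<omega>)
      show ?case
      proof
        assume "\<omega> \<in> {\<omega> \<in> space (P x). ereal (s + n) < H y \<omega>}"
        then have h: "ereal (s + n) < H y \<omega>" by simp
        have "ereal s \<le> ereal (s + n)" using n by simp
        then have h2: "ereal s < H y \<omega>" using h by (rule le_less_trans)
        have "X r \<omega> \<noteq> ereal y" if "0 \<le> r" "r < s" for r
        proof
          assume "X r \<omega> = ereal y"
          then have "H y \<omega> \<le> ereal r"
            unfolding hitting_time_eq_hit by (intro hit_le) (use that in auto)
          also have "\<dots> < ereal s" using that by simp
          finally show False using h2 by simp
        qed
        then have "H y \<omega> = ereal s + hit y (path_from X s \<omega>)"
          unfolding hitting_time_eq_hit by (intro hit_shift s) (auto simp: path_from_def)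
        then have "ereal n < hit y (path_from X s \<omega>)" using h by (cases "hit y (path_from X s \<omega>)") auto
        then show "\<omega> \<in> {\<omega> \<in> ?A. alive_at X ?T \<omega> \<and> path_from X (real_of_ereal (?T \<omega>)) \<omega> \<in> B}"
          using alive[of \<omega>] h2 elim B_iff[OF _ s] by auto
      qed
    qed
    have [measurable]: "X s \<in> borel_measurable (P x)" using measurable_X[OF s] by (simp add: measurable_P[OF x(1)])
    have [measurable]: "path_from X s \<in> measurable (P x) path_space"
    proof -
      have "path_from X s \<in> measurable (P x) (lifetime_paths l)"
        using measurable_path_from_P[OF x(1), of "\<lambda>_. s"] s by simp
      then show ?thesis unfolding lifetime_paths_def by (simp add: measurable_restrict_space2_iff)
    qed
    note [measurable] = B(1)
    have "{\<omega> \<in> space (P x). ereal s < H y \<omega> \<and> X s \<omega> < \<infinity> \<and> path_from X s \<omega> \<in> B} \<in> sets (P x)"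
      by measurable
    also have "{\<omega> \<in> space (P x). ereal s < H y \<omega> \<and> X s \<omega> < \<infinity> \<and> path_from X s \<omega> \<in> B} =
      {\<omega> \<in> ?A. alive_at X ?T \<omega> \<and> path_from X (real_of_ereal (?T \<omega>)) \<omega> \<in> B}"
      by (auto simp: space_P[OF x(1)] alive_at_def)
    finally show "{\<omega> \<in> ?A. alive_at X ?T \<omega> \<and> path_from X (real_of_ereal (?T \<omega>)) \<omega> \<in> B} \<in> sets (P x)" .
  qed
  also have "\<dots> = (\<integral>\<^sup>+ \<omega>. indicator {\<omega> \<in> ?A. alive_at X ?T \<omega>} \<omega> *
          emeasure (P (real_of_ereal (X (real_of_ereal (?T \<omega>)) \<omega>)))
            {\<omega>' \<in> space Om. path_from X 0 \<omega>' \<in> B} \<partial>P x)"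
    by (rule strong_Markov[OF x(1) _ T A B(1)]) (use s in simp)
  also have "\<dots> \<le> (\<integral>\<^sup>+ \<omega>. ennreal (1 - hit_by a y n) * indicator {\<omega> \<in> space (P x). ereal s < H y \<omega>} \<omega> \<partial>P x)"
  proof (rule nn_integral_mono_AE)
    show "AE \<omega> in P x. indicator {\<omega> \<in> ?A. alive_at X ?T \<omega>} \<omega> *
          emeasure (P (real_of_ereal (X (real_of_ereal (?T \<omega>)) \<omega>)))
            {\<omega>' \<in> space Om. path_from X 0 \<omega>' \<in> B}
      \<le> ennreal (1 - hit_by a y n) * indicator {\<omega> \<in> space (P x). ereal s < H y \<omega>} \<omega>"
      using AE_start[OF x(1)]
    proof eventually_elim
      case (elim \<omega>)
      show ?case
      proof (cases "\<omega> \<in> ?A")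
        case True
        then obtain z where z: "X s \<omega> = ereal z" "z \<in> I" "z < y" using alive elim by blast
        have "{\<omega>' \<in> space Om. path_from X 0 \<omega>' \<in> B} = {\<omega>' \<in> space (P z). ereal n < H y \<omega>'}"
          using B_iff[of _ 0] by (auto simp: space_P[OF z(2)] hit_path_from)
        then have "emeasure (P z) {\<omega>' \<in> space Om. path_from X 0 \<omega>' \<in> B} = ennreal (1 - hit_by z y n)"
          using emeasure_not_hit_by[OF z(2)] by simp
        also have "\<dots> \<le> ennreal (1 - hit_by a y n)"
          using hit_by_mono_start[OF a(1) z(2), of y n] I_ge[OF z(2)] a(2) z(3) by (intro ennreal_leI) auto
        finally show ?thesis using True z space_P[OF x(1)] by (auto split: split_indicator)
      qed (auto split: split_indicator)
    qed
  qed
  also have "\<dots> = ennreal (1 - hit_by a y n) * ennreal (1 - hit_by x y s)"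
    unfolding emeasure_not_hit_by[OF x(1), symmetric] by (rule nn_integral_cmult_indicator) measurable
  also have "\<dots> = ennreal ((1 - hit_by a y n) * (1 - hit_by x y s))"
    using hit_by_le_1[OF a(1)] hit_by_le_1[OF x(1)] by (simp add: ennreal_mult)
  finally show ?thesis
    unfolding emeasure_not_hit_by[OF x(1)] using hit_by_le_1[OF a(1)] hit_by_le_1[OF x(1)] by (subst (asm) ennreal_le_iff) auto
qed

text \<open>
  By regularity \<open>y\<close> is reached from the endpoint within some time \<open>n\<close> with positive probability.  Repeated
  trials of length \<open>n\<close> give a geometric bound for the probability of not having reached \<open>y\<close>.
\<close>

lemma hit_lap_0_left_endpoint:
  assumes a: "a \<in> I" "l = ereal a" and x: "x \<in> I" "x < y"
  shows "hit_lap 0 x y = 1"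
proof -
  have y: "y \<in> I" using I_ge[OF x(1)] x(2) by (intro in_I) (auto intro: le_less_trans)
  interpret pa: prob_space "P a" by (rule prob[OF a(1)])
  interpret px: prob_space "P x" by (rule prob[OF x(1)])
  note [measurable] = measurable_hit_P[OF x(1)] measurable_hit_P[OF a(1)]
  obtain n :: nat where n: "0 < hit_by a y n"
  proof (rule ccontr)
    assume "\<not> thesis"
    then have z: "hit_by a y n = 0" for n :: nat using \<open>\<not> thesis\<close> that[of n]
      unfolding hit_by_def by (metis measure_nonneg order_le_less)
    have "(\<lambda>n::nat. hit_by a y n) \<longlonglongrightarrow> measure (P a) (\<Union>n::nat. {\<omega> \<in> space (P a). H y \<omega> \<le> ereal n})"
      unfolding hit_by_def by (rule pa.finite_Lim_measure_incseq) (auto simp: incseq_def intro: order_trans)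
    moreover have "(\<Union>n::nat. {\<omega> \<in> space (P a). H y \<omega> \<le> ereal n}) = {\<omega> \<in> space (P a). H y \<omega> < \<infinity>}"
    proof (intro equalityI subsetI)
      fix \<omega> assume w: "\<omega> \<in> {\<omega> \<in> space (P a). H y \<omega> < \<infinity>}"
      then obtain n :: nat where "H y \<omega> < ereal n" using less_PInf_Ex_of_nat by auto
      then show "\<omega> \<in> (\<Union>n::nat. {\<omega> \<in> space (P a). H y \<omega> \<le> ereal n})" using w by (auto intro: less_imp_le)
    qed auto
    ultimately have "measure (P a) {\<omega> \<in> space (P a). H y \<omega> < \<infinity>} = 0"
      using LIMSEQ_unique[OF tendsto_const[of 0]] by (simp add: z)
    then show False using regular[OF a(1) y] by simp
  qed
  define c where "c = 1 - hit_by a y n"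
  have c: "0 \<le> c" "c < 1" using n hit_by_le_1[OF a(1)] by (auto simp: c_def)
  have step: "1 - hit_by x y (real k * real n) \<le> c ^ k" for k
  proof (induction k)
    case 0 then show ?case by (simp add: hit_by_def)
  next
    case (Suc k)
    have "1 - hit_by x y (real k * real n + real n) \<le> c * (1 - hit_by x y (real k * real n))"
      unfolding c_def by (rule hit_by_survival_step[OF a x]) auto
    also have "\<dots> \<le> c * c ^ k" using Suc c by (intro mult_left_mono) auto
    finally show ?case by (simp add: algebra_simps)
  qed
  have "1 - c ^ k \<le> hit_lap 0 x y" for k
  proof -
    have "hit_by x y (real k * real n) \<le> hit_lap 0 x y"
      unfolding hit_by_def prob_hit_finite[OF x(1)]
      by (intro px.finite_measure_mono) (auto intro: le_less_trans)
    then show ?thesis using step[of k] by simp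
  qed
  moreover have "(\<lambda>k. 1 - c ^ k) \<longlonglongrightarrow> 1 - 0" using c by (intro tendsto_intros LIMSEQ_realpow_zero)
  ultimately have "1 \<le> hit_lap 0 x y" using LIMSEQ_le_const2[of "\<lambda>k. 1 - c ^ k" 1] by auto
  moreover have "hit_lap 0 x y \<le> 1" unfolding prob_hit_finite[OF x(1)] by simp
  ultimately show ?thesis by simp
qed

lemma hit_lap_0_eq_1:
  assumes S: "scale_function P X I S" and m: "speed_measure P X I S m" and dens: "has_continuous_density I m"
    and bd: "left_boundary_ab P X I l S" and x: "x \<in> I" and xy: "x \<le> y"
  shows "hit_lap 0 x y = 1"
proof (cases "x = y")
  case True
  interpret px: prob_space "P x" by (rule prob[OF x])
  have "AE \<omega> in P x. H y \<omega> < \<infinity>"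
    using AE_start[OF x]
  proof eventually_elim
    case (elim \<omega>)
    then have "H y \<omega> \<le> ereal 0" unfolding hitting_time_eq_hit using True by (intro hit_le) auto
    then show ?case by (rule le_less_trans) simp
  qed
  then show ?thesis unfolding prob_hit_finite[OF x] using measurable_hit_P[OF x] by (subst px.prob_Collect_eq_1) auto
next
  case False
  then have lt: "x < y" using xy by simp
  show ?thesis
  proof (cases "scale_left I S = -\<infinity>")
    case True then show ?thesis by (rule hit_lap_0_unbounded_scale[OF S m dens _ x lt])
  next
    case False
    then obtain a where "a \<in> I" "l = ereal a" using bd by (auto simp: left_boundary_ab_def reflecting_def)
    then show ?thesis by (rule hit_lap_0_left_endpoint[OF _ _ x lt])
  qed
qed

end

section \<open>The diffusion with its scale and speed\<close>

lemma hit_le_ddmax: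
  assumes path: "lifetime_path l w" and \<delta>: "0 < \<delta>" and "hit y w \<le> ddtime \<delta> w" "ddtime \<delta> w = ereal D"
  shows "ereal y \<le> ddmax \<delta> w"
proof -
  have "hit y w < \<infinity>" using assms(3,4) by auto
  then obtain T where T: "0 \<le> T" "hit y w = ereal T" "w T = ereal y"
    using hit_attained[OF lifetime_pathD(1)[OF path]] by metis
  have "ddmax \<delta> w = (SUP s\<in>{0..D}. w s)" by (rule ddmax_eq[OF path \<delta> assms(4)])
  then show ?thesis using T assms(3,4) by (auto intro!: SUP_upper2[of T])
qed

text \<open>
  A drawdown below \<open>L\<close> ends strictly below \<open>L - \<delta>\<close>, yet not below the left endpoint.
\<close>

lemma no_drawdown_near_left_endpoint:
  assumes path: "lifetime_path l w" and \<delta>: "0 < \<delta>" and "w 0 \<le> ereal L" "ddtime \<delta> w < hit L w"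
  shows "l < ereal (L - \<delta>)"
proof -
  have "ddtime \<delta> w < \<infinity>" using assms(4) by auto
  then obtain D where D: "ddtime \<delta> w = ereal D" using ddtime_finite[OF path \<delta>] by auto
  obtain s where s: "0 \<le> s" "s < D" "w D + ereal \<delta> \<le> w s" using at_ddtime(3)[OF path \<delta> D] by auto
  have "w s < ereal L" using max_below_hit[OF path \<delta> assms(3), of D s] assms(4) D s by simp
  then have "w D < ereal (L - \<delta>)" using s(3) by (cases "w D"; cases "w s") auto
  moreover have "l \<le> w D" using lifetime_pathD(2)[OF path] at_ddtime(1)[OF path \<delta> D] by simp
  ultimately show ?thesis by (rule le_less_trans[rotated])
qed

locale drawdown_diffusion = regular_diffusion +
  fixes S :: "real \<Rightarrow> real" and m :: "real measure"
  assumes S: "scale_function P X I S" and C1: "C1_scale I S"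
    and m: "speed_measure P X I S m" and dens: "has_continuous_density I m"
    and bd: "left_boundary_ab P X I l S"
begin

lemma interior_I: "interior I = {x. l < ereal x}"
proof -
  have op: "open {x. l < ereal x}"
    using open_Collect_less[of "\<lambda>_. l" ereal] by (simp add: continuous_on_ereal)
  from state_interval show ?thesis
  proof
    assume "I = {x. l < ereal x}"
    then show ?thesis using op by (simp add: interior_open)
  next
    assume I: "I = {x. l \<le> ereal x}"
    show ?thesis
    proof (cases l)
      case (real r)
      then have "I = {r..}" "{x. l < ereal x} = {r<..}" using I by auto
      then show ?thesis by (simp add: interior_real_atLeast)
    next
      case MInf
      then show ?thesis using I by simp
    qed (use left_endpoint in simp)
  qed
qed

lemma open_interior_set: "open {x. l < ereal x}"
  using interior_I open_interior by metis

lemma S_strict: "strict_mono_on I S"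
  using S by (simp add: scale_function_def)

lemma S_less: "a \<in> I \<Longrightarrow> b \<in> I \<Longrightarrow> a < b \<Longrightarrow> S a < S b"
  using S_strict by (auto simp: strict_mono_on_def)

lemma DERIV_S: "l < ereal y \<Longrightarrow> (S has_real_derivative deriv S y) (at y)"
  using C1 by (simp add: C1_scale_def interior_I DERIV_deriv_iff_real_differentiable)

lemma cont_deriv_S: "continuous_on {x. l < ereal x} (deriv S)"
  using C1 by (simp add: C1_scale_def interior_I)

lemma isCont_deriv_S: "l < ereal y \<Longrightarrow> isCont (deriv S) y"
  using cont_deriv_S open_interior_set by (auto simp: continuous_on_eq_continuous_at)

lemma deriv_S_nonneg: "l < ereal y \<Longrightarrow> 0 \<le> deriv S y"
proof (rule tendsto_lowerbound)
  assume y: "l < ereal y"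
  show "((\<lambda>t. (S t - S y) / (t - y)) \<longlongrightarrow> deriv S y) (at_right y)"
    using DERIV_S[OF y] unfolding has_field_derivative_iff by (rule tendsto_mono[rotated]) (simp add: at_le)
  have "eventually (\<lambda>t. t \<in> {y<..<y + 1}) (at_right y)" by (rule eventually_at_right_real) simp
  then show "eventually (\<lambda>t. 0 \<le> (S t - S y) / (t - y)) (at_right y)"
  proof eventually_elim
    case (elim t)
    then have "S y < S t" using S_less in_I_above[OF y] by auto
    then show ?case using elim by simp
  qed
qed simp

text \<open>
  The density \<open>S'\<close> may vanish somewhere, hence integrals against \<open>dS\<close> are turned into Lebesgue integrals instead
  of changing variables.
\<close>

lemma dS_integral:
  assumes A: "A \<in> sets borel" "A \<subseteq> {x. l < ereal x}" and f: "continuous_on A f"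
  shows "set_integrable (dS I S) A f \<longleftrightarrow> set_integrable lborel A (\<lambda>z. deriv S z * (f z :: real))"
    and "(LINT z:A|dS I S. f z) = (LINT z:A|lborel. deriv S z * f z)"
proof -
  define g where "g z = indicator {x. l < ereal x} z * deriv S z" for z
  have [measurable]: "{x. l < ereal x} \<in> sets borel" using open_interior_set by simp
  have g[measurable]: "g \<in> borel_measurable lborel"
    unfolding g_def[abs_def] using borel_measurable_continuous_on_indicator[OF _ cont_deriv_S] by simp
  have g0: "AE z in lborel. 0 \<le> g z"
    using deriv_S_nonneg by (auto simp: g_def split: split_indicator)
  have d: "dS I S = density lborel (\<lambda>z. ennreal (g z))"
    unfolding dS_def interior_I g_def by (intro arg_cong[where f="density lborel"] ext) (auto split: split_indicator)
  have fm: "(\<lambda>z. indicator A z *\<^sub>R f z) \<in> borel_measurable lborel"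
    using borel_measurable_continuous_on_indicator[OF A(1) f] by simp
  have e: "g z *\<^sub>R (indicator A z *\<^sub>R f z) = indicator A z *\<^sub>R (deriv S z * f z)" for z
    using A(2) by (auto simp: g_def split: split_indicator)
  show "set_integrable (dS I S) A f \<longleftrightarrow> set_integrable lborel A (\<lambda>z. deriv S z * f z)"
    unfolding set_integrable_def d integrable_density[OF fm g g0] e ..
  show "(LINT z:A|dS I S. f z) = (LINT z:A|lborel. deriv S z * f z)"
    unfolding set_lebesgue_integral_def d integral_density[OF fm g g0] e ..
qed

text \<open>
  The increments of the left derivative are integrals of \<open>\<alpha> u\<close> against a measure with a continuous density.
  So the left derivative is itself differentiable, in particular continuous, and the one-sided derivative
  of \<open>u\<close> becomes a derivative.
\<close>

lemma eigenfunction_derivatives: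
  assumes u: "generator_eigenfunction I S m \<alpha> u"
    and m': "continuous_on (interior I) m'" "\<forall>y\<in>interior I. 0 \<le> m' y"
      "m = density lborel (\<lambda>y. ennreal (m' y) * indicator (interior I) y)"
    and y: "l < ereal y"
  shows "(left_S_deriv S u has_real_derivative \<alpha> * (m' y * u y)) (at y)"
    and "(u has_real_derivative left_S_deriv S u y * deriv S y) (at y)"
proof -
  let ?J = "{x. l < ereal x}"
  obtain a where a: "l < ereal a" "a < y" using ereal_dense2[OF y] by auto
  have J: "{a..y+1} \<subseteq> ?J" using a by (auto intro: less_le_trans)
  have uJ: "continuous_on ?J u" using u in_I unfolding generator_eigenfunction_def
    by (auto intro: continuous_on_subset)
  have mJ: "continuous_on ?J m'" using m'(1) by (simp add: interior_I)
  define g where "g z = indicator ?J z * m' z" for z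
  have [measurable]: "?J \<in> sets borel" using open_interior_set by simp
  have gm[measurable]: "g \<in> borel_measurable lborel"
    unfolding g_def[abs_def] using borel_measurable_continuous_on_indicator[OF _ mJ] by simp
  have g0: "AE z in lborel. 0 \<le> g z"
    using m'(2) by (auto simp: g_def interior_I split: split_indicator)
  have d: "m = density lborel (\<lambda>z. ennreal (g z))"
    unfolding m'(3) interior_I g_def by (intro arg_cong[where f="density lborel"] ext) (auto split: split_indicator)
  have int: "(LINT z:{a..<t}|m. u z) = (LBINT z=a..t. m' z * u z)" if "a \<le> t" for t
  proof -
    have sub: "{a..<t} \<subseteq> ?J" using a by (auto intro: less_le_trans)
    have fm: "(\<lambda>z. indicator {a..<t} z *\<^sub>R u z) \<in> borel_measurable lborel"
      using borel_measurable_continuous_on_indicator[OF _ continuous_on_subset[OF uJ sub]] by simp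
    have e: "g z *\<^sub>R (indicator {a..<t} z *\<^sub>R u z) = indicator {a..<t} z *\<^sub>R (m' z * u z)" for z
      using sub by (auto simp: g_def split: split_indicator)
    have "(LINT z:{a..<t}|m. u z) = (LBINT z:{a..<t}. m' z * u z)"
      unfolding set_lebesgue_integral_def d integral_density[OF fm gm g0] e ..
    then show ?thesis using that by (simp add: interval_integral_Ico)
  qed
  have cont: "continuous_on {a..y+1} (\<lambda>z. m' z * u z)"
    by (intro continuous_intros continuous_on_subset[OF mJ J] continuous_on_subset[OF uJ J])
  have "((\<lambda>t. LBINT z=a..t. m' z * u z) has_vector_derivative (m' y * u y)) (at y within {a..y+1})"
    by (rule interval_integral_FTC2[OF _ _ cont]) (use a in auto)
  then have "((\<lambda>t. LBINT z=a..t. m' z * u z) has_real_derivative (m' y * u y)) (at y)"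
    using at_within_interior[of y "{a..y+1}"] a
    by (simp add: has_real_derivative_iff_has_vector_derivative)
  then have "((\<lambda>t. left_S_deriv S u a + \<alpha> * (LBINT z=a..t. m' z * u z)) has_real_derivative \<alpha> * (m' y * u y)) (at y)"
    by (auto intro!: derivative_eq_intros)
  then show D': "(left_S_deriv S u has_real_derivative \<alpha> * (m' y * u y)) (at y)"
  proof (rule has_field_derivative_transform_within_open[of _ _ _ "{a<..<y+1}"])
    fix t assume t: "t \<in> {a<..<y+1}"
    then have "l < ereal t" using subsetD[OF J, of t] by auto
    then have "left_S_deriv S u t - left_S_deriv S u a = \<alpha> * (LINT z:{a..<t}|m. u z)"
      using u a t unfolding generator_eigenfunction_def interior_I by auto
    then show "left_S_deriv S u a + \<alpha> * (LBINT z=a..t. m' z * u z) = left_S_deriv S u t"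
      using int[of t] t by simp
  qed (use a in auto)
  show "(u has_real_derivative left_S_deriv S u y * deriv S y) (at y)"
  proof (rule DERIV_of_left_S_deriv[of a y "y+1"])
    have sub: "{a<..<y+1} \<subseteq> {a..y+1}" by auto
    show "continuous_on {a<..<y+1} u" using continuous_on_subset[OF uJ] J sub by (meson subset_trans)
    have "continuous_on I S" using S by (simp add: scale_function_def)
    moreover have I: "{a<..<y+1} \<subseteq> I" using in_I J sub by auto
    ultimately show "continuous_on {a<..<y+1} S" by (rule continuous_on_subset)
    show "strict_mono_on {a<..<y+1} S" using S_strict I by (rule monotone_on_subset)
    show "isCont (left_S_deriv S u) y" by (rule DERIV_isCont[OF D'])
    show "(S has_real_derivative deriv S y) (at y)" by (rule DERIV_S[OF y])
    fix t assume "a < t" "t < y + 1"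
    then have "t \<in> interior I" using subsetD[OF J, of t] by (simp add: interior_I)
    then obtain D where "(S_quotient S u t \<longlongrightarrow> D) (at_left t)"
      using u unfolding generator_eigenfunction_def by blast
    moreover from this have "left_S_deriv S u t = D"
      unfolding left_S_deriv_def by (intro tendsto_Lim) auto
    ultimately show "(S_quotient S u t \<longlongrightarrow> left_S_deriv S u t) (at_left t)" by simp
  qed (use a in auto)
qed

text \<open>
  In the derivative of \<open>\<psi>\<^sup>- \<phi> - \<psi> \<phi>\<^sup>-\<close> the terms with \<open>\<alpha> m'\<close> and those with \<open>S'\<close> cancel.
\<close>

lemma wronskian_constant:
  assumes "generator_eigenfunction I S m \<alpha> \<psi>" "generator_eigenfunction I S m \<alpha> \<phi>"
    and "l < ereal x" "l < ereal y"
  shows "wronskian S \<psi> \<phi> x = wronskian S \<psi> \<phi> y"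
proof -
  obtain m' where m': "continuous_on (interior I) m'" "\<forall>y\<in>interior I. 0 \<le> m' y"
    "m = density lborel (\<lambda>y. ennreal (m' y) * indicator (interior I) y)"
    using dens unfolding has_continuous_density_def by auto
  note d\<psi> = eigenfunction_derivatives[OF assms(1) m'] and d\<phi> = eigenfunction_derivatives[OF assms(2) m']
  have "(wronskian S \<psi> \<phi> has_real_derivative 0) (at z)" if "l < ereal z" for z
    unfolding wronskian_def[abs_def]
    by (rule DERIV_cong[OF DERIV_diff[OF DERIV_mult[OF d\<psi>(1)[OF that] d\<phi>(2)[OF that]]
            DERIV_mult[OF d\<psi>(2)[OF that] d\<phi>(1)[OF that]]]])
      (simp add: algebra_simps)
  then have *: "\<And>z. z \<in> {x. l < ereal x} \<Longrightarrow> (wronskian S \<psi> \<phi> has_real_derivative 0) (at z within {x. l < ereal x})"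
    by (auto intro: has_field_derivative_at_within)
  have "convex {x. l < ereal x}"
    by (auto simp: is_interval_convex_1[symmetric] is_interval_1 intro: less_le_trans)
  from has_field_derivative_zero_constant[OF this *] show ?thesis using assms(3,4) by auto
qed

context
  fixes x \<delta> :: real
  assumes x: "x \<in> I" and \<delta>: "0 < \<delta>"
begin

abbreviation "L \<equiv> lower_limit l \<delta> x"

text \<open>
  Either the start is at least \<open>\<delta>\<close> above the left endpoint and \<open>L\<close> is the start, or \<open>L\<close> is the point at
  distance \<open>\<delta>\<close> from the endpoint.
\<close>

lemma L_cases: "L = x \<or> l = ereal (L - \<delta>)" and x_le_L: "x \<le> L" and l_le: "l \<le> ereal (L - \<delta>)"
  using I_ge[OF x] left_endpoint by (cases l; auto simp: lower_limit_def max_def)+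

lemma l_less_L: "l < ereal L"
  using l_le \<delta> by (auto intro: le_less_trans)

lemma L_in_I: "L \<in> I"
  by (rule in_I[OF l_less_L])

lemma above_L: "L \<le> u \<Longrightarrow> l < ereal u" "L \<le> u \<Longrightarrow> u \<in> I" "L < u \<Longrightarrow> l < ereal (u - \<delta>)"
proof -
  show 1: "L \<le> u \<Longrightarrow> l < ereal u" using l_less_L by (auto intro: less_le_trans)
  then show "L \<le> u \<Longrightarrow> u \<in> I" using in_I by simp
  assume "L < u"
  then have "ereal (L - \<delta>) < ereal (u - \<delta>)" by simp
  then show "l < ereal (u - \<delta>)" using l_le by (rule le_less_trans[rotated])
qed

lemma AE_no_drawdown_before_L: "AE \<omega> in P x. \<not> \<theta> \<delta> \<omega> < H L \<omega>"
  using AE_start[OF x]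
proof eventually_elim
  case (elim \<omega>)
  show ?case
  proof
    assume d: "\<theta> \<delta> \<omega> < H L \<omega>"
    from L_cases show False
    proof
      assume "L = x"
      then have "H L \<omega> \<le> ereal 0" unfolding hitting_time_eq_hit using elim by (intro hit_le) auto
      then show False using d drawdown_0[OF \<delta>, of \<omega>] elim by (auto simp: zero_ereal_def)
    next
      assume "l = ereal (L - \<delta>)"
      moreover have "l < ereal (L - \<delta>)"
        using no_drawdown_near_left_endpoint[OF path \<delta>, of \<omega> L] elim x_le_L d
        unfolding hitting_time_eq_hit drawdown_time_eq_ddtime by simp
      ultimately show False by simp
    qed
  qed
qed

lemma surv_L:
  shows "surv \<alpha> \<delta> x L = hit_lap \<alpha> x L"
  unfolding surv_def hit_lap_def
proof (rule integral_cong_AE)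
  note [measurable] = measurable_hit_P[OF x] measurable_drawdown_P[OF \<delta> x]
  show "(\<lambda>\<omega>. disc \<alpha> (H L \<omega>) * before (H L) (\<theta> \<delta>) \<omega>) \<in> borel_measurable (P x)"
    "(\<lambda>\<omega>. disc \<alpha> (H L \<omega>)) \<in> borel_measurable (P x)" by measurable
  show "AE \<omega> in P x. disc \<alpha> (H L \<omega>) * before (H L) (\<theta> \<delta>) \<omega>
    = disc \<alpha> (H L \<omega>)"
    using AE_start[OF x] AE_no_drawdown_before_L
  proof eventually_elim
    case (elim \<omega>)
    then have "H L \<omega> < \<theta> \<delta> \<omega> \<or> H L \<omega> = \<infinity>"
      using before_ddtime_dichotomy[OF path \<delta>, of \<omega> L] x_le_L
      unfolding hitting_time_eq_hit drawdown_time_eq_ddtime by auto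
    then show ?case by auto
  qed
qed

text \<open>
  Multiplicativity is the renewal property, and the bounds are those by the two-sided exit problem with
  lower barriers \<open>v - \<delta>\<close> and \<open>a < u - \<delta>\<close>.
\<close>

lemma survival_from_kernels:
  assumes pq: "\<And>y. l < ereal y \<Longrightarrow> (p has_real_derivative p' y) (at y)"
      "\<And>y. l < ereal y \<Longrightarrow> (q has_real_derivative q' y) (at y)"
      "\<And>y. l < ereal y \<Longrightarrow> isCont p' y" "\<And>y. l < ereal y \<Longrightarrow> isCont q' y"
      "\<And>a v. l < ereal a \<Longrightarrow> a < v \<Longrightarrow> 0 < cross p q a v"
      "\<And>a. l < ereal a \<Longrightarrow> 0 < q a" "\<And>a v. l < ereal a \<Longrightarrow> a \<le> v \<Longrightarrow> q v \<le> q a"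
    and hb: "\<And>a u v. l < ereal a \<Longrightarrow> a < u \<Longrightarrow> u < v \<Longrightarrow> hit_before \<alpha> u v a = cross p q a u / cross p q a v"
    and \<alpha>: "0 \<le> \<alpha>" and pos: "0 < hit_lap \<alpha> x L"
  shows "drawdown_survival l p q p' q' \<delta> L (surv \<alpha> \<delta> x) (surv \<alpha> \<delta>)"
proof (unfold_locales; (fact \<delta> l_le pq)?)
  show "0 < surv \<alpha> \<delta> x L" using pos by (simp add: surv_L)
  fix u v :: real assume uv: "L \<le> u" "u < v"
  have u: "u \<in> I" by (rule above_L(2)[OF uv(1)])
  show "surv \<alpha> \<delta> x v = surv \<alpha> \<delta> x u * surv \<alpha> \<delta> u v"
    by (rule surv_mult[OF \<delta> x u _ uv(2)]) (use x_le_L uv in simp)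
  show "surv \<alpha> \<delta> u v \<le> 1"
    using surv_plus_drop_le_1[OF \<delta> \<alpha> u, of v] drop_nonneg[of \<alpha> \<delta> u v] by simp
  show "cross p q (v - \<delta>) u / cross p q (v - \<delta>) v \<le> surv \<alpha> \<delta> u v" if "v < u + \<delta>"
  proof -
    have "l < ereal (v - \<delta>)" using above_L(3)[of v] uv by simp
    then show ?thesis using hit_before_le_surv[OF \<delta> \<alpha> u uv(2) that] hb[of "v - \<delta>" u v] uv that by simp
  qed
  show "surv \<alpha> \<delta> u v \<le> cross p q a u / cross p q a v" if "l < ereal a" "a < u - \<delta>" for a
    using surv_le_hit_before[OF \<delta> \<alpha> u that(2), of v] hb[OF that(1) _ uv(2)] that \<delta> by simp
qed

lemma survival_scale: "drawdown_survival l S (\<lambda>_. 1) (deriv S) (\<lambda>_. 0) \<delta> L (surv 0 \<delta> x) (surv 0 \<delta>)"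
proof (rule survival_from_kernels)
  fix a v assume "l < ereal a" "a < v"
  then show "0 < cross S (\<lambda>_. 1) a v" using S_less[of a v] in_I_above[of a] by (simp add: cross_def)
next
  fix a u v assume "l < ereal a" "a < u" "u < v"
  then show "hit_before 0 u v a = cross S (\<lambda>_. 1) a u / cross S (\<lambda>_. 1) a v"
    using hit_before_scale(2)[OF S m dens] by (simp add: cross_def)
next
  show "0 < hit_lap 0 x L" using hit_lap_0_eq_1[OF S m dens bd x x_le_L] by simp
qed (auto intro: DERIV_S isCont_deriv_S)

lemma surv_0_L: "surv 0 \<delta> x L = 1"
  using hit_lap_0_eq_1[OF S m dens bd x x_le_L] by (simp add: surv_L)

lemma surv_0_prob: "surv 0 \<delta> x y = measure (P x) {\<omega> \<in> space (P x). H y \<omega> < \<theta> \<delta> \<omega>}"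
proof -
  note [measurable] = measurable_hit_P[OF x] measurable_drawdown_P[OF \<delta> x]
  have "surv 0 \<delta> x y = (LINT \<omega>|P x. indicator {\<omega> \<in> space (P x). H y \<omega> < \<theta> \<delta> \<omega>} \<omega>)"
    unfolding surv_def by (rule Bochner_Integration.integral_cong) (auto simp: disc_0 split: split_indicator)
  then show ?thesis by simp
qed

section \<open>The law of the maximum\<close>

text \<open>
  Reaching \<open>v > y\<close> before the drawdown forces a maximum above \<open>y\<close>.  Conversely, a maximum above \<open>y\<close> at a finite
  drawdown time means that \<open>y\<close> was passed before; for an infinite drawdown time, when the maximum is \<open>\<infinity>\<close> by
  convention, it was passed because it almost surely is.  The gap between \<open>v\<close> and \<open>y\<close> closes by continuity
  of \<open>surv\<close>.
\<close>

lemma prob_max_greater: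
  assumes y: "L \<le> y"
  shows "measure (P x) {\<omega> \<in> space (P x). max_at_drawdown X \<delta> \<omega> > ereal y} = surv 0 \<delta> x y"
proof -
  interpret prob_space "P x" by (rule prob[OF x])
  interpret A: drawdown_survival l S "\<lambda>_. 1" "deriv S" "\<lambda>_. 0" \<delta> L "surv 0 \<delta> x" "surv 0 \<delta>" by (rule survival_scale)
  note [measurable] = measurable_hit_P[OF x] measurable_drawdown_P[OF \<delta> x] measurable_max_P[OF \<delta> x]
  have xy: "x \<le> y" using x_le_L y by simp
  have "AE \<omega> in P x. H y \<omega> < \<infinity>"
    using hit_lap_0_eq_1[OF S m dens bd x xy] unfolding prob_hit_finite[OF x]
    by (subst (asm) prob_Collect_eq_1) auto
  then have "AE \<omega> in P x. \<omega> \<in> {\<omega> \<in> space (P x). max_at_drawdown X \<delta> \<omega> > ereal y} \<longrightarrow>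
    \<omega> \<in> {\<omega> \<in> space (P x). H y \<omega> < \<theta> \<delta> \<omega>}"
    using AE_start[OF x]
  proof eventually_elim
    case (elim \<omega>)
    show ?case
    proof
      assume "\<omega> \<in> {\<omega> \<in> space (P x). max_at_drawdown X \<delta> \<omega> > ereal y}"
      then have "H y \<omega> < \<theta> \<delta> \<omega>"
        using ddmax_greater_imp_hit[OF path \<delta>, of \<omega> y] elim xy
        unfolding hitting_time_eq_hit drawdown_time_eq_ddtime max_at_drawdown_eq_ddmax
        by (cases "ddtime \<delta> (\<lambda>t. X t \<omega>) = \<infinity>") auto
      then show "\<omega> \<in> {\<omega> \<in> space (P x). H y \<omega> < \<theta> \<delta> \<omega>}" using elim space_P[OF x] by simp
    qed
  qed
  then have "prob {\<omega> \<in> space (P x). max_at_drawdown X \<delta> \<omega> > ereal y} \<le> surv 0 \<delta> x y"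
    unfolding surv_0_prob by (rule finite_measure_mono_AE) measurable
  moreover have "surv 0 \<delta> x y \<le> prob {\<omega> \<in> space (P x). max_at_drawdown X \<delta> \<omega> > ereal y}"
  proof (rule tendsto_upperbound)
    show "(surv 0 \<delta> x \<longlongrightarrow> surv 0 \<delta> x y) (at_right y)"
    proof (cases "L = y")
      case True then show ?thesis using A.G_right_start by simp
    next
      case False
      then have "isCont (surv 0 \<delta> x) y" using A.DERIV_G[of y] y by (intro DERIV_isCont) auto
      then show ?thesis unfolding isCont_def by (rule tendsto_mono[rotated]) (simp add: at_le)
    qed
    have "eventually (\<lambda>t. t \<in> {y<..<y + 1}) (at_right y)" by (rule eventually_at_right_real) simp
    then show "eventually (\<lambda>v. surv 0 \<delta> x v \<le> prob {\<omega> \<in> space (P x). max_at_drawdown X \<delta> \<omega> > ereal y}) (at_right y)"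
    proof eventually_elim
      case (elim v)
      show ?case unfolding surv_0_prob
      proof (rule finite_measure_mono_AE)
        show "AE \<omega> in P x. \<omega> \<in> {\<omega> \<in> space (P x). H v \<omega> < \<theta> \<delta> \<omega>} \<longrightarrow>
          \<omega> \<in> {\<omega> \<in> space (P x). max_at_drawdown X \<delta> \<omega> > ereal y}"
          using AE_start[OF x]
        proof eventually_elim
          case w: (elim \<omega>)
          then show ?case
            using hit_imp_ddmax_greater[OF path \<delta>, of \<omega> v y] elim xy
            unfolding hitting_time_eq_hit drawdown_time_eq_ddtime max_at_drawdown_eq_ddmax by auto
        qed
      qed measurable
    qed
  qed simp
  ultimately show ?thesis by simp
qed

theorem law_of_maximum:
  assumes y: "L \<le> y"
  shows "set_integrable (dS I S) {L<..y} (\<lambda>z. 1 / (S z - S (z - \<delta>)))"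
    and "measure (P x) {\<omega> \<in> space (P x). max_at_drawdown X \<delta> \<omega> > ereal y} =
       exp (- (LINT z:{L<..y}|dS I S. 1 / (S z - S (z - \<delta>))))"
proof -
  interpret A: drawdown_survival l S "\<lambda>_. 1" "deriv S" "\<lambda>_. 0" \<delta> L "surv 0 \<delta> x" "surv 0 \<delta>" by (rule survival_scale)
  have bb: "A.hazard z = deriv S z * (1 / (S z - S (z - \<delta>)))" for z
    by (simp add: A.hazard_def cross_def)
  have cont: "continuous_on {L<..y} (\<lambda>z. 1 / (S z - S (z - \<delta>)))"
  proof -
    have cS: "continuous_on I S" using S by (simp add: scale_function_def)
    have 1: "continuous_on {L<..y} S" by (rule continuous_on_subset[OF cS]) (auto intro: above_L)
    have 2: "continuous_on {L<..y} (\<lambda>z. S (z - \<delta>))"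
      by (rule continuous_on_compose2[OF cS]) (auto intro!: continuous_intros in_I[OF above_L(3)])
    have "S z - S (z - \<delta>) \<noteq> 0" if "z \<in> {L<..y}" for z
      using S_less[of "z - \<delta>" z] above_L(3)[of z] in_I[of "z - \<delta>"] above_L(2)[of z] that \<delta> by auto
    then show ?thesis using 1 2 by (intro continuous_intros) auto
  qed
  have sub: "{L<..y} \<subseteq> {x. l < ereal x}" using above_L(1) by auto
  note d = dS_integral[OF _ sub cont, folded bb]
  show "set_integrable (dS I S) {L<..y} (\<lambda>z. 1 / (S z - S (z - \<delta>)))"
  proof (cases "L = y")
    case True then show ?thesis by (simp add: set_integrable_def)
  next
    case False
    then show ?thesis using A.survival_integral(1)[of y] y d(1) by simp
  qed
  show "measure (P x) {\<omega> \<in> space (P x). max_at_drawdown X \<delta> \<omega> > ereal y} =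
       exp (- (LINT z:{L<..y}|dS I S. 1 / (S z - S (z - \<delta>))))"
  proof (cases "L = y")
    case True then show ?thesis using prob_max_greater[of L] surv_0_L by (simp add: set_lebesgue_integral_def)
  next
    case False
    then show ?thesis using A.survival_formula[of y] prob_max_greater[OF y] surv_0_L y d(2) by simp
  qed
qed

section \<open>The joint Laplace transform\<close>

text \<open>
  For a finite drawdown time this is \<open>exp (- \<alpha> \<theta> - \<beta> M)\<close>.  For an infinite one the first factor is \<open>0\<close>, as the
  convention for \<open>exp (- \<infinity>)\<close> demands, while \<^const>\<open>real_of_ereal\<close> keeps the second one finite.
\<close>

definition lap :: "real \<Rightarrow> real \<Rightarrow> 'a \<Rightarrow> real" where
  "lap \<alpha> \<beta> \<omega> = disc \<alpha> (\<theta> \<delta> \<omega>) * exp (- \<beta> * real_of_ereal (max_at_drawdown X \<delta> \<omega>))"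

lemma exp_neg_eq_lap:
  assumes \<omega>: "\<omega> \<in> space Om" and \<alpha>: "0 < \<alpha>" and \<beta>: "0 \<le> \<beta>"
  shows "exp_neg (ereal \<alpha> * \<theta> \<delta> \<omega> + ereal \<beta> * max_at_drawdown X \<delta> \<omega>) = lap \<alpha> \<beta> \<omega>"
proof (cases "\<theta> \<delta> \<omega> = \<infinity>")
  case True
  then have "max_at_drawdown X \<delta> \<omega> = \<infinity>" by (simp add: max_at_drawdown_def)
  then show ?thesis using True \<alpha> \<beta> by (cases "\<beta> = 0") (auto simp: exp_neg_def lap_def)
next
  case False
  then obtain D where D: "\<theta> \<delta> \<omega> = ereal D"
    using drawdown_0[OF \<delta> \<omega>] by (cases "\<theta> \<delta> \<omega>") auto
  then obtain k where k: "max_at_drawdown X \<delta> \<omega> = ereal k"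
    using ddmax_finite[OF path[OF \<omega>] \<delta>] unfolding drawdown_time_eq_ddtime max_at_drawdown_eq_ddmax by metis
  show ?thesis by (simp add: D k exp_neg_def lap_def disc_def exp_add[symmetric] exp_diff)
qed

lemma measurable_lap: "lap \<alpha> \<beta> \<in> borel_measurable (P x)"
proof -
  note [measurable] = measurable_drawdown_P[OF \<delta> x] measurable_max_P[OF \<delta> x]
  show ?thesis unfolding lap_def[abs_def] by measurable
qed

lemma lap_nonneg: "0 \<le> lap \<alpha> \<beta> \<omega>"
  by (simp add: lap_def)

lemma AE_lap_bound:
  assumes \<alpha>: "0 \<le> \<alpha>" and \<beta>: "0 \<le> \<beta>"
  shows "AE \<omega> in P x. lap \<alpha> \<beta> \<omega> \<le> exp (- \<beta> * x)"
  using AE_start[OF x]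
proof eventually_elim
  case (elim \<omega>)
  show ?case
  proof (cases "\<theta> \<delta> \<omega> = \<infinity>")
    case False
    then obtain D where D: "\<theta> \<delta> \<omega> = ereal D"
      using drawdown_0[OF \<delta>, of \<omega>] elim by (cases "\<theta> \<delta> \<omega>") auto
    then obtain k where k: "max_at_drawdown X \<delta> \<omega> = ereal k" "x \<le> k"
      using ddmax_finite[OF path \<delta>, of \<omega>] elim unfolding drawdown_time_eq_ddtime max_at_drawdown_eq_ddmax
      by (metis ereal_less_eq(3))
    have "disc \<alpha> (\<theta> \<delta> \<omega>) * exp (- \<beta> * k) \<le> 1 * exp (- \<beta> * x)"
      using disc_le_1[OF \<alpha> drawdown_0[OF \<delta>]] elim k \<beta> by (intro mult_mono) (auto simp: mult_left_mono)
    then show ?thesis by (simp add: lap_def k)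
  qed (simp add: lap_def)
qed

lemma integrable_lap:
  assumes \<alpha>: "0 \<le> \<alpha>" and \<beta>: "0 \<le> \<beta>" and R: "Measurable.pred (P x) R"
  shows "integrable (P x) (\<lambda>\<omega>. lap \<alpha> \<beta> \<omega> * indicator {\<omega>. R \<omega>} \<omega>)"
proof -
  interpret prob_space "P x" by (rule prob[OF x])
  note [measurable] = measurable_lap R
  show ?thesis
  proof (rule integrable_const_bound[where B="exp (- \<beta> * x)"])
    show "AE \<omega> in P x. norm (lap \<alpha> \<beta> \<omega> * indicator {\<omega>. R \<omega>} \<omega>) \<le> exp (- \<beta> * x)"
      using AE_lap_bound[OF \<alpha> \<beta>] by eventually_elim (auto simp: lap_nonneg split: split_indicator)
    show "(\<lambda>\<omega>. lap \<alpha> \<beta> \<omega> * indicator {\<omega>. R \<omega>} \<omega>) \<in> borel_measurable (P x)" by measurable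
  qed
qed

definition lap_upto :: "real \<Rightarrow> real \<Rightarrow> real \<Rightarrow> real" where
  "lap_upto \<alpha> \<beta> y = (LINT \<omega>|P x. lap \<alpha> \<beta> \<omega> * before (\<theta> \<delta>) (H y) \<omega>)"

lemma lap_upto_L: "lap_upto \<alpha> \<beta> L = 0"
proof -
  have "lap_upto \<alpha> \<beta> L = (LINT \<omega>|P x. 0)"
    unfolding lap_upto_def
  proof (rule integral_cong_AE)
    note [measurable] = measurable_lap pred_drawdown_hit[OF x \<delta>]
    show "(\<lambda>\<omega>. lap \<alpha> \<beta> \<omega> * before (\<theta> \<delta>) (H L) \<omega>) \<in> borel_measurable (P x)"
      by measurable
    show "AE \<omega> in P x. lap \<alpha> \<beta> \<omega> * before (\<theta> \<delta>) (H L) \<omega> = 0"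
      using AE_no_drawdown_before_L by eventually_elim auto
  qed simp
  then show ?thesis by simp
qed

text \<open>
  The maximum at a finite drawdown time is finite, so that every high level is reached later or not at
  all.
\<close>

lemma lap_upto_limit:
  assumes \<alpha>: "0 \<le> \<alpha>" and \<beta>: "0 \<le> \<beta>"
  shows "(lap_upto \<alpha> \<beta> \<longlongrightarrow> (LINT \<omega>|P x. lap \<alpha> \<beta> \<omega>)) at_top"
  unfolding lap_upto_def[abs_def]
proof (rule integral_dominated_convergence_at_top[where w="\<lambda>_. exp (- \<beta> * x)"])
  interpret prob_space "P x" by (rule prob[OF x])
  note [measurable] = measurable_lap pred_drawdown_hit[OF x \<delta>]
  show "lap \<alpha> \<beta> \<in> borel_measurable (P x)" by measurable
  show "(\<lambda>\<omega>. lap \<alpha> \<beta> \<omega> * before (\<theta> \<delta>) (H y) \<omega>) \<in> borel_measurable (P x)" for y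
    by measurable
  show "integrable (P x) (\<lambda>_. exp (- \<beta> * x))" by simp
  show "\<forall>\<^sub>F y in at_top. AE \<omega> in P x. norm (lap \<alpha> \<beta> \<omega> * before (\<theta> \<delta>) (H y) \<omega>) \<le> exp (- \<beta> * x)"
  proof (rule always_eventually, rule allI)
    fix y
    show "AE \<omega> in P x. norm (lap \<alpha> \<beta> \<omega> * before (\<theta> \<delta>) (H y) \<omega>) \<le> exp (- \<beta> * x)"
      using AE_lap_bound[OF \<alpha> \<beta>] by eventually_elim (auto simp: lap_nonneg split: split_indicator)
  qed
  show "AE \<omega> in P x. ((\<lambda>y. lap \<alpha> \<beta> \<omega> * before (\<theta> \<delta>) (H y) \<omega>) \<longlongrightarrow> lap \<alpha> \<beta> \<omega>) at_top"
    using AE_start[OF x]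
  proof eventually_elim
    case (elim \<omega>)
    show ?case
    proof (cases "\<theta> \<delta> \<omega> = \<infinity>")
      case False
      then obtain D where D: "\<theta> \<delta> \<omega> = ereal D"
        using drawdown_0[OF \<delta>, of \<omega>] elim by (cases "\<theta> \<delta> \<omega>") auto
      then obtain k where k: "max_at_drawdown X \<delta> \<omega> = ereal k"
        using ddmax_finite[OF path \<delta>, of \<omega>] elim unfolding drawdown_time_eq_ddtime max_at_drawdown_eq_ddmax
        by metis
      have before: "\<theta> \<delta> \<omega> < H y \<omega>" if "k < y" for y
      proof (rule ccontr)
        assume "\<not> ?thesis"
        then have "ereal y \<le> ereal k"
          using hit_le_ddmax[OF path \<delta>, of \<omega> y D] elim D k
          unfolding drawdown_time_eq_ddtime max_at_drawdown_eq_ddmax hitting_time_eq_hit by simp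
        then show False using that by simp
      qed
      have "eventually (\<lambda>y. lap \<alpha> \<beta> \<omega> * before (\<theta> \<delta>) (H y) \<omega> = lap \<alpha> \<beta> \<omega>) at_top"
        using eventually_gt_at_top[of k] by (rule eventually_mono) (simp add: before)
      then show ?thesis by (rule tendsto_eventually)
    qed (simp add: lap_def)
  qed
qed

text \<open>
  The increment is the expectation over \<open>H u < \<theta> < H v\<close>, where the maximum is between \<open>u\<close> and \<open>v\<close>.
\<close>

lemma lap_upto_increment:
  assumes \<alpha>: "0 \<le> \<alpha>" and \<beta>: "0 \<le> \<beta>" and uv: "L \<le> u" "u < v"
  shows "exp (- \<beta> * v) * (surv \<alpha> \<delta> x u * drop \<alpha> \<delta> u v) \<le> lap_upto \<alpha> \<beta> v - lap_upto \<alpha> \<beta> u"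
    and "lap_upto \<alpha> \<beta> v - lap_upto \<alpha> \<beta> u \<le> exp (- \<beta> * u) * (surv \<alpha> \<delta> x u * drop \<alpha> \<delta> u v)"
proof -
  note [measurable] = measurable_lap pred_drawdown_hit[OF x \<delta>] pred_hit_drawdown[OF x \<delta>] measurable_drawdown_P[OF \<delta> x]
  let ?R = "\<lambda>\<omega>. H u \<omega> < \<theta> \<delta> \<omega> \<and> \<theta> \<delta> \<omega> < H v \<omega>"
  have R: "Measurable.pred (P x) ?R" by measurable
  have xu: "x \<le> u" using x_le_L uv by simp
  have inc: "lap_upto \<alpha> \<beta> v - lap_upto \<alpha> \<beta> u = (LINT \<omega>|P x. lap \<alpha> \<beta> \<omega> * indicator {\<omega>. ?R \<omega>} \<omega>)"
  proof -
    have "lap_upto \<alpha> \<beta> v - lap_upto \<alpha> \<beta> u =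
      (LINT \<omega>|P x. lap \<alpha> \<beta> \<omega> * before (\<theta> \<delta>) (H v) \<omega>
        - lap \<alpha> \<beta> \<omega> * before (\<theta> \<delta>) (H u) \<omega>)"
      unfolding lap_upto_def
      by (intro Bochner_Integration.integral_diff[symmetric] integrable_lap \<alpha> \<beta> pred_drawdown_hit x \<delta>)
    also have "\<dots> = (LINT \<omega>|P x. lap \<alpha> \<beta> \<omega> * indicator {\<omega>. ?R \<omega>} \<omega>)"
    proof (rule integral_cong_AE)
      show "AE \<omega> in P x. lap \<alpha> \<beta> \<omega> * before (\<theta> \<delta>) (H v) \<omega>
        - lap \<alpha> \<beta> \<omega> * before (\<theta> \<delta>) (H u) \<omega> = lap \<alpha> \<beta> \<omega> * indicator {\<omega>. ?R \<omega>} \<omega>"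
        using AE_start[OF x]
      proof eventually_elim
        case (elim \<omega>)
        then have w: "\<omega> \<in> space Om" and s: "X 0 \<omega> \<le> ereal u" using xu by auto
        have le: "H u \<omega> \<le> H v \<omega>"
          unfolding hitting_time_eq_hit using hit_mono[OF continuous_paths[OF w] s, of v] uv by simp
        have "\<theta> \<delta> \<omega> < H u \<omega> \<or> H u \<omega> < \<theta> \<delta> \<omega> \<or>
          (H u \<omega> = \<infinity> \<and> \<theta> \<delta> \<omega> = \<infinity>)"
          using before_ddtime_dichotomy[OF path[OF w] \<delta> s]
          unfolding hitting_time_eq_hit drawdown_time_eq_ddtime .
        then show ?case using le by (auto split: split_indicator)
      qed
    qed measurable
    finally show ?thesis .
  qed
  have int1: "integrable (P x) (\<lambda>\<omega>. lap \<alpha> \<beta> \<omega> * indicator {\<omega>. ?R \<omega>} \<omega>)"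
    by (rule integrable_lap[OF \<alpha> \<beta> R])
  have int2: "integrable (P x) (\<lambda>\<omega>. disc \<alpha> (\<theta> \<delta> \<omega>) * indicator {\<omega>. ?R \<omega>} \<omega>)"
    by (rule integrable_disc_drawdown[OF \<delta> x \<alpha> R])
  have bounds: "AE \<omega> in P x. exp (- \<beta> * v) * (disc \<alpha> (\<theta> \<delta> \<omega>) * indicator {\<omega>. ?R \<omega>} \<omega>)
        \<le> lap \<alpha> \<beta> \<omega> * indicator {\<omega>. ?R \<omega>} \<omega> \<and>
      lap \<alpha> \<beta> \<omega> * indicator {\<omega>. ?R \<omega>} \<omega>
        \<le> exp (- \<beta> * u) * (disc \<alpha> (\<theta> \<delta> \<omega>) * indicator {\<omega>. ?R \<omega>} \<omega>)"
    using AE_start[OF x]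
  proof eventually_elim
    case (elim \<omega>)
    then have w: "\<omega> \<in> space Om" and s: "X 0 \<omega> \<le> ereal u" using xu by auto
    show ?case
    proof (cases "?R \<omega>")
      case True
      then have "ereal u \<le> max_at_drawdown X \<delta> \<omega>" "max_at_drawdown X \<delta> \<omega> \<le> ereal v"
        using running_max_between[OF path[OF w] \<delta> s, of v] uv
        unfolding hitting_time_eq_hit drawdown_time_eq_ddtime max_at_drawdown_eq_ddmax by auto
      then obtain k where k: "max_at_drawdown X \<delta> \<omega> = ereal k" "u \<le> k" "k \<le> v"
        by (cases "max_at_drawdown X \<delta> \<omega>") auto
      have e: "exp (- \<beta> * v) \<le> exp (- \<beta> * k)" "exp (- \<beta> * k) \<le> exp (- \<beta> * u)"
        using k \<beta> by (auto simp: mult_left_mono)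
      show ?thesis
        using True mult_right_mono[OF e(1) disc_nonneg[of \<alpha> "\<theta> \<delta> \<omega>"]]
          mult_right_mono[OF e(2) disc_nonneg[of \<alpha> "\<theta> \<delta> \<omega>"]]
        by (simp add: lap_def k mult.commute)
    qed simp
  qed
  have dr: "(LINT \<omega>|P x. disc \<alpha> (\<theta> \<delta> \<omega>) * indicator {\<omega>. ?R \<omega>} \<omega>) = surv \<alpha> \<delta> x u * drop \<alpha> \<delta> u v"
    by (rule drop_increment[OF \<delta> x above_L(2)[OF uv(1)] xu uv(2)])
  have "(LINT \<omega>|P x. exp (- \<beta> * v) * (disc \<alpha> (\<theta> \<delta> \<omega>) * indicator {\<omega>. ?R \<omega>} \<omega>))
      \<le> (LINT \<omega>|P x. lap \<alpha> \<beta> \<omega> * indicator {\<omega>. ?R \<omega>} \<omega>)"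
    by (rule integral_mono_AE[OF integrable_mult_right[OF int2] int1]) (use bounds in eventually_elim, simp)
  then show "exp (- \<beta> * v) * (surv \<alpha> \<delta> x u * drop \<alpha> \<delta> u v) \<le> lap_upto \<alpha> \<beta> v - lap_upto \<alpha> \<beta> u"
    unfolding inc integral_mult_right_zero dr .
  have "(LINT \<omega>|P x. lap \<alpha> \<beta> \<omega> * indicator {\<omega>. ?R \<omega>} \<omega>)
      \<le> (LINT \<omega>|P x. exp (- \<beta> * u) * (disc \<alpha> (\<theta> \<delta> \<omega>) * indicator {\<omega>. ?R \<omega>} \<omega>))"
    by (rule integral_mono_AE[OF int1 integrable_mult_right[OF int2]]) (use bounds in eventually_elim, simp)
  then show "lap_upto \<alpha> \<beta> v - lap_upto \<alpha> \<beta> u \<le> exp (- \<beta> * u) * (surv \<alpha> \<delta> x u * drop \<alpha> \<delta> u v)"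
    unfolding inc integral_mult_right_zero dr .
qed

context
  fixes \<alpha> \<beta> :: real and \<psi> \<phi> :: "real \<Rightarrow> real"
  assumes \<alpha>: "0 < \<alpha>" and \<beta>: "0 \<le> \<beta>"
    and inc: "increasing_solution P X I S m \<alpha> \<psi>" and dec: "decreasing_solution P X I S m \<alpha> \<phi>"
begin

lemma drawdown_law_solutions: "drawdown_law l \<psi> \<phi> (\<lambda>y. left_S_deriv S \<psi> y * deriv S y) (\<lambda>y. left_S_deriv S \<phi> y * deriv S y) \<delta> L
    (surv \<alpha> \<delta> x) (surv \<alpha> \<delta>) (lap_upto \<alpha> \<beta>) (drop \<alpha> \<delta>) \<beta> (LINT \<omega>|P x. lap \<alpha> \<beta> \<omega>)"
proof -
  have eig: "generator_eigenfunction I S m \<alpha> \<psi>" "generator_eigenfunction I S m \<alpha> \<phi>"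
    using inc dec by (auto simp: increasing_solution_def decreasing_solution_def)
  obtain m' where m': "continuous_on (interior I) m'" "\<forall>y\<in>interior I. 0 \<le> m' y"
    "m = density lborel (\<lambda>y. ennreal (m' y) * indicator (interior I) y)"
    using dens unfolding has_continuous_density_def by auto
  note d = eigenfunction_derivatives[OF eig(1) m'] eigenfunction_derivatives[OF eig(2) m']
  have \<alpha>0: "0 \<le> \<alpha>" using \<alpha> by simp
  interpret drawdown_survival l \<psi> \<phi> "\<lambda>y. left_S_deriv S \<psi> y * deriv S y" "\<lambda>y. left_S_deriv S \<phi> y * deriv S y" \<delta> L
    "surv \<alpha> \<delta> x" "surv \<alpha> \<delta>"
  proof (rule survival_from_kernels)
    fix a v assume "l < ereal a" "a < v"
    then show "0 < cross \<psi> \<phi> a v" using cross_pos[OF inc dec \<alpha>, of a v] in_I_above[of a] by simp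
  next
    fix a v assume "l < ereal a" "a \<le> v"
    then show "\<phi> v \<le> \<phi> a" using \<phi>_anti[OF inc dec \<alpha>, of a v] in_I_above[of a] by simp
  next
    fix a u v assume h: "l < ereal a" "a < u" "u < v"
    show "hit_before \<alpha> u v a = cross \<psi> \<phi> a u / cross \<psi> \<phi> a v"
      by (rule hit_before_laplace(1)[OF inc dec \<alpha>]) (use h in_I_above[of a] in auto)
  next
    show "0 < hit_lap \<alpha> x L"
      using hit_lap_up[OF inc dec \<alpha> x L_in_I x_le_L] \<psi>_pos[OF inc dec \<alpha>] x L_in_I by simp
  qed (auto intro!: d isCont_deriv_S continuous_intros DERIV_isCont[OF d(1)] DERIV_isCont[OF d(3)]
      \<phi>_pos[OF inc dec \<alpha>] in_I \<alpha>0)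
  show ?thesis
  proof
    show "0 \<le> \<beta>" by (rule \<beta>)
    show "lap_upto \<alpha> \<beta> L = 0" by (rule lap_upto_L)
    show "(lap_upto \<alpha> \<beta> \<longlongrightarrow> (LINT \<omega>|P x. lap \<alpha> \<beta> \<omega>)) at_top" by (rule lap_upto_limit[OF \<alpha>0 \<beta>])
    fix u v :: real assume uv: "L \<le> u" "u < v"
    have u: "u \<in> I" by (rule above_L(2)[OF uv(1)])
    show "exp (- \<beta> * v) * (surv \<alpha> \<delta> x u * drop \<alpha> \<delta> u v) \<le> lap_upto \<alpha> \<beta> v - lap_upto \<alpha> \<beta> u"
      "lap_upto \<alpha> \<beta> v - lap_upto \<alpha> \<beta> u \<le> exp (- \<beta> * u) * (surv \<alpha> \<delta> x u * drop \<alpha> \<delta> u v)"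
      by (rule lap_upto_increment[OF \<alpha>0 \<beta> uv])+
    show "0 \<le> drop \<alpha> \<delta> u v" by (rule drop_nonneg)
    show "drop \<alpha> \<delta> u v \<le> 1 - surv \<alpha> \<delta> u v" using surv_plus_drop_le_1[OF \<delta> \<alpha>0 u, of v] by simp
    show "drop \<alpha> \<delta> u v \<le> cross \<psi> \<phi> u v / cross \<psi> \<phi> (v - \<delta>) v" if "v < u + \<delta>"
    proof -
      have "l < ereal (v - \<delta>)" using above_L(3)[of v] uv by simp
      then have "hit_before \<alpha> u (v - \<delta>) v = cross \<psi> \<phi> u v / cross \<psi> \<phi> (v - \<delta>) v"
        using in_I_above[of "v - \<delta>"] uv that by (intro hit_before_laplace(2)[OF inc dec \<alpha>]) auto
      then show ?thesis using drop_le_hit_before[OF \<delta> \<alpha>0 u uv(2) that] by simp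
    qed
    show "cross \<psi> \<phi> u v / cross \<psi> \<phi> a v \<le> drop \<alpha> \<delta> u v" if "l < ereal a" "a < u - \<delta>" for a
    proof -
      have "hit_before \<alpha> u a v = cross \<psi> \<phi> u v / cross \<psi> \<phi> a v"
        using in_I_above[OF that(1)] uv that \<delta> by (intro hit_before_laplace(2)[OF inc dec \<alpha>]) auto
      then show ?thesis using hit_before_le_drop[OF \<delta> \<alpha>0 u that(2), of v] by simp
    qed
  qed
qed

text \<open>
  The inner integral of \<open>b\<close> is \<open>- ln (g(x,y) / g(x,L))\<close>, which turns the integrand into the derivative of
  \<open>lap_upto\<close> up to the constant factor \<open>g(x,L) = \<psi>(x) / \<psi>(L)\<close>.
\<close>

theorem laplace_transform:
  shows "integrable (P x) (\<lambda>\<omega>. exp_neg (ereal \<alpha> * \<theta> \<delta> \<omega> + ereal \<beta> * max_at_drawdown X \<delta> \<omega>))"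
    and "L < y \<Longrightarrow> set_integrable (dS I S) {L<..y} (b_fun S \<psi> \<phi> \<delta>)"
    and "set_integrable (dS I S) {L<..}
         (\<lambda>y. c_fun S \<psi> \<phi> \<delta> y * exp (- \<beta> * y - (LINT z:{L<..y}|dS I S. b_fun S \<psi> \<phi> \<delta> z)))"
    and "(LINT \<omega>|P x. exp_neg (ereal \<alpha> * \<theta> \<delta> \<omega> + ereal \<beta> * max_at_drawdown X \<delta> \<omega>)) =
       \<psi> x / \<psi> L * (LINT y:{L<..}|dS I S.
          c_fun S \<psi> \<phi> \<delta> y * exp (- \<beta> * y - (LINT z:{L<..y}|dS I S. b_fun S \<psi> \<phi> \<delta> z)))"
    and "L < y \<Longrightarrow> u \<in> interior I \<Longrightarrow> c_fun S \<psi> \<phi> \<delta> y = wronskian S \<psi> \<phi> u / bc_denom \<psi> \<phi> \<delta> y"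
proof -
  interpret A: drawdown_law l \<psi> \<phi> "\<lambda>y. left_S_deriv S \<psi> y * deriv S y" "\<lambda>y. left_S_deriv S \<phi> y * deriv S y" \<delta> L
    "surv \<alpha> \<delta> x" "surv \<alpha> \<delta>" "lap_upto \<alpha> \<beta>" "drop \<alpha> \<delta>" \<beta> "LINT \<omega>|P x. lap \<alpha> \<beta> \<omega>"
    by (rule drawdown_law_solutions)
  have eig: "generator_eigenfunction I S m \<alpha> \<psi>" "generator_eigenfunction I S m \<alpha> \<phi>"
    using inc dec by (auto simp: increasing_solution_def decreasing_solution_def)
  obtain m' where m': "continuous_on (interior I) m'" "\<forall>y\<in>interior I. 0 \<le> m' y"
    "m = density lborel (\<lambda>y. ennreal (m' y) * indicator (interior I) y)"
    using dens unfolding has_continuous_density_def by auto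
  note d = eigenfunction_derivatives[OF eig(1) m'] eigenfunction_derivatives[OF eig(2) m']
  have \<alpha>0: "0 \<le> \<alpha>" using \<alpha> by simp
  let ?b = "b_fun S \<psi> \<phi> \<delta>" and ?c = "c_fun S \<psi> \<phi> \<delta>" and ?G = "surv \<alpha> \<delta> x"
  have bb: "A.hazard z = deriv S z * ?b z" and cc: "A.drop_rate z = deriv S z * ?c z" for z
    unfolding A.hazard_def A.drop_rate_def b_fun_def c_fun_def cross_def bc_denom_def times_divide_eq_right
    by (rule arg_cong2[where f="(/)"]; simp add: algebra_simps)+
  have denom: "bc_denom \<psi> \<phi> \<delta> z \<noteq> 0" if "L < z" for z
    using A.cross_pos[OF above_L(3)[OF that], of z] \<delta> by (simp add: bc_denom_def cross_def)
  have cD: "continuous_on {L<..} (left_S_deriv S \<psi>)" "continuous_on {L<..} (left_S_deriv S \<phi>)"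
    by (auto intro!: continuous_at_imp_continuous_on DERIV_isCont[OF d(1)] DERIV_isCont[OF d(3)] above_L(1))
  have cI: "continuous_on I \<psi>" "continuous_on I \<phi>" using eig by (auto simp: generator_eigenfunction_def)
  have c0: "continuous_on {L<..} \<psi>" "continuous_on {L<..} \<phi>"
    by (auto intro!: continuous_on_subset[OF cI(1)] continuous_on_subset[OF cI(2)] above_L(2))
  have c1: "continuous_on {L<..} (\<lambda>z. \<psi> (z - \<delta>))" "continuous_on {L<..} (\<lambda>z. \<phi> (z - \<delta>))"
    by (auto intro!: continuous_on_compose2[OF cI(1)] continuous_on_compose2[OF cI(2)] continuous_intros in_I[OF above_L(3)])
  have cden: "continuous_on {L<..} (bc_denom \<psi> \<phi> \<delta>)"
    unfolding bc_denom_def[abs_def] by (intro continuous_intros c0 c1)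
  have cb: "continuous_on {L<..} ?b" and ccont: "continuous_on {L<..} ?c"
    unfolding b_fun_def[abs_def] c_fun_def[abs_def] using denom
    by (auto intro!: continuous_intros cD c0 c1 cden)
  have sub: "{L<..} \<subseteq> {x. l < ereal x}" using above_L(1) by auto
  have suby: "{L<..y} \<subseteq> {x. l < ereal x}" for y using above_L(1) by auto
  have cby: "continuous_on {L<..y} ?b" for y by (rule continuous_on_subset[OF cb]) auto
  note db = dS_integral[OF _ suby cby, folded bb]
  have GL: "?G L = \<psi> x / \<psi> L" using hit_lap_up[OF inc dec \<alpha> x L_in_I x_le_L] by (simp add: surv_L)
  have G: "?G y = \<psi> x / \<psi> L * exp (- (LINT z:{L<..y}|dS I S. ?b z))" if "L < y" for y
    using A.survival_formula[OF that] db(2)[of y] by (simp add: GL)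
  show "L < y \<Longrightarrow> set_integrable (dS I S) {L<..y} ?b" for y
    using A.survival_integral(1)[of y] db(1)[of y] by simp
  let ?f = "\<lambda>y. ?c y * exp (- \<beta> * y - (LINT z:{L<..y}|dS I S. ?b z))"
  let ?r = "\<psi> x / \<psi> L"
  have r: "0 < ?r" using \<psi>_pos[OF inc dec \<alpha>] x L_in_I by simp
  have f_eq: "?f y = ?c y * (exp (- \<beta> * y) * (?G y / ?r))" if "L < y" for y
  proof -
    have "?G y / ?r = exp (- (LINT z:{L<..y}|dS I S. ?b z))"
      unfolding G[OF that] by (rule nonzero_mult_div_cancel_left) (rule less_imp_neq[OF r, symmetric])
    then show ?thesis by (simp add: exp_diff exp_minus divide_inverse)
  qed
  have cG: "continuous_on {L<..} ?G"
    by (auto intro!: continuous_at_imp_continuous_on DERIV_isCont[OF A.DERIV_G])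
  have "continuous_on {L<..} (\<lambda>y. ?c y * (exp (- \<beta> * y) * (?G y / ?r)))"
    using r by (intro continuous_intros ccont cG) auto
  then have cf: "continuous_on {L<..} ?f"
    by (rule continuous_on_cong[THEN iffD2, rotated 2]) (rule refl, rule f_eq, simp)
  note df = dS_integral[OF _ sub cf]
  have e: "deriv S y * ?f y = (exp (- \<beta> * y) * (?G y * A.drop_rate y)) / ?r" if "y \<in> {L<..}" for y
    using f_eq[of y] that by (simp add: cc)
  have "set_integrable lborel {L<..} (\<lambda>y. (exp (- \<beta> * y) * (?G y * A.drop_rate y)) / ?r)"
    using A.law_integral(1) by (rule set_integrable_divide)
  also have "?this \<longleftrightarrow> set_integrable lborel {L<..} (\<lambda>y. deriv S y * ?f y)"
    by (rule set_integrable_cong[OF refl refl e[symmetric]])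
  finally show "set_integrable (dS I S) {L<..} ?f" using df(1) by simp
  have "(LINT y:{L<..}|dS I S. ?f y) = (LINT y:{L<..}|lborel. deriv S y * ?f y)" using df(2) by simp
  also have "\<dots> = (LINT y:{L<..}|lborel. (exp (- \<beta> * y) * (?G y * A.drop_rate y)) / ?r)"
    by (rule set_lebesgue_integral_cong) (simp, intro allI impI e)
  also have "\<dots> = (LINT \<omega>|P x. lap \<alpha> \<beta> \<omega>) / ?r" using A.law_integral(2) by simp
  finally have q: "(LINT y:{L<..}|dS I S. ?f y) = (LINT \<omega>|P x. lap \<alpha> \<beta> \<omega>) / ?r" .
  have *: "(LINT \<omega>|P x. lap \<alpha> \<beta> \<omega>) = ?r * (LINT y:{L<..}|dS I S. ?f y)"
    by (simp only: q times_divide_eq_right nonzero_mult_div_cancel_left[OF less_imp_neq[OF r, symmetric]])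
  have cong: "exp_neg (ereal \<alpha> * \<theta> \<delta> \<omega> + ereal \<beta> * max_at_drawdown X \<delta> \<omega>) = lap \<alpha> \<beta> \<omega>"
    if "\<omega> \<in> space (P x)" for \<omega>
    using exp_neg_eq_lap[OF _ \<alpha> \<beta>, of \<omega>] that space_P[OF x] by simp
  show "(LINT \<omega>|P x. exp_neg (ereal \<alpha> * \<theta> \<delta> \<omega> + ereal \<beta> * max_at_drawdown X \<delta> \<omega>)) =
    ?r * (LINT y:{L<..}|dS I S. ?f y)"
    unfolding *[symmetric] by (rule Bochner_Integration.integral_cong) (auto simp: cong)
  have "integrable (P x) (lap \<alpha> \<beta>)" using integrable_lap[OF \<alpha>0 \<beta>, of "\<lambda>_. True"] by simp
  then show "integrable (P x) (\<lambda>\<omega>. exp_neg (ereal \<alpha> * \<theta> \<delta> \<omega> + ereal \<beta> * max_at_drawdown X \<delta> \<omega>))"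
    by (rule Bochner_Integration.integrable_cong[THEN iffD2, rotated 2]) (auto simp: cong)
  show "L < y \<Longrightarrow> u \<in> interior I \<Longrightarrow> ?c y = wronskian S \<psi> \<phi> u / bc_denom \<psi> \<phi> \<delta> y" for y u
    using wronskian_constant[OF eig, of u y] above_L(1)[of y] interior_I
    by (simp add: c_fun_def wronskian_def algebra_simps)
qed

end

end

end

theorem theorem3p1:
  fixes Om :: "'a measure" and P :: "real \<Rightarrow> 'a measure" and X :: "real \<Rightarrow> 'a \<Rightarrow> ereal"
    and I :: "real set" and l :: ereal and S :: "real \<Rightarrow> real" and m :: "real measure"
    and \<psi> \<phi> :: "real \<Rightarrow> real \<Rightarrow> real"
  assumes "regular_diffusion Om P X I l"
    and "scale_function P X I S" and "C1_scale I S"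
    and "speed_measure P X I S m" and "has_continuous_density I m"
    and "class1 P X I l S \<or> class2 P X I l S"
    and "\<And>\<alpha>. 0 < \<alpha> \<Longrightarrow> increasing_solution P X I S m \<alpha> (\<psi> \<alpha>)"
    and "\<And>\<alpha>. 0 < \<alpha> \<Longrightarrow> decreasing_solution P X I S m \<alpha> (\<phi> \<alpha>)"
  shows "\<forall>x\<in>I. \<forall>\<delta>>0.
    (\<forall>\<alpha>>0. \<forall>\<beta>\<ge>0.
       integrable (P x) (\<lambda>\<omega>. exp_neg (ereal \<alpha> * drawdown_time X \<delta> \<omega>
                                     + ereal \<beta> * max_at_drawdown X \<delta> \<omega>)) \<and>
       (\<forall>y>lower_limit l \<delta> x.
          set_integrable (dS I S) {lower_limit l \<delta> x<..y} (b_fun S (\<psi> \<alpha>) (\<phi> \<alpha>) \<delta>)) \<and>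
       set_integrable (dS I S) {lower_limit l \<delta> x<..}
         (\<lambda>y. c_fun S (\<psi> \<alpha>) (\<phi> \<alpha>) \<delta> y *
            exp (- \<beta> * y - (LINT z:{lower_limit l \<delta> x<..y}|dS I S. b_fun S (\<psi> \<alpha>) (\<phi> \<alpha>) \<delta> z))) \<and>
       (LINT \<omega>|P x. exp_neg (ereal \<alpha> * drawdown_time X \<delta> \<omega>
                            + ereal \<beta> * max_at_drawdown X \<delta> \<omega>)) =
       \<psi> \<alpha> x / \<psi> \<alpha> (lower_limit l \<delta> x) *
       (LINT y:{lower_limit l \<delta> x<..}|dS I S.
          c_fun S (\<psi> \<alpha>) (\<phi> \<alpha>) \<delta> y *
            exp (- \<beta> * y - (LINT z:{lower_limit l \<delta> x<..y}|dS I S. b_fun S (\<psi> \<alpha>) (\<phi> \<alpha>) \<delta> z))) \<and>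
       (\<forall>y>lower_limit l \<delta> x. \<forall>u\<in>interior I.
          c_fun S (\<psi> \<alpha>) (\<phi> \<alpha>) \<delta> y = wronskian S (\<psi> \<alpha>) (\<phi> \<alpha>) u / bc_denom (\<psi> \<alpha>) (\<phi> \<alpha>) \<delta> y)) \<and>
    (\<forall>y\<ge>lower_limit l \<delta> x.
       set_integrable (dS I S) {lower_limit l \<delta> x<..y} (\<lambda>z. 1 / (S z - S (z - \<delta>))) \<and>
       measure (P x) {\<omega> \<in> space (P x). max_at_drawdown X \<delta> \<omega> > ereal y} =
       exp (- (LINT z:{lower_limit l \<delta> x<..y}|dS I S. 1 / (S z - S (z - \<delta>)))))"
proof -
  have "left_boundary_ab P X I l S" using assms(6) by (auto simp: class1_def class2_def)
  then interpret drawdown_diffusion Om P X I l S m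
    using assms(1-5) by (simp add: drawdown_diffusion_def drawdown_diffusion_axioms_def)
  show ?thesis
  proof (intro ballI allI impI conjI)
    fix x \<delta> :: real assume x: "x \<in> I" and \<delta>: "0 < \<delta>"
    {
      fix \<alpha> \<beta> :: real assume \<alpha>: "0 < \<alpha>" and \<beta>: "0 \<le> \<beta>"
      note T = laplace_transform[OF x \<delta> \<alpha> \<beta> assms(7)[OF \<alpha>] assms(8)[OF \<alpha>]]
      show "integrable (P x) (\<lambda>\<omega>. exp_neg (ereal \<alpha> * drawdown_time X \<delta> \<omega> + ereal \<beta> * max_at_drawdown X \<delta> \<omega>))"
        by (rule T(1))
      show "set_integrable (dS I S) {lower_limit l \<delta> x<..y} (b_fun S (\<psi> \<alpha>) (\<phi> \<alpha>) \<delta>)"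
        if "lower_limit l \<delta> x < y" for y
        by (rule T(2)[OF that])
      show "set_integrable (dS I S) {lower_limit l \<delta> x<..}
         (\<lambda>y. c_fun S (\<psi> \<alpha>) (\<phi> \<alpha>) \<delta> y *
            exp (- \<beta> * y - (LINT z:{lower_limit l \<delta> x<..y}|dS I S. b_fun S (\<psi> \<alpha>) (\<phi> \<alpha>) \<delta> z)))"
        by (rule T(3))
      show "(LINT \<omega>|P x. exp_neg (ereal \<alpha> * drawdown_time X \<delta> \<omega> + ereal \<beta> * max_at_drawdown X \<delta> \<omega>)) =
        \<psi> \<alpha> x / \<psi> \<alpha> (lower_limit l \<delta> x) *
        (LINT y:{lower_limit l \<delta> x<..}|dS I S. c_fun S (\<psi> \<alpha>) (\<phi> \<alpha>) \<delta> y *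
            exp (- \<beta> * y - (LINT z:{lower_limit l \<delta> x<..y}|dS I S. b_fun S (\<psi> \<alpha>) (\<phi> \<alpha>) \<delta> z)))"
        by (rule T(4))
      show "c_fun S (\<psi> \<alpha>) (\<phi> \<alpha>) \<delta> y = wronskian S (\<psi> \<alpha>) (\<phi> \<alpha>) u / bc_denom (\<psi> \<alpha>) (\<phi> \<alpha>) \<delta> y"
        if "lower_limit l \<delta> x < y" "u \<in> interior I" for y u
        by (rule T(5)[OF that])
    }
    fix y assume y: "lower_limit l \<delta> x \<le> y"
    show "set_integrable (dS I S) {lower_limit l \<delta> x<..y} (\<lambda>z. 1 / (S z - S (z - \<delta>)))"
      by (rule law_of_maximum(1)[OF x \<delta> y])
    show "measure (P x) {\<omega> \<in> space (P x). max_at_drawdown X \<delta> \<omega> > ereal y} =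
       exp (- (LINT z:{lower_limit l \<delta> x<..y}|dS I S. 1 / (S z - S (z - \<delta>))))"
      by (rule law_of_maximum(2)[OF x \<delta> y])
  qed
qed

end
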